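(* Let $0<r<n$ be integers, $\alpha,\beta\in\mathbb{C}$, $C\in M_{r,n-r}$, $D\in M_{n-r,r}$, and $$A=\begin{bmatrix}\alpha I_r & C\\ D&\beta I_{n-r}\end{bmatrix}\in M_n .$$ Suppose that the spectrum of $M(\theta)$ is independent of $\theta\in[0,2\pi)$. Let $s_1\ge\dots\ge s_p$ be the non-zero singular values of $C+D^*$, counting multiplicities, and let $m=\min\{n-r,r\}$, $m'=\max\{n-r,r\}$. If $n<2r$ (respectively $n>2r$), then $$\Lambda_k(A)=\begin{cases}E(\alpha,\beta;s_k), & 1\le k\le p,\\ [\alpha,\beta], & p<k\le m,\\ \{\alpha\}\ (\text{respectively }\{\beta\}), & m<k\le m',\\ \emptyset, & m'<k\le n.\end{cases}$$ If $n=2r$, then $$\Lambda_k(A)=\begin{cases}E(\alpha,\beta;s_k), & 1\le k\le p,\\ [\alpha,\beta], & p<k\le n/2,\\ \emptyset, & n/2<k\le n.\end{cases}$$ In particular, $W(A)=E(\alpha,\beta;\|C+D^*\|)$.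
   Context: $M_{m,n}$ is the set of $m\times n$ complex matrices and $M_n=M_{n,n}$. For $A\in M_n$ and $1\le k\le n$, the rank-$k$ numerical range is $$\Lambda_k(A)=\{\lambda\in\mathbb{C}: X^*AX=\lambda I_k \text{ for some } X\in M_{n,k}\text{ with }X^*X=I_k\},$$ and $W(A)=\Lambda_1(A)$ is the numerical range. For a square matrix $T$, $\Re(T)=(T+T^* )/2$. For $\theta\in[0,2\pi)$ put $$M_{C,D}(\theta)=C^*C+DD^*+2\,\Re(e^{-2i\theta}DC),\qquad M_{D,C}(\theta)=D^*D+CC^*+2\,\Re(e^{-2i\theta}CD),$$ and set $M(\theta)=M_{C,D}(\theta)$ if $n\le 2r$ and $M(\theta)=M_{D,C}(\theta)$ if $n>2r$. $E(\alpha,\beta;s)$ denotes the (closed) elliptical disc with foci at $\alpha$ and $\beta$ and minor axis of (full) length $s$ if $\alpha\ne\beta$ (the segment joining the foci when $s=0$), reduced to the circular disc centered at $\alpha$ of radius $s/2$ if $\alpha=\beta$. $[\alpha,\beta]$ is the line segment joining $\alpha$ and $\beta$, reduced to $\{\alpha\}$ if $\alpha=\beta$. $\|\cdot\|$ is the spectral (operator) norm.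
   Formalization: The claim that Λ_k(A) is empty for m'<k≤n (k>n/2 if n=2r) is stated only when α≠β or k>n−p; if α=β and m'<k≤n−p it is false: for n=2, r=1, α=β=0, C=D=0 one has Λ_2(A)={0}. *)

theory Defs
  imports
    "HOL-Analysis.Line_Segment"
    "Jordan_Normal_Form.Schur_Decomposition"
    "Jordan_Normal_Form.Spectral_Radius"
begin

text \<open>The rank-\<open>k\<close> numerical range of a square matrix, intended for \<open>1 \<le> k \<le> dim_row A\<close>.\<close>

definition rank_numerical_range :: "nat \<Rightarrow> complex mat \<Rightarrow> complex set" where
  "rank_numerical_range k A =
     {l. \<exists>X \<in> carrier_mat (dim_row A) k.
           mat_adjoint X * X = 1\<^sub>m k \<and> mat_adjoint X * A * X = l \<cdot>\<^sub>m 1\<^sub>m k}"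

definition numerical_range :: "complex mat \<Rightarrow> complex set" where
  "numerical_range A = rank_numerical_range 1 A"

definition hermitian_part :: "complex mat \<Rightarrow> complex mat" where
  "hermitian_part T = (1 / 2) \<cdot>\<^sub>m (T + mat_adjoint T)"

text \<open>
  For \<open>C\<close> of size \<open>r \<times> q\<close> and \<open>D\<close> of size \<open>q \<times> r\<close> this is \<open>M\<^bsub>C,D\<^esub>(\<theta>)\<close>, of size \<open>q\<close>; exchanging \<open>C\<close> and
  \<open>D\<close> gives \<open>M\<^bsub>D,C\<^esub>(\<theta>)\<close>, of size \<open>r\<close>.
\<close>

definition M_matrix :: "complex mat \<Rightarrow> complex mat \<Rightarrow> real \<Rightarrow> complex mat" where
  "M_matrix C D \<theta> =
     mat_adjoint C * C + D * mat_adjoint D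
       + 2 \<cdot>\<^sub>m hermitian_part (exp (- 2 * \<i> * complex_of_real \<theta>) \<cdot>\<^sub>m (D * C))"

text \<open>
  The non-zero singular values of \<open>G\<close>, with multiplicities and in non-increasing order: the square
  roots of the non-zero roots of the characteristic polynomial of \<open>G\<^sup>* G\<close>. These roots are
  non-negative reals stored as complex numbers, so \<open>Re\<close> loses no information.
  List positions start at 0, hence \<open>s\<^sub>k\<close> is \<open>nonzero_singular_values G ! (k - 1)\<close>.
\<close>

definition nonzero_singular_values :: "complex mat \<Rightarrow> real list" where
  "nonzero_singular_values G =
     rev (sorted_list_of_multiset
       (image_mset (\<lambda>x. sqrt (Re x))
         (filter_mset (\<lambda>x. x \<noteq> 0) (proots (char_poly (mat_adjoint G * G))))))"

definition l2_norm_vec :: "complex vec \<Rightarrow> real" where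
  "l2_norm_vec v = sqrt (\<Sum>i<dim_vec v. (cmod (v $ i))\<^sup>2)"

text \<open>The operator norm; the set of unit vectors is non-empty whenever \<open>G\<close> has a column.\<close>

definition spectral_norm :: "complex mat \<Rightarrow> real" where
  "spectral_norm G =
     (SUP v \<in> {v \<in> carrier_vec (dim_col G). l2_norm_vec v = 1}. l2_norm_vec (G *\<^sub>v v))"

text \<open>
  The closed elliptical disc with foci \<open>\<alpha>\<close> and \<open>\<beta>\<close> and minor axis of full length \<open>s \<ge> 0\<close>.
  With focal distance \<open>dist \<alpha> \<beta>\<close>, the major axis has full length \<open>sqrt ((dist \<alpha> \<beta>)\<^sup>2 + s\<^sup>2)\<close>,
  which is the bound on the sum of the distances to the foci. For \<open>s = 0\<close> this is the
  triangle equality, that is, the segment joining the foci.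
\<close>

definition elliptical_disc :: "complex \<Rightarrow> complex \<Rightarrow> real \<Rightarrow> complex set" where
  "elliptical_disc \<alpha> \<beta> s =
     (if \<alpha> = \<beta> then cball \<alpha> (s / 2)
      else {z. dist z \<alpha> + dist z \<beta> \<le> sqrt ((dist \<alpha> \<beta>)\<^sup>2 + s\<^sup>2)})"

end

theory Submission
  imports Defs
begin

text \<open>
  Write \<open>a = \<alpha> - z\<close>, \<open>b = \<beta> - z\<close>, \<open>B = A - z I\<close> and \<open>G(\<omega>) = \<omega> C + D\<^sup>*\<close> for \<open>|\<omega>| = 1\<close>.
  With \<open>\<omega> = exp (- 2 i \<theta>)\<close> the matrix \<open>M(\<theta>)\<close> is \<open>G(\<omega>)\<^sup>* G(\<omega>)\<close> or \<open>G(\<omega>) G(\<omega>)\<^sup>*\<close>. Its eigenvalues lie in a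
  fixed finite set, so the characteristic polynomial, being continuous in \<open>\<theta>\<close>, is constant: the
  singular values \<open>s\<^sub>j\<close> of \<open>G(\<omega>)\<close> do not depend on \<open>\<omega>\<close>.

  Upper bounds. If \<open>z \<in> \<Lambda>\<^sub>k(A)\<close>, the form of \<open>B\<close> vanishes on a \<open>k\<close>-dimensional space, whereas for a
  suitable \<open>|w| = 1\<close> the form \<open>Re (w x\<^sup>* B x)\<close> is definite on the vectors \<open>(u, v)\<close> with \<open>v\<close> in the span
  of the right singular vectors of index at least \<open>k\<close>, unless \<open>z\<close> lies in the ellipse for \<open>s\<^sub>k\<close>.

  Lower bounds. Constancy of the singular values factors the determinant of the pencil,
  \<open>det (\<omega> B + B\<^sup>*) = (\<omega> a + conj a)\<^bsup>r-p\<^esup> (\<omega> b + conj b)\<^bsup>n-r-p\<^esup> \<Prod>\<^sub>j ((\<omega> a + conj a) (\<omega> b + conj b) - \<omega> s\<^sub>j\<^sup>2)\<close>,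
  and the \<open>j\<close>-th quadratic factor has a root inside the unit disc exactly when \<open>z\<close> is interior to the
  ellipse for \<open>s\<^sub>j\<close>. By Schur triangularization of \<open>T = - B\<inverse> B\<^sup>*\<close>, which satisfies \<open>T\<^sup>* B T = B\<close>, the
  first \<open>k\<close> such roots give a \<open>k\<close>-dimensional \<open>T\<close>-invariant space on which \<open>T\<close> is stable, so the form of
  \<open>B\<close> vanishes there. Boundary points follow by compactness. On the segment \<open>[\<alpha>, \<beta>]\<close> the pencil is in
  addition singular at a unimodular \<open>\<omega>\<close>, and an isotropic part of its kernel supplies the missing
  \<open>k - p\<close> dimensions.
\<close>

text \<open>The hypothesis fixes the singular values of \<open>G(\<omega>)\<close> but not its
  singular vectors, which may turn with \<open>\<omega>\<close>; so no unitary splitting of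
  \<open>A\<close> into 2-by-2 blocks can be read off. Two weaker pieces of information do the work:
  a singular basis for one \<open>\<omega>\<close> at a time for the upper bounds, and the
  determinant for all \<open>\<omega>\<close> for the spectrum of \<open>T\<close>. Both bounds meet
  in one pencil because \<open>w B + conj w B^*\<close> is \<open>conj w\<close> times
  \<open>\<omega> B + B^*\<close> when \<open>\<omega> = w^2\<close>. Divided by
  \<open>\<omega>\<close>, a quadratic factor is real on the unit circle with maximum
  \<open>2 |a b| + 2 Re (a conj b) - s_j^2\<close>. At an interior point it has no unimodular root,
  and as the product of its roots is unimodular, exactly one root is stable. Strictly inside the
  segment there are only \<open>p\<close> stable eigenvalues. The linear factors share the
  unimodular root \<open>- conj a / a\<close>, where invariance of the form says nothing about
  eigenvectors, since \<open>conj \<omega> \<omega> = 1\<close>. Isotropy has to be built by hand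
  inside that eigenspace, while its mixed products with the stable space vanish as before.\<close>

unbundle no vec_syntax and no inner_syntax

subsection \<open>Adjoints and inner products\<close>

lemma mat_adjoint_eq: "mat_adjoint A = mat (dim_col A) (dim_row A) (\<lambda>(i, j). conjugate (A $$ (j, i)))"
  by (rule eq_matI) (auto simp: mat_adjoint_def mat_of_rows_def)

lemma dim_mat_adjoint [simp]:
  "dim_row (mat_adjoint A) = dim_col A" "dim_col (mat_adjoint A) = dim_row A"
  by (auto simp: mat_adjoint_eq)

lemma mat_adjoint_carrier [simp]: "A \<in> carrier_mat n m \<Longrightarrow> mat_adjoint A \<in> carrier_mat m n"
  by auto

lemma mat_adjoint_index [simp]:
  "i < dim_col A \<Longrightarrow> j < dim_row A \<Longrightarrow> mat_adjoint A $$ (i, j) = conjugate (A $$ (j, i))"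
  by (auto simp: mat_adjoint_eq)

lemma mat_adjoint_adjoint [simp]: "mat_adjoint (mat_adjoint A) = A"
  by (rule eq_matI) auto

lemma mat_adjoint_smult: "mat_adjoint (c \<cdot>\<^sub>m A) = conjugate c \<cdot>\<^sub>m mat_adjoint A"
  by (rule eq_matI) (auto simp: conjugate_dist_mul)

lemma mat_adjoint_uminus:
  fixes A :: "complex mat"
  shows "mat_adjoint (- A) = - mat_adjoint A"
  by (rule eq_matI) auto

lemma mat_adjoint_mult:
  "A \<in> carrier_mat n m \<Longrightarrow> B \<in> carrier_mat m l \<Longrightarrow> mat_adjoint (A * B) = mat_adjoint B * mat_adjoint A"
  by (rule eq_matI) (auto simp: scalar_prod_def sum_conjugate conjugate_dist_mul mult.commute)

lemma cscalar_mult_mat_vec: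
  fixes A :: "complex mat"
  assumes "A \<in> carrier_mat n m" "x \<in> carrier_vec m" "y \<in> carrier_vec n"
  shows "(A *\<^sub>v x) \<bullet>c y = x \<bullet>c (mat_adjoint A *\<^sub>v y)"
proof -
  have "(A *\<^sub>v x) \<bullet>c y = (\<Sum>i<n. \<Sum>j<m. A $$ (i, j) * x $ j * cnj (y $ i))"
    using assms by (auto simp: scalar_prod_def sum_distrib_right lessThan_atLeast0 intro!: sum.cong)
  also have "\<dots> = (\<Sum>j<m. \<Sum>i<n. A $$ (i, j) * x $ j * cnj (y $ i))"
    by (rule sum.swap)
  also have "\<dots> = x \<bullet>c (mat_adjoint A *\<^sub>v y)"
    using assms by (auto simp: scalar_prod_def sum_distrib_left lessThan_atLeast0 mult_ac intro!: sum.cong)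
  finally show ?thesis .
qed

lemma cscalar_conj:
  fixes x y :: "complex vec"
  assumes "x \<in> carrier_vec n" "y \<in> carrier_vec n"
  shows "y \<bullet>c x = cnj (x \<bullet>c y)"
  using assms by (auto simp: scalar_prod_def mult.commute)

text \<open>The product \<open>\<bullet>c\<close> conjugates its second argument, which is why the
  row index \<open>i\<close> appears on the right.\<close>

lemma adjoint_sandwich_index:
  fixes A X Y :: "complex mat"
  assumes "A \<in> carrier_mat n m" "X \<in> carrier_mat n k" "Y \<in> carrier_mat m l" "i < k" "j < l"
  shows "(mat_adjoint X * A * Y) $$ (i, j) = (A *\<^sub>v col Y j) \<bullet>c col X i"
proof -
  have "(mat_adjoint X * A * Y) = (mat_adjoint X * (A * Y))"
    using assms by (intro assoc_mult_mat) auto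
  also have "\<dots> $$ (i, j) = row (mat_adjoint X) i \<bullet> col (A * Y) j"
    using assms by (subst index_mult_mat(1)) auto
  also have "col (A * Y) j = A *\<^sub>v col Y j"
    using col_mult2[OF assms(1,3,5)] .
  also have "row (mat_adjoint X) i = conjugate (col X i)"
    using assms by (intro eq_vecI) auto
  finally show ?thesis using assms 
    by (simp add: comm_scalar_prod[of _ n])
qed

lemma adjoint_mult_index:
  fixes X Y :: "complex mat"
  assumes "X \<in> carrier_mat n k" "Y \<in> carrier_mat n l" "i < k" "j < l"
  shows "(mat_adjoint X * Y) $$ (i, j) = col Y j \<bullet>c col X i"
  using adjoint_sandwich_index[OF one_carrier_mat assms] assms
  by (simp add: right_mult_one_mat[of _ k n])

lemma cscalar_sandwich:
  fixes A X :: "complex mat"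
  assumes "A \<in> carrier_mat n n" "X \<in> carrier_mat n k" "c \<in> carrier_vec k" "d \<in> carrier_vec k"
  shows "(A *\<^sub>v (X *\<^sub>v c)) \<bullet>c (X *\<^sub>v d) = ((mat_adjoint X * A * X) *\<^sub>v c) \<bullet>c d"
proof -
  have "((mat_adjoint X * A * X) *\<^sub>v c) \<bullet>c d = (mat_adjoint X *\<^sub>v (A *\<^sub>v (X *\<^sub>v c))) \<bullet>c d"
  proof -
    have "(mat_adjoint X * A * X) *\<^sub>v c = (mat_adjoint X * A) *\<^sub>v (X *\<^sub>v c)"
      using assms by (intro assoc_mult_mat_vec) auto
    also have "\<dots> = mat_adjoint X *\<^sub>v (A *\<^sub>v (X *\<^sub>v c))"
      using assms by (intro assoc_mult_mat_vec) auto
    finally show ?thesis by simp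
  qed
  also have "\<dots> = (A *\<^sub>v (X *\<^sub>v c)) \<bullet>c (X *\<^sub>v d)"
    using assms by (subst cscalar_mult_mat_vec[of _ k n]) auto
  finally show ?thesis ..
qed

definition sqnorm :: "complex vec \<Rightarrow> real" where
  "sqnorm v = (\<Sum>i<dim_vec v. (cmod (v $ i))\<^sup>2)"

lemma sqnorm_cscalar: "v \<bullet>c v = complex_of_real (sqnorm v)"
  unfolding sqnorm_def of_real_sum scalar_prod_def
  by (auto simp: lessThan_atLeast0 complex_norm_square simp del: of_real_power intro!: sum.cong)

lemma sqnorm_nonneg [simp]: "0 \<le> sqnorm v"
  unfolding sqnorm_def by (rule sum_nonneg) auto

lemma sqnorm_eq_0: "v \<in> carrier_vec n \<Longrightarrow> sqnorm v = 0 \<longleftrightarrow> v = 0\<^sub>v n"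
  unfolding sqnorm_def by (subst sum_nonneg_eq_0_iff) (auto simp: vec_eq_iff)

lemma sqnorm_pos: "v \<in> carrier_vec n \<Longrightarrow> v \<noteq> 0\<^sub>v n \<Longrightarrow> 0 < sqnorm v"
  using sqnorm_eq_0[of v n] sqnorm_nonneg[of v] by linarith

lemma l2_norm_vec_sqnorm: "l2_norm_vec v = sqrt (sqnorm v)"
  by (simp add: l2_norm_vec_def sqnorm_def)

lemma sqnorm_smult: "sqnorm (c \<cdot>\<^sub>v v) = (cmod c)\<^sup>2 * sqnorm v"
  unfolding sqnorm_def by (simp add: norm_mult power_mult_distrib sum_distrib_left)

lemma sqnorm_adjoint:
  fixes X :: "complex mat"
  assumes "X \<in> carrier_mat n k" "c \<in> carrier_vec k"
  shows "complex_of_real (sqnorm (X *\<^sub>v c)) = ((mat_adjoint X * X) *\<^sub>v c) \<bullet>c c"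
  using cscalar_sandwich[OF one_carrier_mat assms(1) assms(2) assms(2)] assms
  by (simp add: sqnorm_cscalar right_mult_one_mat[of _ k n])

lemma sqnorm_isometry:
  fixes X :: "complex mat"
  assumes "X \<in> carrier_mat n k" "mat_adjoint X * X = 1\<^sub>m k" "c \<in> carrier_vec k"
  shows "sqnorm (X *\<^sub>v c) = sqnorm c"
  using sqnorm_adjoint[OF assms(1,3)] assms by (simp add: sqnorm_cscalar)

lemma unitary_right_inverse:
  fixes U :: "complex mat"
  assumes "U \<in> carrier_mat n n" "mat_adjoint U * U = 1\<^sub>m n"
  shows "U * mat_adjoint U = 1\<^sub>m n"
  using mat_mult_left_right_inverse[OF _ assms(1,2)] assms by auto

text \<open>Padding with zero rows gives a square matrix whose transpose kills
  \<open>unit_vec k m\<close>, so its determinant vanishes and it has a kernel vector.\<close>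

lemma wide_mat_kernel:
  fixes A :: "'a :: field mat"
  assumes A: "A \<in> carrier_mat m k" and mk: "m < k"
  obtains c where "c \<in> carrier_vec k" "c \<noteq> 0\<^sub>v k" "A *\<^sub>v c = 0\<^sub>v m"
proof -
  define B where "B = mat k k (\<lambda>(i, j). if i < m then A $$ (i, j) else 0)"
  have B: "B \<in> carrier_mat k k" by (simp add: B_def)
  have "(transpose_mat B) *\<^sub>v unit_vec k m = 0\<^sub>v k"
    using mk B by (intro eq_vecI) (auto simp: B_def scalar_prod_right_unit)
  hence "det (transpose_mat B) = 0"
    using det_0_iff_vec_prod_zero_field[of "transpose_mat B" k] B mk 
    by (metis transpose_carrier_mat unit_vec_carrier unit_vec_nonzero)
  hence "det B = 0" using det_transpose[OF B] by simp
  then obtain c where c: "c \<in> carrier_vec k" "c \<noteq> 0\<^sub>v k" "B *\<^sub>v c = 0\<^sub>v k"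
    using det_0_iff_vec_prod_zero_field[OF B] by blast
  have "A *\<^sub>v c = 0\<^sub>v m"
  proof (rule eq_vecI)
    fix i assume "i < dim_vec (0\<^sub>v m :: 'a vec)"
    hence i: "i < m" by simp
    have "row B i = row A i" using i mk A by (intro eq_vecI) (auto simp: B_def)
    moreover have "(B *\<^sub>v c) $ i = 0" using c(3) i mk by simp
    ultimately show "(A *\<^sub>v c) $ i = 0\<^sub>v m $ i" using i mk A B by simp
  qed (use A in auto)
  with c show ?thesis using that by blast
qed

text \<open>A kernel vector of \<open>R\<close> stacked on the adjoint of \<open>E\<close> is
  orthogonal to all columns found so far; there are \<open>m + h\<close> rows, so one exists as long
  as \<open>m + h < n\<close>.\<close>

lemma orthonormal_kernel:
  fixes R :: "complex mat"
  assumes R: "R \<in> carrier_mat m n" and h: "m + h \<le> n"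
  shows "\<exists>E \<in> carrier_mat n h. mat_adjoint E * E = 1\<^sub>m h \<and> R * E = 0\<^sub>m m h"
  using h
proof (induction h)
  case 0
  have "(0\<^sub>m n 0 :: complex mat) \<in> carrier_mat n 0" by simp
  moreover have "mat_adjoint (0\<^sub>m n 0 :: complex mat) * 0\<^sub>m n 0 = 1\<^sub>m 0" by (rule eq_matI) auto
  moreover have "R * 0\<^sub>m n 0 = 0\<^sub>m m 0" using R by (intro eq_matI) auto
  ultimately show ?case by blast
next
  case (Suc h)
  then obtain E where E: "E \<in> carrier_mat n h" "mat_adjoint E * E = 1\<^sub>m h" "R * E = 0\<^sub>m m h"
    by auto
  have "R @\<^sub>r mat_adjoint E \<in> carrier_mat (m + h) n"
    using R E by (intro carrier_append_rows) auto
  from wide_mat_kernel[OF this] Suc.prems obtain c where c: "c \<in> carrier_vec n" "c \<noteq> 0\<^sub>v n"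
    "(R @\<^sub>r mat_adjoint E) *\<^sub>v c = 0\<^sub>v (m + h)" by auto
  have "(R *\<^sub>v c) @\<^sub>v (mat_adjoint E *\<^sub>v c) = 0\<^sub>v m @\<^sub>v 0\<^sub>v h"
    using c(3) mat_mult_append[OF R _ c(1), of "mat_adjoint E" h] E(1)
    by (auto intro!: eq_vecI)
  hence Rc: "R *\<^sub>v c = 0\<^sub>v m" and Ec: "mat_adjoint E *\<^sub>v c = 0\<^sub>v h"
    using append_vec_eq[of "R *\<^sub>v c" m "0\<^sub>v m"] R mult_mat_vec_carrier[OF R c(1)] by auto
  define d where "d = complex_of_real (1 / sqrt (sqnorm c)) \<cdot>\<^sub>v c"
  have pos: "0 < sqnorm c" using sqnorm_pos[OF c(1,2)] .
  have d: "d \<in> carrier_vec n" "sqnorm d = 1"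
    using c pos by (auto simp: d_def sqnorm_smult power_divide norm_divide)
  have Rd: "R *\<^sub>v d = 0\<^sub>v m" and Ed: "mat_adjoint E *\<^sub>v d = 0\<^sub>v h"
    using mult_mat_vec[OF R c(1)] mult_mat_vec[of "mat_adjoint E" h n c] E(1) c(1) Rc Ec
    by (auto simp: d_def)
  have Ed': "col E i \<bullet>c d = 0" "d \<bullet>c col E i = 0" if "i < h" for i
  proof -
    have "(mat_adjoint E *\<^sub>v d) $ i = 0" using Ed that by simp
    moreover have "row (mat_adjoint E) i = conjugate (col E i)"
      using that E(1) by (intro eq_vecI) auto
    ultimately show "d \<bullet>c col E i = 0" using that E(1) d(1)
      by (simp add: comm_scalar_prod[of _ n])
    thus "col E i \<bullet>c d = 0" using cscalar_conj[of d n "col E i"] d(1) E(1) that by auto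
  qed
  define F where "F = mat_of_cols n (cols E @ [d])"
  have F: "F \<in> carrier_mat n (Suc h)" using E(1) by (auto simp: F_def)
  have colF: "col F i = (if i < h then col E i else d)" if "i < Suc h" for i
    using that E(1) d(1) by (auto simp: F_def nth_append cols_nth intro!: eq_vecI)
  have "mat_adjoint F * F = 1\<^sub>m (Suc h)"
  proof (rule eq_matI)
    fix i j assume "i < dim_row (1\<^sub>m (Suc h) :: complex mat)" "j < dim_col (1\<^sub>m (Suc h) :: complex mat)"
    hence ij: "i < Suc h" "j < Suc h" by auto
    have EE: "col E j \<bullet>c col E i = (if i = j then 1 else 0)" if "i < h" "j < h"
      using adjoint_mult_index[OF E(1) E(1) that] E(2) that by simp
    show "(mat_adjoint F * F) $$ (i, j) = 1\<^sub>m (Suc h) $$ (i, j)"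
      unfolding adjoint_mult_index[OF F F ij] colF[OF ij(1)] colF[OF ij(2)]
      using ij EE Ed' d(2) by (auto simp: sqnorm_cscalar)
  qed (use F in auto)
  moreover have "R * F = 0\<^sub>m m (Suc h)"
  proof (rule mat_col_eqI)
    fix i assume "i < dim_col (0\<^sub>m m (Suc h) :: complex mat)"
    hence i: "i < Suc h" by simp
    have "col (R * F) i = R *\<^sub>v col F i" using col_mult2[OF R F i] .
    also have "\<dots> = 0\<^sub>v m"
    proof (cases "i < h")
      case True
      have "R *\<^sub>v col E i = col (R * E) i" using col_mult2[OF R E(1) True] ..
      thus ?thesis using E(3) True colF[OF i] by simp
    qed (use colF[OF i] Rd in auto)
    finally show "col (R * F) i = col (0\<^sub>m m (Suc h)) i" using i by simp
  qed (use R F in auto)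
  ultimately show ?case using F by blast
qed

subsection \<open>The spectral theorem with prescribed order of the eigenvalues\<close>

lemma smult_mat_vec:
  fixes A :: "complex mat"
  assumes "A \<in> carrier_mat n m" "v \<in> carrier_vec m"
  shows "(a \<cdot>\<^sub>m A) *\<^sub>v v = a \<cdot>\<^sub>v (A *\<^sub>v v)"
  using assms by (intro eq_vecI) auto

lemma mat_diag_simps [simp]:
  "dim_row (mat_diag n f) = n" "dim_col (mat_diag n f) = n"
  "i < n \<Longrightarrow> j < n \<Longrightarrow> mat_diag n f $$ (i, j) = (if i = j then f j else 0)"
  by (auto simp: mat_diag_def)

lemma poly_char_poly:
  fixes A :: "complex mat"
  assumes "A \<in> carrier_mat n n"
  shows "poly (char_poly A) t = det (t \<cdot>\<^sub>m 1\<^sub>m n - A)"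
proof -
  have "- (char_matrix A t) = t \<cdot>\<^sub>m 1\<^sub>m n - A"
    using assms by (intro eq_matI) (auto simp: char_matrix_def)
  thus ?thesis using char_poly_matrix[OF assms] by simp
qed

text \<open>For Hermitian \<open>A\<close>, \<open><A f, d> = <f, A d> = conj e <f, d>\<close>, so
  the orthogonal complement of an eigenvector is invariant and both off-diagonal blocks vanish. The
  complement \<open>F\<close> is left free: it is taken first arbitrary, then diagonalizing the
  remaining block.\<close>

lemma unitary_cons_col:
  fixes A F :: "complex mat" and d :: "complex vec"
  assumes A: "A \<in> carrier_mat (Suc n) (Suc n)" "mat_adjoint A = A"
    and d: "d \<in> carrier_vec (Suc n)" "sqnorm d = 1" "A *\<^sub>v d = e \<cdot>\<^sub>v d"
    and F: "F \<in> carrier_mat (Suc n) n" "mat_adjoint F * F = 1\<^sub>m n"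
      "\<forall>i<n. col F i \<bullet>c d = 0"
  defines "W \<equiv> mat_of_cols (Suc n) (d # cols F)"
  shows "W \<in> carrier_mat (Suc n) (Suc n)" "mat_adjoint W * W = 1\<^sub>m (Suc n)"
    "mat_adjoint W * A * W = four_block_mat (mat 1 1 (\<lambda>_. e)) (0\<^sub>m 1 n) (0\<^sub>m n 1) (mat_adjoint F * A * F)"
proof -
  show W: "W \<in> carrier_mat (Suc n) (Suc n)" using F(1) by (auto simp: W_def)
  have col0: "col W 0 = d" using d by (auto simp: W_def intro!: eq_vecI)
  have colS: "col W (Suc i) = col F i" if "i < n" for i
    using that F(1) by (auto simp: W_def cols_nth intro!: eq_vecI)
  have dF: "d \<bullet>c col F i = 0" if "i < n" for i
    using cscalar_conj[of "col F i" "Suc n" d] F that d(1) by auto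
  show "mat_adjoint W * W = 1\<^sub>m (Suc n)"
  proof (rule eq_matI)
    fix i j assume "i < dim_row (1\<^sub>m (Suc n) :: complex mat)" "j < dim_col (1\<^sub>m (Suc n) :: complex mat)"
    hence ij: "i < Suc n" "j < Suc n" by auto
    have FF: "col F j \<bullet>c col F i = (if i = j then 1 else 0)" if "i < n" "j < n" for i j
      using adjoint_mult_index[OF F(1) F(1) that] F(2) that by simp
    show "(mat_adjoint W * W) $$ (i, j) = 1\<^sub>m (Suc n) $$ (i, j)"
      unfolding adjoint_mult_index[OF W W ij]
      using ij FF dF F(3) d(2) 
      by (cases i; cases j) (auto simp: col0 colS sqnorm_cscalar)
  qed (use W in auto)
  show "mat_adjoint W * A * W = four_block_mat (mat 1 1 (\<lambda>_. e)) (0\<^sub>m 1 n) (0\<^sub>m n 1) (mat_adjoint F * A * F)"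
    (is "_ = ?R")
  proof (rule eq_matI)
    fix i j assume "i < dim_row ?R" "j < dim_col ?R"
    hence ij: "i < Suc n" "j < Suc n" using F(1) by auto
    have FA: "(A *\<^sub>v col F i) \<bullet>c d = 0" if "i < n" for i
    proof -
      have "(A *\<^sub>v col F i) \<bullet>c d = col F i \<bullet>c (e \<cdot>\<^sub>v d)"
        using cscalar_mult_mat_vec[OF A(1), of "col F i" d] that F(1) d A(2) by auto
      also have "\<dots> = cnj e * (col F i \<bullet>c d)"
        using that F(1) d(1) by (simp add: conjugate_smult_vec)
      finally show ?thesis using F(3) that by simp
    qed
    show "(mat_adjoint W * A * W) $$ (i, j) = ?R $$ (i, j)"
      unfolding adjoint_sandwich_index[OF A(1) W W ij]
      using ij dF d F(1) adjoint_sandwich_index[OF A(1) F(1) F(1)] FA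
      by (cases i; cases j) (auto simp: col0 colS sqnorm_cscalar)
  qed (use W F(1) in auto)
qed

text \<open>Splitting off the head of \<open>es\<close> first makes the diagonal follow the given
  factorization. The order matters later: with decreasing singular values, the trailing basis
  vectors span a space on which \<open>G(\<omega>)\<close> has norm at most
  \<open>s_k\<close>.\<close>

lemma hermitian_diagonalization:
  fixes A :: "complex mat"
  assumes "A \<in> carrier_mat n n" "mat_adjoint A = A"
    and "char_poly A = (\<Prod>e\<leftarrow>es. [:- e, 1:])"
  shows "\<exists>U \<in> carrier_mat n n. mat_adjoint U * U = 1\<^sub>m n \<and> mat_adjoint U * A * U = mat_diag n (\<lambda>i. es ! i)"
  using assms
proof (induction es arbitrary: n A)
  case Nil
  have "n = 0" using degree_monic_char_poly[OF Nil(1)] Nil(3) by simp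
  hence "(1\<^sub>m n :: complex mat) \<in> carrier_mat n n \<and> mat_adjoint (1\<^sub>m n :: complex mat) * 1\<^sub>m n = 1\<^sub>m n 
    \<and> mat_adjoint (1\<^sub>m n) * A * 1\<^sub>m n = mat_diag n (\<lambda>i. [] ! i)"
    using Nil(1) by (auto intro!: eq_matI)
  thus ?case by blast
next
  case (Cons e es n A)
  note A = Cons.prems(1,2)
  have "degree (char_poly A) = Suc (length es)"
    unfolding Cons.prems(3) using degree_linear_factors[of uminus "e # es"] by simp
  then obtain n1 where n: "n = Suc n1" using degree_monic_char_poly[OF A(1)] by auto
  have "eigenvalue A e" unfolding eigenvalue_root_char_poly[OF A(1)] Cons.prems(3) by simp
  then obtain v where v: "v \<in> carrier_vec n" "v \<noteq> 0\<^sub>v n" "A *\<^sub>v v = e \<cdot>\<^sub>v v"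
    using A(1) unfolding eigenvalue_def eigenvector_def by auto
  define d where "d = complex_of_real (1 / sqrt (sqnorm v)) \<cdot>\<^sub>v v"
  have pos: "0 < sqnorm v" using sqnorm_pos[OF v(1,2)] .
  have d: "d \<in> carrier_vec n" "sqnorm d = 1" "A *\<^sub>v d = e \<cdot>\<^sub>v d"
    using v pos A(1) by (auto simp: d_def sqnorm_smult power_divide norm_divide mult_mat_vec smult_smult_assoc mult.commute)
  \<comment> \<open>Conjugated, because a row acts without conjugation; the kernel of
    \<open>R\<close> is the orthogonal complement of \<open>d\<close>.\<close>
  define R where "R = mat_of_rows n [conjugate d]"
  have R: "R \<in> carrier_mat 1 n" by (auto simp: R_def mat_of_rows_def)
  obtain E where E: "E \<in> carrier_mat n n1" "mat_adjoint E * E = 1\<^sub>m n1" "R * E = 0\<^sub>m 1 n1"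
    using orthonormal_kernel[OF R, of n1] n by auto
  have Ed: "\<forall>i<n1. col E i \<bullet>c d = 0"
  proof (intro allI impI)
    fix i assume that: "i < n1"
    have "(R * E) $$ (0, i) = conjugate d \<bullet> col E i"
      using that E(1) R d(1) by (subst index_mult_mat(1)) (auto simp: R_def)
    thus "col E i \<bullet>c d = 0" using E that d(1) by (simp add: comm_scalar_prod[of "conjugate d" n])
  qed
  note WE = unitary_cons_col[OF A[unfolded n] d[unfolded n] E(1)[unfolded n] E(2) Ed]
  define W where "W = mat_of_cols (Suc n1) (d # cols E)"
  define A3 where "A3 = mat_adjoint E * A * E"
  have A3: "A3 \<in> carrier_mat n1 n1" using E(1) A(1) by (auto simp: A3_def)
  have hA3: "mat_adjoint A3 = A3"
  proof -
    have "mat_adjoint A3 = mat_adjoint E * mat_adjoint (mat_adjoint E * A)"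
      unfolding A3_def using E(1) A(1) by (intro mat_adjoint_mult) auto
    also have "mat_adjoint (mat_adjoint E * A) = A * E"
      using mat_adjoint_mult[of "mat_adjoint E" n1 n A n] E(1) A by auto
    finally show ?thesis using E(1) A(1) by (simp add: A3_def assoc_mult_mat[of _ n1 n])
  qed
  have WW: "W * mat_adjoint W = 1\<^sub>m n"
    using unitary_right_inverse[OF WE(1,2)] by (simp add: W_def n)
  have "similar_mat_wit (mat_adjoint W * A * W) A (mat_adjoint W) W"
    by (rule similar_mat_witI[of _ _ n]) (use WE(1,2) WW A(1) in \<open>auto simp: W_def[symmetric] n\<close>)
  hence "char_poly (mat_adjoint W * A * W) = char_poly A"
    by (intro char_poly_similar) (auto simp: similar_mat_def)
  moreover have "char_poly (mat_adjoint W * A * W) = [:- e, 1:] * char_poly A3"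
  proof -
    have "char_poly (mat 1 1 (\<lambda>_. e)) = [:- e, 1:]"
      by (simp add: char_poly_defs det_def sign_def)
    thus ?thesis unfolding W_def WE(3) A3_def[symmetric]
      using char_poly_four_block_zeros_col[of "mat 1 1 (\<lambda>_. e)" "0\<^sub>m 1 n1" n1 A3] A3 by auto
  qed
  ultimately have "[:- e, 1:] * char_poly A3 = [:- e, 1:] * (\<Prod>e\<leftarrow>es. [:- e, 1:])"
    using Cons.prems(3) by simp
  hence "char_poly A3 = (\<Prod>e\<leftarrow>es. [:- e, 1:])"
    by (metis mult_cancel_left pCons_eq_0_iff zero_neq_one)
  from Cons.IH[OF A3 hA3 this] obtain V where V: "V \<in> carrier_mat n1 n1" "mat_adjoint V * V = 1\<^sub>m n1"
    "mat_adjoint V * A3 * V = mat_diag n1 (\<lambda>i. es ! i)" by blast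
  \<comment> \<open>Turning the complement \<open>E\<close> by \<open>V\<close> keeps it orthogonal
    to \<open>d\<close> and diagonalizes the compression \<open>A3\<close>.\<close>
  define F where "F = E * V"
  have F: "F \<in> carrier_mat n n1" using E(1) V(1) by (simp add: F_def)
  have colF: "col F i = E *\<^sub>v col V i" if "i < n1" for i
    unfolding F_def using col_mult2[OF E(1) V(1) that] .
  have FF: "mat_adjoint F * F = 1\<^sub>m n1"
  proof (rule eq_matI)
    fix i j assume "i < dim_row (1\<^sub>m n1 :: complex mat)" "j < dim_col (1\<^sub>m n1 :: complex mat)"
    hence ij: "i < n1" "j < n1" by auto
    have "(mat_adjoint F * F) $$ (i, j) = (1\<^sub>m n *\<^sub>v (E *\<^sub>v col V j)) \<bullet>c (E *\<^sub>v col V i)"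
      using adjoint_mult_index[OF F F ij] ij colF E(1) V(1) by simp
    also have "\<dots> = col V j \<bullet>c col V i"
      using cscalar_sandwich[OF one_carrier_mat E(1), of "col V j" "col V i"] V(1) ij E
      by (simp add: right_mult_one_mat[of _ n1 n])
    also have "\<dots> = (mat_adjoint V * V) $$ (i, j)"
      using adjoint_mult_index[OF V(1) V(1) ij] by simp
    finally show "(mat_adjoint F * F) $$ (i, j) = 1\<^sub>m n1 $$ (i, j)" using V(2) by simp
  qed (use F in auto)
  have FAF: "mat_adjoint F * A * F = mat_diag n1 (\<lambda>i. es ! i)"
  proof (rule eq_matI)
    fix i j assume "i < dim_row (mat_diag n1 (\<lambda>i. es ! i))" "j < dim_col (mat_diag n1 (\<lambda>i. es ! i))"
    hence ij: "i < n1" "j < n1" by auto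
    have "(mat_adjoint F * A * F) $$ (i, j) = (A *\<^sub>v (E *\<^sub>v col V j)) \<bullet>c (E *\<^sub>v col V i)"
      using adjoint_sandwich_index[OF A(1) F F ij] ij colF by simp
    also have "\<dots> = (A3 *\<^sub>v col V j) \<bullet>c col V i"
      using cscalar_sandwich[OF A(1) E(1), of "col V j" "col V i"] V(1) ij E
      by (simp add: A3_def)
    also have "\<dots> = (mat_adjoint V * A3 * V) $$ (i, j)"
      using adjoint_sandwich_index[OF A3 V(1) V(1) ij] by simp
    finally show "(mat_adjoint F * A * F) $$ (i, j) = mat_diag n1 (\<lambda>i. es ! i) $$ (i, j)" using V(3) by simp
  qed (use F in auto)
  have Fd: "\<forall>i<n1. col F i \<bullet>c d = 0"
  proof (intro allI impI)
    fix i assume that: "i < n1"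
    have z: "mat_adjoint E *\<^sub>v d = 0\<^sub>v n1"
    proof (rule eq_vecI)
      fix j assume "j < dim_vec (0\<^sub>v n1 :: complex vec)"
      hence j: "j < n1" by simp
      have "(mat_adjoint E *\<^sub>v d) $ j = conjugate (col E j) \<bullet> d"
      proof -
        have "row (mat_adjoint E) j = conjugate (col E j)"
          using j E(1) by (intro eq_vecI) auto
        thus ?thesis using j E(1) by simp
      qed
      also have "\<dots> = d \<bullet>c col E j" using j E(1) d(1) by (simp add: comm_scalar_prod[of _ n])
      also have "\<dots> = 0" using cscalar_conj[of "col E j" n d] Ed j E(1) d(1) j by auto
      finally show "(mat_adjoint E *\<^sub>v d) $ j = 0\<^sub>v n1 $ j" using j by simp
    qed (use E(1) in auto)
    show "col F i \<bullet>c d = 0" unfolding colF[OF that]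
      using cscalar_mult_mat_vec[OF E(1), of "col V i" d] V(1) that d(1) z by (simp add: scalar_prod_right_zero)
  qed
  note WF = unitary_cons_col[OF A[unfolded n] d[unfolded n] F[unfolded n] FF Fd]
  have "mat_adjoint (mat_of_cols (Suc n1) (d # cols F)) * A * mat_of_cols (Suc n1) (d # cols F)
      = mat_diag n (\<lambda>i. (e # es) ! i)"
    unfolding WF(3) FAF by (rule eq_matI) (auto simp: n nth_Cons')
  thus ?case using WF(1,2) unfolding n by blast
qed

text \<open>The eigenvectors of the Gram matrix are mapped by \<open>X\<close> to orthogonal
  vectors, non-zero by injectivity; \<open>Y\<close> consists of these eigenvectors,
  rescaled.\<close>

lemma orthonormalization:
  fixes X :: "complex mat"
  assumes X: "X \<in> carrier_mat n k" and inj: "\<And>c. c \<in> carrier_vec k \<Longrightarrow> X *\<^sub>v c = 0\<^sub>v n \<Longrightarrow> c = 0\<^sub>v k"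
  shows "\<exists>Y \<in> carrier_mat k k. mat_adjoint (X * Y) * (X * Y) = 1\<^sub>m k"
proof -
  define H where "H = mat_adjoint X * X"
  have H: "H \<in> carrier_mat k k" using X by (auto simp: H_def)
  have "mat_adjoint H = H" unfolding H_def using mat_adjoint_mult[of "mat_adjoint X" k n X k] X by simp
  moreover obtain es where "char_poly H = (\<Prod>e\<leftarrow>es. [:- e, 1:])" using char_poly_factorized[OF H] by blast
  ultimately obtain U where U: "U \<in> carrier_mat k k" "mat_adjoint U * U = 1\<^sub>m k"
    "mat_adjoint U * H * U = mat_diag k (\<lambda>i. es ! i)"
    using hermitian_diagonalization[OF H] by blast
  define w where "w i = X *\<^sub>v col U i" for i
  have w: "w i \<in> carrier_vec n" if "i < k" for i using X U(1) that by (auto simp: w_def)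
  have ww: "w j \<bullet>c w i = (if i = j then es ! i else 0)" if "i < k" "j < k" for i j
  proof -
    have "w j \<bullet>c w i = (H *\<^sub>v col U j) \<bullet>c col U i"
      using cscalar_sandwich[OF one_carrier_mat X, of "col U j" "col U i"] U(1) that X
      by (simp add: w_def H_def right_mult_one_mat[of _ k n])
    also have "\<dots> = (mat_adjoint U * H * U) $$ (i, j)"
      using adjoint_sandwich_index[OF H U(1) U(1) that] by simp
    finally show ?thesis using U(3) that by (simp add: mat_diag_def)
  qed
  have pos: "0 < sqnorm (w i)" if "i < k" for i
  proof -
    have "col U i \<noteq> 0\<^sub>v k"
      using adjoint_mult_index[OF U(1) U(1) that that] U that by auto
    hence "w i \<noteq> 0\<^sub>v n" using inj[of "col U i"] U(1) that unfolding w_def by auto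
    thus ?thesis using sqnorm_pos w[OF that] by blast
  qed
  define Y where "Y = mat k k (\<lambda>(i, j). complex_of_real (1 / sqrt (sqnorm (w j))) * U $$ (i, j))"
  have Y: "Y \<in> carrier_mat k k" by (simp add: Y_def)
  have colXY: "col (X * Y) j = complex_of_real (1 / sqrt (sqnorm (w j))) \<cdot>\<^sub>v w j" if "j < k" for j
  proof -
    have "col Y j = complex_of_real (1 / sqrt (sqnorm (w j))) \<cdot>\<^sub>v col U j"
      using that U(1) by (intro eq_vecI) (auto simp: Y_def)
    hence "X *\<^sub>v col Y j = complex_of_real (1 / sqrt (sqnorm (w j))) \<cdot>\<^sub>v w j"
      using mult_mat_vec[OF X, of "col U j"] U(1) that unfolding w_def by simp
    thus ?thesis using col_mult2[OF X Y that] by simp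
  qed
  have XY: "X * Y \<in> carrier_mat n k" using X Y by simp
  have "mat_adjoint (X * Y) * (X * Y) = 1\<^sub>m k"
  proof (rule eq_matI)
    fix i j assume "i < dim_row (1\<^sub>m k :: complex mat)" "j < dim_col (1\<^sub>m k :: complex mat)"
    hence ij: "i < k" "j < k" by auto
    have "(mat_adjoint (X * Y) * (X * Y)) $$ (i, j)
      = complex_of_real (1 / sqrt (sqnorm (w j))) * (complex_of_real (1 / sqrt (sqnorm (w i))) * (w j \<bullet>c w i))"
      using adjoint_mult_index[OF XY XY ij] colXY ij w[OF ij(1)] w[OF ij(2)] by (simp add: conjugate_smult_vec)
    also have "\<dots> = 1\<^sub>m k $$ (i, j)"
    proof (cases "i = j")
      case True
      define x where "x = sqnorm (w i)"
      have "1 / sqrt x * (1 / sqrt x * x) = 1"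
        using pos[OF ij(1)] by (simp add: x_def real_div_sqrt)
      hence "complex_of_real (1 / sqrt x) * (complex_of_real (1 / sqrt x) * complex_of_real x) = 1"
        unfolding of_real_mult[symmetric] by (simp only: of_real_1)
      thus ?thesis using True ij by (simp only: sqnorm_cscalar x_def index_one_mat if_True) simp
    qed (use ij ww in simp)
    finally show "(mat_adjoint (X * Y) * (X * Y)) $$ (i, j) = 1\<^sub>m k $$ (i, j)" .
  qed (use XY in \<open>simp_all add: Y_def\<close>)
  thus ?thesis using Y by blast
qed

subsection \<open>Membership in the higher-rank numerical range\<close>

text \<open>Isotropy under \<open>A - z\<close> does not depend on the basis of the subspace, so an
  injective \<open>X\<close> serves as well as an isometric one.\<close>

lemma rank_numerical_rangeI:
  assumes A: "A \<in> carrier_mat n n" and X: "X \<in> carrier_mat n k"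
    and inj: "\<And>c. c \<in> carrier_vec k \<Longrightarrow> X *\<^sub>v c = 0\<^sub>v n \<Longrightarrow> c = 0\<^sub>v k"
    and iso: "mat_adjoint X * (A - z \<cdot>\<^sub>m 1\<^sub>m n) * X = 0\<^sub>m k k"
  shows "z \<in> rank_numerical_range k A"
proof -
  obtain Y where Y: "Y \<in> carrier_mat k k" "mat_adjoint (X * Y) * (X * Y) = 1\<^sub>m k"
    using orthonormalization[OF X inj] by blast
  define Z where "Z = X * Y"
  have Z: "Z \<in> carrier_mat n k" "mat_adjoint Z * Z = 1\<^sub>m k" using X Y by (auto simp: Z_def)
  have B: "A - z \<cdot>\<^sub>m 1\<^sub>m n \<in> carrier_mat n n" using A by auto
  have "mat_adjoint Z * A * Z = z \<cdot>\<^sub>m 1\<^sub>m k"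
  proof (rule eq_matI)
    fix i j assume "i < dim_row (z \<cdot>\<^sub>m 1\<^sub>m k)" "j < dim_col (z \<cdot>\<^sub>m 1\<^sub>m k)"
    hence ij: "i < k" "j < k" by auto
    have col: "col Z j = X *\<^sub>v col Y j" if "j < k" for j
      unfolding Z_def using col_mult2[OF X Y(1) that] .
    have colY: "col Y j \<in> carrier_vec k" if "j < k" for j using Y(1) that by auto
    have colZ: "col Z j \<in> carrier_vec n" if "j < k" for j using Z(1) that by auto
    have "0 = ((A - z \<cdot>\<^sub>m 1\<^sub>m n) *\<^sub>v col Z j) \<bullet>c col Z i"
    proof -
      have "0\<^sub>m k k *\<^sub>v col Y j = 0\<^sub>v k" using colY[OF ij(2)] by (intro eq_vecI) auto
      thus ?thesis
        using cscalar_sandwich[OF B X colY[OF ij(2)] colY[OF ij(1)]] iso colY[OF ij(1)] ij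
        by (simp add: col)
    qed
    also have "(A - z \<cdot>\<^sub>m 1\<^sub>m n) *\<^sub>v col Z j = A *\<^sub>v col Z j - z \<cdot>\<^sub>v col Z j"
      using A colZ[OF ij(2)] 
      by (subst minus_mult_distrib_mat_vec[of _ n n]) (auto simp: smult_mat_vec[of _ n n])
    also have "\<dots> \<bullet>c col Z i = (A *\<^sub>v col Z j) \<bullet>c col Z i - z * (col Z j \<bullet>c col Z i)"
      using A colZ ij by (subst minus_scalar_prod_distrib[of _ n]) auto
    also have "(A *\<^sub>v col Z j) \<bullet>c col Z i = (mat_adjoint Z * A * Z) $$ (i, j)"
      using adjoint_sandwich_index[OF A Z(1) Z(1) ij] by simp
    also have "col Z j \<bullet>c col Z i = 1\<^sub>m k $$ (i, j)"
      using adjoint_mult_index[OF Z(1) Z(1) ij] Z(2) by simp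
    finally show "(mat_adjoint Z * A * Z) $$ (i, j) = (z \<cdot>\<^sub>m 1\<^sub>m k) $$ (i, j)" using ij by simp
  qed (use Z A in auto)
  thus ?thesis using Z A unfolding rank_numerical_range_def by auto
qed

lemma rank_numerical_rangeE:
  assumes A: "A \<in> carrier_mat n n" and z: "z \<in> rank_numerical_range k A"
  obtains X where "X \<in> carrier_mat n k"
    "\<And>c. c \<in> carrier_vec k \<Longrightarrow> (A *\<^sub>v (X *\<^sub>v c)) \<bullet>c (X *\<^sub>v c) = z * of_real (sqnorm (X *\<^sub>v c))"
    "\<And>c. c \<in> carrier_vec k \<Longrightarrow> sqnorm (X *\<^sub>v c) = sqnorm c"
proof -
  obtain X where X: "X \<in> carrier_mat n k" "mat_adjoint X * X = 1\<^sub>m k" "mat_adjoint X * A * X = z \<cdot>\<^sub>m 1\<^sub>m k"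
    using z A unfolding rank_numerical_range_def by auto
  have 1: "sqnorm (X *\<^sub>v c) = sqnorm c" if "c \<in> carrier_vec k" for c
    using sqnorm_isometry[OF X(1,2) that] .
  have "(A *\<^sub>v (X *\<^sub>v c)) \<bullet>c (X *\<^sub>v c) = z * of_real (sqnorm (X *\<^sub>v c))" if "c \<in> carrier_vec k" for c
    using cscalar_sandwich[OF A X(1) that that] that
    by (simp add: X(3) 1 smult_mat_vec[of _ k k] sqnorm_cscalar)
  thus ?thesis using that X(1) 1 by blast
qed

lemma sqnorm_diagonalized:
  fixes G U :: "complex mat"
  assumes G: "G \<in> carrier_mat r q" and U: "U \<in> carrier_mat q q"
    and d: "mat_adjoint U * (mat_adjoint G * G) * U = mat_diag q (\<lambda>i. complex_of_real (f i))"
    and c: "c \<in> carrier_vec q"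
  shows "sqnorm (G *\<^sub>v (U *\<^sub>v c)) = (\<Sum>i<q. f i * (cmod (c $ i))\<^sup>2)"
proof -
  have "complex_of_real (sqnorm (G *\<^sub>v (U *\<^sub>v c))) = ((mat_adjoint G * G) *\<^sub>v (U *\<^sub>v c)) \<bullet>c (U *\<^sub>v c)"
    using sqnorm_adjoint[OF G, of "U *\<^sub>v c"] U c by simp
  also have "\<dots> = (mat_diag q (\<lambda>i. complex_of_real (f i)) *\<^sub>v c) \<bullet>c c"
  proof -
    have "mat_adjoint G * G \<in> carrier_mat q q" using G by auto
    thus ?thesis using cscalar_sandwich[OF _ U c c] d by simp
  qed
  also have "\<dots> = (\<Sum>i<q. of_real (f i) * c $ i * cnj (c $ i))"
  proof -
    have "(mat_diag q (\<lambda>i. complex_of_real (f i)) *\<^sub>v c) $ i = of_real (f i) * c $ i" if "i < q" for i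
    proof -
      have "(mat_diag q (\<lambda>i. complex_of_real (f i)) *\<^sub>v c) $ i
        = (\<Sum>j\<in>{0..<q}. (if i = j then of_real (f j) else 0) * c $ j)"
        using that c by (simp add: scalar_prod_def)
      also have "\<dots> = (\<Sum>j\<in>{0..<q}. if j = i then of_real (f i) * c $ i else 0)"
        by (rule sum.cong) auto
      finally show ?thesis using that by simp
    qed
    thus ?thesis using c by (simp add: scalar_prod_def lessThan_atLeast0)
  qed
  also have "\<dots> = complex_of_real (\<Sum>i<q. f i * (cmod (c $ i))\<^sup>2)"
    unfolding of_real_sum of_real_mult complex_norm_square by (simp add: mult_ac)
  finally show ?thesis unfolding of_real_eq_iff .
qed

lemma mat_adjoint_mult_vec_carrier [simp]:
  "A \<in> carrier_mat n m \<Longrightarrow> mat_adjoint A *\<^sub>v v \<in> carrier_vec m"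
  by (auto intro: carrier_vecI)

lemma mult_mat_zero_vec:
  fixes A :: "complex mat"
  shows "A \<in> carrier_mat n m \<Longrightarrow> A *\<^sub>v 0\<^sub>v m = 0\<^sub>v n"
  by (intro eq_vecI) auto

subsection \<open>A matrix family with finitely many eigenvalues\<close>

lemma continuous_on_det:
  fixes K :: "real \<Rightarrow> complex mat"
  assumes "\<And>t. K t \<in> carrier_mat n n"
    and "\<And>i j. i < n \<Longrightarrow> j < n \<Longrightarrow> continuous_on UNIV (\<lambda>t. K t $$ (i, j))"
  shows "continuous_on UNIV (\<lambda>t. det (K t))"
proof -
  have "(\<lambda>t. det (K t)) = (\<lambda>t. \<Sum>p\<in>{p. p permutes {0..<n}}. signof p * (\<Prod>i = 0..<n. K t $$ (i, p i)))"
    using det_def'[OF assms(1)] by auto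
  moreover have "continuous_on UNIV (\<lambda>t. \<Sum>p\<in>{p. p permutes {0..<n}}. signof p * (\<Prod>i = 0..<n. K t $$ (i, p i)))"
  proof (intro continuous_intros assms(2))
    fix p i assume "p \<in> {p. p permutes {0..<n}}" "i \<in> {0..<n}"
    thus "p i < n" using permutes_in_image[of p "{0..<n}" i] by auto
  qed auto
  ultimately show ?thesis by (simp only:)
qed

text \<open>A constant spectrum does not fix multiplicities by itself; connectedness of the real
  line does. At a fixed \<open>x\<close> the value is a product of \<open>n\<close> factors
  \<open>x - e\<close> with \<open>e\<close> in \<open>S\<close>, so it takes finitely many values,
  and it is continuous in the parameter.\<close>

lemma char_poly_constant:
  fixes K :: "real \<Rightarrow> complex mat"
  assumes K: "\<And>t. K t \<in> carrier_mat n n"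
    and cont: "\<And>i j. i < n \<Longrightarrow> j < n \<Longrightarrow> continuous_on UNIV (\<lambda>t. K t $$ (i, j))"
    and fin: "finite S" and sp: "\<And>t. spectrum (K t) \<subseteq> S"
  shows "char_poly (K t) = char_poly (K u)"
proof -
  have "poly (char_poly (K t)) x = poly (char_poly (K u)) x" for x
  proof -
    define f where "f t = poly (char_poly (K t)) x" for t
    have f: "f = (\<lambda>t. det (x \<cdot>\<^sub>m 1\<^sub>m n - K t))"
      using poly_char_poly[OF K] by (intro ext) (simp add: f_def)
    have "continuous_on UNIV (\<lambda>t. det (x \<cdot>\<^sub>m 1\<^sub>m n - K t))"
    proof (rule continuous_on_det[of _ n])
      fix i j assume ij: "i < n" "j < n"
      have "(x \<cdot>\<^sub>m 1\<^sub>m n - K t) $$ (i, j) = (x \<cdot>\<^sub>m 1\<^sub>m n) $$ (i, j) - K t $$ (i, j)" for t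
        using ij K[of t] by (intro index_minus_mat(1)) auto
      moreover have "continuous_on UNIV (\<lambda>t. (x \<cdot>\<^sub>m 1\<^sub>m n) $$ (i, j) - K t $$ (i, j))"
        using cont[OF ij] by (auto intro!: continuous_intros)
      ultimately show "continuous_on UNIV (\<lambda>t. (x \<cdot>\<^sub>m 1\<^sub>m n - K t) $$ (i, j))"
        by (simp only:)
    qed (use K in \<open>intro minus_carrier_mat\<close>)
    hence c: "continuous_on UNIV f" unfolding f .
    have "range f \<subseteq> (\<lambda>es. \<Prod>e\<leftarrow>es. x - e) ` {es. set es \<subseteq> S \<and> length es = n}"
    proof
      fix y assume "y \<in> range f"
      then obtain t where y: "y = f t" by auto
      obtain es where es: "char_poly (K t) = (\<Prod>e\<leftarrow>es. [:- e, 1:])" "length es = n"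
        using char_poly_factorized[OF K] by blast
      have "set es \<subseteq> S"
      proof
        fix e assume e: "e \<in> set es"
        hence "0 \<in> set (map (\<lambda>x. e - x) es)" by force
        hence "poly (char_poly (K t)) e = 0"
          unfolding es(1) by (simp add: poly_prod_list o_def prod_list_zero_iff image_iff)
        thus "e \<in> S" using sp[of t] unfolding spectrum_root_char_poly[OF K] by (simp add: subset_iff)
      qed
      moreover have "f t = (\<Prod>e\<leftarrow>es. x - e)" by (simp add: f_def es poly_prod_list o_def)
      ultimately show "y \<in> (\<lambda>es. \<Prod>e\<leftarrow>es. x - e) ` {es. set es \<subseteq> S \<and> length es = n}" using es(2) y by auto
    qed
    hence "finite (range f)"
      by (rule finite_subset) (intro finite_imageI finite_lists_length_eq[OF fin])
    hence "f constant_on UNIV" by (rule continuous_finite_range_constant[OF connected_UNIV c])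
    then obtain y where "\<And>t. f t = y" unfolding constant_on_def by blast
    hence "f t = f u" by simp
    thus ?thesis unfolding f_def .
  qed
  thus ?thesis using poly_eq_poly_eq_iff by blast
qed

subsection \<open>Matrices with scalar diagonal blocks\<close>

definition rotated_off_diagonal :: "complex mat \<Rightarrow> complex mat \<Rightarrow> complex \<Rightarrow> complex mat" where
  "rotated_off_diagonal C D \<omega> = \<omega> \<cdot>\<^sub>m C + mat_adjoint D"

text \<open>Cauchy-Schwarz with a free weight \<open>t\<close>, obtained entrywise by completing the
  square. The weight distributes the cross term over \<open>|u|^2\<close> and
  \<open>|v|^2\<close>.\<close>

lemma Re_weak_Cauchy_Schwarz:
  fixes g u :: "complex vec"
  assumes "g \<in> carrier_vec n" "u \<in> carrier_vec n" "0 < t" "cmod w = 1"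
  shows "- (t * sqnorm u + sqnorm g / (4 * t)) \<le> Re (w * (g \<bullet>c u))"
proof -
  have "cmod (g \<bullet>c u) \<le> (\<Sum>i<n. cmod (g $ i) * cmod (u $ i))"
    using assms(1,2) by (auto simp: scalar_prod_def lessThan_atLeast0 norm_mult intro!: sum_norm_le)
  also have "\<dots> \<le> (\<Sum>i<n. t * (cmod (u $ i))\<^sup>2 + (cmod (g $ i))\<^sup>2 / (4 * t))"
  proof (rule sum_mono)
    fix i
    have "0 \<le> (2 * t * cmod (u $ i) - cmod (g $ i))\<^sup>2 / (4 * t)" using assms(3) by simp
    also have "\<dots> = t * (cmod (u $ i))\<^sup>2 + (cmod (g $ i))\<^sup>2 / (4 * t) - cmod (g $ i) * cmod (u $ i)"
      using assms(3) by (simp add: power2_eq_square field_simps)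
    finally show "cmod (g $ i) * cmod (u $ i) \<le> t * (cmod (u $ i))\<^sup>2 + (cmod (g $ i))\<^sup>2 / (4 * t)" by simp
  qed
  also have "\<dots> = t * sqnorm u + sqnorm g / (4 * t)"
    using assms(1,2) by (simp add: sqnorm_def sum.distrib sum_distrib_left sum_divide_distrib)
  finally have "cmod (w * (g \<bullet>c u)) \<le> t * sqnorm u + sqnorm g / (4 * t)"
    using assms(4) by (simp add: norm_mult)
  thus ?thesis using abs_Re_le_cmod[of "w * (g \<bullet>c u)"] by linarith
qed

text \<open>
  The quantity \<open>2 |a b| + 2 Re (a conj b)\<close> with \<open>a = \<alpha> - z\<close> and \<open>b = \<beta> - z\<close> describes both the
  elliptical discs and the maximum of \<open>4 Re (w a) Re (w b)\<close> over unimodular \<open>w\<close>.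
\<close>

definition ellipse_form :: "complex \<Rightarrow> complex \<Rightarrow> complex \<Rightarrow> real" where
  "ellipse_form \<alpha> \<beta> z = 2 * cmod ((\<alpha> - z) * (\<beta> - z)) + 2 * Re ((\<alpha> - z) * cnj (\<beta> - z))"

text \<open>Half the argument of \<open>a b\<close> makes \<open>w^2 a b\<close> equal to
  \<open>|a b|\<close>, and \<open>2 Re x Re y = Re (x y) + Re (x conj y)\<close> gives the product.
  Its positivity means equal signs, and replacing \<open>w\<close> by \<open>- w\<close> makes both
  positive.\<close>

lemma ex_rotation_pos:
  fixes a b :: complex
  assumes pos: "0 < 2 * cmod (a * b) + 2 * Re (a * cnj b)"
  obtains w where "cmod w = 1" "0 < Re (w * a)" "0 < Re (w * b)"
    "4 * (Re (w * a) * Re (w * b)) = 2 * cmod (a * b) + 2 * Re (a * cnj b)"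
proof -
  define w where "w = cis (- Arg (a * b) / 2)"
  have w: "cmod w = 1" by (simp add: w_def)
  have ww: "w * w * (a * b) = of_real (cmod (a * b))"
  proof -
    define m where "m = complex_of_real (cmod (a * b))"
    define t where "t = Arg (a * b)"
    have "w * w = cis (- t)" by (simp add: w_def cis_mult t_def)
    moreover have "a * b = m * cis t"
      using rcis_cmod_Arg[of "a * b"] by (simp add: rcis_def m_def t_def)
    ultimately have "w * w * (a * b) = m * (cis (- t) * cis t)" by (simp only: mult_ac)
    also have "cis (- t) * cis t = 1" by (simp add: cis_mult)
    finally show ?thesis by (simp only: m_def mult_1_right)
  qed
  have id: "2 * (Re x * Re y) = Re (x * y) + Re (x * cnj y)" for x y by simp
  have prod: "4 * (Re (w * a) * Re (w * b)) = 2 * cmod (a * b) + 2 * Re (a * cnj b)"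
  proof -
    have "w * cnj w = 1" using w complex_norm_square[of w] by simp
    moreover have "(w * a) * cnj (w * b) = (w * cnj w) * (a * cnj b)" by (simp add: mult_ac)
    ultimately have "(w * a) * cnj (w * b) = a * cnj b" by (simp only: mult_1_left)
    moreover have "(w * a) * (w * b) = of_real (cmod (a * b))" using ww by (simp add: mult_ac)
    ultimately have "2 * (Re (w * a) * Re (w * b)) = cmod (a * b) + Re (a * cnj b)"
      unfolding id by (simp only: Re_complex_of_real)
    thus ?thesis by linarith
  qed
  have "0 < Re (w * a) * Re (w * b)" using prod pos by linarith
  then consider "0 < Re (w * a)" "0 < Re (w * b)" | "Re (w * a) < 0" "Re (w * b) < 0"
    by (auto simp: zero_less_mult_iff)
  thus ?thesis
  proof cases
    case 1 thus ?thesis using that w prod by blast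
  next
    case 2
    have m: "Re (- w * c) = - Re (w * c)" for c by simp
    have "4 * (Re (- w * a) * Re (- w * b)) = 2 * cmod (a * b) + 2 * Re (a * cnj b)"
      using prod unfolding m minus_mult_minus .
    moreover have "0 < Re (- w * a)" "0 < Re (- w * b)" using 2 unfolding m by linarith+
    moreover have "cmod (- w) = 1" using w by simp
    ultimately show ?thesis using that by blast
  qed
qed

section \<open>Block matrices whose \<open>G(\<omega>)\<close> all have the same singular
  values\<close>

locale scalar_block_matrix =
  fixes r q :: nat and \<alpha> \<beta> :: complex and C D :: "complex mat" and s :: "real list"
  assumes C: "C \<in> carrier_mat r q" and D: "D \<in> carrier_mat q r"
    and s_pos: "\<And>x. x \<in> set s \<Longrightarrow> 0 < x" and s_sorted: "sorted_wrt (\<ge>) s"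
    and length_s: "length s \<le> q"
    and char_poly_gram: "\<And>\<omega>. cmod \<omega> = 1 \<Longrightarrow>
      char_poly (mat_adjoint (rotated_off_diagonal C D \<omega>) * rotated_off_diagonal C D \<omega>)
      = (\<Prod>e\<leftarrow>map (\<lambda>x. complex_of_real (x\<^sup>2)) s @ replicate (q - length s) 0. [:- e, 1:])"
begin

abbreviation "G \<equiv> rotated_off_diagonal C D"
abbreviation "p \<equiv> length s"
abbreviation "n \<equiv> r + q"

definition A :: "complex mat" where
  "A = four_block_mat (\<alpha> \<cdot>\<^sub>m 1\<^sub>m r) C D (\<beta> \<cdot>\<^sub>m 1\<^sub>m q)"

text \<open>Indexed from 0, so \<open>s_k\<close> is \<open>sv (k - 1)\<close>. The default value 0
  beyond \<open>p\<close> lets one upper bound cover the ellipses and, for \<open>k > p\<close>, the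
  segment.\<close>

definition sv :: "nat \<Rightarrow> real" where "sv i = (if i < p then s ! i else 0)"

lemma A_carrier [simp]: "A \<in> carrier_mat n n"
  unfolding A_def by auto

lemma G_carrier [simp]: "G \<omega> \<in> carrier_mat r q"
  using C D by (auto simp: rotated_off_diagonal_def)

lemma sv_nonneg: "0 \<le> sv i"
  using s_pos[of "s ! i"] by (auto simp: sv_def less_imp_le)

lemma sv_mono: "i \<le> j \<Longrightarrow> sv j \<le> sv i"
  using s_sorted s_pos[of "s ! i"] sorted_wrt_nth_less[of "(\<ge>)" s i j] 
  by (cases "i = j") (auto simp: sv_def less_imp_le)

text \<open>The right singular basis \<open>U\<close> depends on \<open>\<omega>\<close>; only the
  values \<open>sv i\<close> do not. The list in the locale hypothesis is already padded with zeros
  to length \<open>q\<close>, so it fixes the order of the basis.\<close>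

lemma svd:
  assumes "cmod \<omega> = 1"
  obtains U where "U \<in> carrier_mat q q" "mat_adjoint U * U = 1\<^sub>m q"
    "\<And>c. c \<in> carrier_vec q \<Longrightarrow> sqnorm (G \<omega> *\<^sub>v (U *\<^sub>v c)) = (\<Sum>i<q. (sv i)\<^sup>2 * (cmod (c $ i))\<^sup>2)"
proof -
  let ?es = "map (\<lambda>x. complex_of_real (x\<^sup>2)) s @ replicate (q - p) 0"
  define K where "K = mat_adjoint (G \<omega>) * G \<omega>"
  have K: "K \<in> carrier_mat q q" unfolding K_def by (rule mult_carrier_mat[OF mat_adjoint_carrier[OF G_carrier] G_carrier])
  have "mat_adjoint K = K" unfolding K_def
    using mat_adjoint_mult[OF mat_adjoint_carrier[OF G_carrier] G_carrier] by simp
  then obtain U where U: "U \<in> carrier_mat q q" "mat_adjoint U * U = 1\<^sub>m q"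
    "mat_adjoint U * K * U = mat_diag q (\<lambda>i. ?es ! i)"
    using hermitian_diagonalization[OF K _ char_poly_gram[OF assms, folded K_def]] by blast
  have "mat_diag q (\<lambda>i. ?es ! i) = mat_diag q (\<lambda>i. complex_of_real ((sv i)\<^sup>2))"
    by (rule eq_matI) (auto simp: sv_def nth_append)
  with U(3) have "mat_adjoint U * (mat_adjoint (G \<omega>) * G \<omega>) * U = mat_diag q (\<lambda>i. complex_of_real ((sv i)\<^sup>2))"
    by (simp only: K_def)
  from sqnorm_diagonalized[OF G_carrier U(1) this] that[OF U(1,2)] show ?thesis by blast
qed

lemma quadratic_form:
  assumes u: "u \<in> carrier_vec r" and v: "v \<in> carrier_vec q"
  shows "(A *\<^sub>v (u @\<^sub>v v)) \<bullet>c (u @\<^sub>v v)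
    = \<alpha> * of_real (sqnorm u) + \<beta> * of_real (sqnorm v) + (C *\<^sub>v v) \<bullet>c u + (D *\<^sub>v u) \<bullet>c v"
proof -
  have conj: "conjugate (u @\<^sub>v v) = conjugate u @\<^sub>v conjugate v"
    using u v by (intro eq_vecI) auto
  have "A *\<^sub>v (u @\<^sub>v v) = ((\<alpha> \<cdot>\<^sub>m 1\<^sub>m r) *\<^sub>v u + C *\<^sub>v v) @\<^sub>v (D *\<^sub>v u + (\<beta> \<cdot>\<^sub>m 1\<^sub>m q) *\<^sub>v v)"
    unfolding A_def using C D u v by (intro four_block_mat_mult_vec) auto
  also have "\<dots> = (\<alpha> \<cdot>\<^sub>v u + C *\<^sub>v v) @\<^sub>v (D *\<^sub>v u + \<beta> \<cdot>\<^sub>v v)"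
    using u v by (simp add: smult_mat_vec[of _ r r] smult_mat_vec[of _ q q])
  also have "\<dots> \<bullet>c (u @\<^sub>v v) = (\<alpha> \<cdot>\<^sub>v u + C *\<^sub>v v) \<bullet>c u + (D *\<^sub>v u + \<beta> \<cdot>\<^sub>v v) \<bullet>c v"
    unfolding conj using u v C D by (subst scalar_prod_append[of _ r _ q]) auto
  also have "\<dots> = (\<alpha> \<cdot>\<^sub>v u) \<bullet>c u + (C *\<^sub>v v) \<bullet>c u + ((D *\<^sub>v u) \<bullet>c v + (\<beta> \<cdot>\<^sub>v v) \<bullet>c v)"
    using u v C D add_scalar_prod_distrib[of "\<alpha> \<cdot>\<^sub>v u" r "C *\<^sub>v v" "conjugate u"]
      add_scalar_prod_distrib[of "D *\<^sub>v u" q "\<beta> \<cdot>\<^sub>v v" "conjugate v"] by simp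
  finally show ?thesis using u v by (simp add: sqnorm_cscalar)
qed

lemma rotated_form:
  assumes u: "u \<in> carrier_vec r" and v: "v \<in> carrier_vec q"
  shows "Re (w * ((C *\<^sub>v v) \<bullet>c u + (D *\<^sub>v u) \<bullet>c v)) = Re (w * ((C *\<^sub>v v) \<bullet>c u) + cnj w * ((mat_adjoint D *\<^sub>v v) \<bullet>c u))"
proof -
  have "(D *\<^sub>v u) \<bullet>c v = u \<bullet>c (mat_adjoint D *\<^sub>v v)"
    by (rule cscalar_mult_mat_vec[OF D u v])
  also have "\<dots> = cnj ((mat_adjoint D *\<^sub>v v) \<bullet>c u)"
    using D u v by (intro cscalar_conj) auto
  finally show ?thesis by (simp add: algebra_simps)
qed

text \<open>Under the real part the \<open>D\<close> term may be conjugated into one with the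
  adjoint of \<open>D\<close> and factor \<open>cnj w\<close>; taking \<open>cnj w\<close> out of
  both terms leaves \<open>G\<close> at \<open>w^2\<close>.\<close>

lemma G_form:
  assumes u: "u \<in> carrier_vec r" and v: "v \<in> carrier_vec q" and w: "cmod w = 1"
  shows "Re (w * ((C *\<^sub>v v) \<bullet>c u + (D *\<^sub>v u) \<bullet>c v)) = Re (cnj w * ((G (w\<^sup>2) *\<^sub>v v) \<bullet>c u))"
proof -
  have ww: "cnj w * w\<^sup>2 = w" using w complex_norm_square[of w] by (simp add: power2_eq_square mult_ac)
  have "G (w\<^sup>2) *\<^sub>v v = w\<^sup>2 \<cdot>\<^sub>v (C *\<^sub>v v) + mat_adjoint D *\<^sub>v v"
    unfolding rotated_off_diagonal_def using C D v
    by (subst add_mult_distrib_mat_vec[of _ r q]) (auto simp: smult_mat_vec[of _ r q])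
  hence "(G (w\<^sup>2) *\<^sub>v v) \<bullet>c u = w\<^sup>2 * ((C *\<^sub>v v) \<bullet>c u) + (mat_adjoint D *\<^sub>v v) \<bullet>c u"
    using C D u v mat_adjoint_mult_vec_carrier[OF D] add_scalar_prod_distrib[of "w\<^sup>2 \<cdot>\<^sub>v (C *\<^sub>v v)" r "mat_adjoint D *\<^sub>v v" "conjugate u"] by simp
  hence "cnj w * ((G (w\<^sup>2) *\<^sub>v v) \<bullet>c u) = (cnj w * w\<^sup>2) * ((C *\<^sub>v v) \<bullet>c u) + cnj w * ((mat_adjoint D *\<^sub>v v) \<bullet>c u)"
    by (simp add: algebra_simps)
  thus ?thesis using rotated_form[OF u v, of w] unfolding ww by simp
qed

section \<open>Upper bounds for the ranges\<close>

lemma range_decompose: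
  assumes "z \<in> rank_numerical_range k A"
  obtains X Y where "X \<in> carrier_mat r k" "Y \<in> carrier_mat q k"
    "\<And>c. c \<in> carrier_vec k \<Longrightarrow> (\<alpha> - z) * of_real (sqnorm (X *\<^sub>v c)) + (\<beta> - z) * of_real (sqnorm (Y *\<^sub>v c))
       + ((C *\<^sub>v (Y *\<^sub>v c)) \<bullet>c (X *\<^sub>v c) + (D *\<^sub>v (X *\<^sub>v c)) \<bullet>c (Y *\<^sub>v c)) = 0"
    "\<And>c. c \<in> carrier_vec k \<Longrightarrow> sqnorm (X *\<^sub>v c) + sqnorm (Y *\<^sub>v c) = sqnorm c"
proof -
  obtain Z where Z: "Z \<in> carrier_mat n k"
    "\<And>c. c \<in> carrier_vec k \<Longrightarrow> (A *\<^sub>v (Z *\<^sub>v c)) \<bullet>c (Z *\<^sub>v c) = z * of_real (sqnorm (Z *\<^sub>v c))"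
    "\<And>c. c \<in> carrier_vec k \<Longrightarrow> sqnorm (Z *\<^sub>v c) = sqnorm c"
    using rank_numerical_rangeE[OF A_carrier assms] by blast
  define X where "X = mat r k (\<lambda>(i, j). Z $$ (i, j))"
  define Y where "Y = mat q k (\<lambda>(i, j). Z $$ (r + i, j))"
  have X: "X \<in> carrier_mat r k" and Y: "Y \<in> carrier_mat q k" by (auto simp: X_def Y_def)
  have app: "Z *\<^sub>v c = (X *\<^sub>v c) @\<^sub>v (Y *\<^sub>v c)" if c: "c \<in> carrier_vec k" for c
  proof (rule eq_vecI)
    fix i assume "i < dim_vec ((X *\<^sub>v c) @\<^sub>v (Y *\<^sub>v c))"
    hence i: "i < n" using X Y by auto
    have "row Z i = (if i < r then row X i else row Y (i - r))"
      using i Z(1) by (auto simp: X_def Y_def intro!: eq_vecI)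
    thus "(Z *\<^sub>v c) $ i = ((X *\<^sub>v c) @\<^sub>v (Y *\<^sub>v c)) $ i"
      using i Z(1) X Y by (auto simp: index_append_vec)
  qed (use Z X Y in auto)
  have sq: "sqnorm (Z *\<^sub>v c) = sqnorm (X *\<^sub>v c) + sqnorm (Y *\<^sub>v c)" if c: "c \<in> carrier_vec k" for c
  proof -
    have "conjugate ((X *\<^sub>v c) @\<^sub>v (Y *\<^sub>v c)) = conjugate (X *\<^sub>v c) @\<^sub>v conjugate (Y *\<^sub>v c)"
      using X Y c by (intro eq_vecI) auto
    hence "(Z *\<^sub>v c) \<bullet>c (Z *\<^sub>v c) = (X *\<^sub>v c) \<bullet>c (X *\<^sub>v c) + (Y *\<^sub>v c) \<bullet>c (Y *\<^sub>v c)"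
      unfolding app[OF c] using X Y c by (simp add: scalar_prod_append[of _ r _ q])
    thus ?thesis unfolding sqnorm_cscalar of_real_add[symmetric] of_real_eq_iff .
  qed
  have "(\<alpha> - z) * of_real (sqnorm (X *\<^sub>v c)) + (\<beta> - z) * of_real (sqnorm (Y *\<^sub>v c))
       + ((C *\<^sub>v (Y *\<^sub>v c)) \<bullet>c (X *\<^sub>v c) + (D *\<^sub>v (X *\<^sub>v c)) \<bullet>c (Y *\<^sub>v c)) = 0"
    if c: "c \<in> carrier_vec k" for c
  proof -
    have "z * of_real (sqnorm (X *\<^sub>v c) + sqnorm (Y *\<^sub>v c)) 
      = \<alpha> * of_real (sqnorm (X *\<^sub>v c)) + \<beta> * of_real (sqnorm (Y *\<^sub>v c)) + (C *\<^sub>v (Y *\<^sub>v c)) \<bullet>c (X *\<^sub>v c) + (D *\<^sub>v (X *\<^sub>v c)) \<bullet>c (Y *\<^sub>v c)"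
      using Z(2)[OF c] quadratic_form[of "X *\<^sub>v c" "Y *\<^sub>v c"] X Y c sq[OF c] by (simp add: app[OF c])
    thus ?thesis by (simp add: algebra_simps)
  qed
  thus ?thesis using that[OF X Y] Z(3) sq by auto
qed

text \<open>With \<open>x = Re (w a)\<close> and \<open>y = Re (w b)\<close>, the rotated form is at
  least \<open>x |u|^2 + y |v|^2 - |u| |G v|\<close>, which is positive definite where
  \<open>|G v| \<le> \<sigma> |v|\<close> once \<open>\<sigma>^2 < 4 x y\<close>. A
  \<open>k\<close>-dimensional isotropic space meets that region, as only \<open>k - 1\<close>
  singular directions must be avoided.\<close>

lemma range_ellipse:
  assumes k: "1 \<le> k" "k \<le> q" and z: "z \<in> rank_numerical_range k A"
  shows "ellipse_form \<alpha> \<beta> z \<le> (sv (k - 1))\<^sup>2"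
proof (rule ccontr)
  define \<sigma> where "\<sigma> = sv (k - 1)"
  define a where "a = \<alpha> - z"
  define b where "b = \<beta> - z"
  assume "\<not> ?thesis"
  hence gt: "\<sigma>\<^sup>2 < 2 * cmod (a * b) + 2 * Re (a * cnj b)"
    by (simp add: ellipse_form_def a_def b_def \<sigma>_def)
  moreover have "0 \<le> \<sigma>\<^sup>2" by simp
  ultimately have "0 < 2 * cmod (a * b) + 2 * Re (a * cnj b)" by linarith
  then obtain w where w: "cmod w = 1" "0 < Re (w * a)" "0 < Re (w * b)"
    "4 * (Re (w * a) * Re (w * b)) = 2 * cmod (a * b) + 2 * Re (a * cnj b)"
    using ex_rotation_pos by blast
  define x where "x = Re (w * a)"
  define y where "y = Re (w * b)"
  have xy: "0 < x" "0 < y" "\<sigma>\<^sup>2 < 4 * (x * y)" using w gt by (auto simp: x_def y_def)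
  \<comment> \<open>Midpoint of \<open>\<sigma>^2 / (4 y)\<close> and \<open>x\<close>: both
    \<open>t < x\<close> and \<open>\<sigma>^2 / (4 t) < y\<close> hold, so the cross term exhausts
    neither coefficient.\<close>
  define t where "t = (\<sigma>\<^sup>2 / (4 * y) + x) / 2"
  have t: "0 < t" "t < x" "\<sigma>\<^sup>2 / (4 * t) < y"
  proof -
    define e where "e = \<sigma>\<^sup>2 / (4 * y)"
    have e: "e < x" "0 \<le> e" using xy by (auto simp: e_def field_simps)
    have t_e: "t = (e + x) / 2" by (simp add: t_def e_def)
    show t0: "0 < t" and "t < x" using e xy(1) unfolding t_e by simp_all
    have "e < t" using e unfolding t_e by simp
    hence "\<sigma>\<^sup>2 / (4 * y) < t" by (simp only: e_def)
    thus "\<sigma>\<^sup>2 / (4 * t) < y" using xy t0 by (simp add: field_simps)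
  qed
  obtain X Y where XY: "X \<in> carrier_mat r k" "Y \<in> carrier_mat q k"
    "\<And>c. c \<in> carrier_vec k \<Longrightarrow> a * of_real (sqnorm (X *\<^sub>v c)) + b * of_real (sqnorm (Y *\<^sub>v c))
       + ((C *\<^sub>v (Y *\<^sub>v c)) \<bullet>c (X *\<^sub>v c) + (D *\<^sub>v (X *\<^sub>v c)) \<bullet>c (Y *\<^sub>v c)) = 0"
    "\<And>c. c \<in> carrier_vec k \<Longrightarrow> sqnorm (X *\<^sub>v c) + sqnorm (Y *\<^sub>v c) = sqnorm c"
    using range_decompose[OF z, folded a_def b_def] by blast
  have w2: "cmod (w\<^sup>2) = 1" using w by (simp add: norm_power)
  obtain U where U: "U \<in> carrier_mat q q" "mat_adjoint U * U = 1\<^sub>m q"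
    "\<And>c. c \<in> carrier_vec q \<Longrightarrow> sqnorm (G (w\<^sup>2) *\<^sub>v (U *\<^sub>v c)) = (\<Sum>i<q. (sv i)\<^sup>2 * (cmod (c $ i))\<^sup>2)"
    using svd[OF w2] by blast
  define V where "V = mat_adjoint U * Y"
  have UY: "V \<in> carrier_mat q k" using U(1) XY(2) by (auto simp: V_def)
  \<comment> \<open>The rows of \<open>R\<close> read off the first \<open>k - 1\<close> coordinates
    in the right singular basis; with \<open>k\<close> columns a non-zero \<open>c\<close> remains.
    For \<open>k = 1\<close> there is no condition.\<close>
  define R where "R = mat (k - 1) k (\<lambda>(i, j). V $$ (i, j))"
  have "R \<in> carrier_mat (k - 1) k" by (simp add: R_def)
  then obtain c where c: "c \<in> carrier_vec k" "c \<noteq> 0\<^sub>v k" "R *\<^sub>v c = 0\<^sub>v (k - 1)"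
    using wide_mat_kernel[of R "k - 1" k] k by auto
  define u where "u = X *\<^sub>v c"
  define v where "v = Y *\<^sub>v c"
  define d where "d = mat_adjoint U *\<^sub>v v"
  have uv: "u \<in> carrier_vec r" "v \<in> carrier_vec q" "d \<in> carrier_vec q"
    using XY c U(1) by (auto simp: u_def v_def d_def)
  have d0: "d $ i = 0" if "i < k - 1" for i
  proof -
    have "d = V *\<^sub>v c"
      unfolding d_def v_def V_def using U(1) XY(2) c(1) by (simp add: assoc_mult_mat_vec[of _ q q])
    moreover have "row V i = row R i"
      using that k UY by (intro eq_vecI) (auto simp: R_def)
    moreover have "(R *\<^sub>v c) $ i = 0" using c(3) that by simp
    moreover have "dim_row R = k - 1" by (simp add: R_def)
    ultimately show ?thesis using that k UY by simp
  qed
  have vd: "v = U *\<^sub>v d"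
    unfolding d_def using unitary_right_inverse[OF U(1,2)] uv(2) U(1)
    by (simp add: assoc_mult_mat_vec[symmetric, of U q q _ q])
  have nd: "sqnorm v = sqnorm d" unfolding vd using sqnorm_isometry[OF U(1,2) uv(3)] .
  have "sqnorm (G (w\<^sup>2) *\<^sub>v v) = (\<Sum>i<q. (sv i)\<^sup>2 * (cmod (d $ i))\<^sup>2)"
    using U(3)[OF uv(3)] vd by simp
  also have "\<dots> \<le> (\<Sum>i<q. \<sigma>\<^sup>2 * (cmod (d $ i))\<^sup>2)"
  proof (rule sum_mono)
    fix i
    show "(sv i)\<^sup>2 * (cmod (d $ i))\<^sup>2 \<le> \<sigma>\<^sup>2 * (cmod (d $ i))\<^sup>2"
    proof (cases "i < k - 1")
      case False
      hence "sv i \<le> \<sigma>" unfolding \<sigma>_def by (intro sv_mono) auto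
      thus ?thesis using sv_nonneg[of i] by (intro mult_right_mono power_mono) auto
    qed (use d0 in simp)
  qed
  also have "\<dots> = \<sigma>\<^sup>2 * sqnorm v"
    unfolding nd using uv(3) by (simp add: sqnorm_def sum_distrib_left)
  finally have gv: "sqnorm (G (w\<^sup>2) *\<^sub>v v) \<le> \<sigma>\<^sup>2 * sqnorm v" .
  have "0 = Re (w * (a * of_real (sqnorm u) + b * of_real (sqnorm v) + ((C *\<^sub>v v) \<bullet>c u + (D *\<^sub>v u) \<bullet>c v)))"
    using XY(3)[OF c(1)] by (simp add: u_def v_def)
  also have "\<dots> = Re (w * a * of_real (sqnorm u)) + Re (w * b * of_real (sqnorm v)) + Re (w * ((C *\<^sub>v v) \<bullet>c u + (D *\<^sub>v u) \<bullet>c v))"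
    by (simp only: distrib_left plus_complex.sel mult.assoc)
  also have "\<dots> = x * sqnorm u + y * sqnorm v + Re (cnj w * ((G (w\<^sup>2) *\<^sub>v v) \<bullet>c u))"
    unfolding G_form[OF uv(1,2) w(1)] x_def y_def by simp
  finally have form: "0 = x * sqnorm u + y * sqnorm v + Re (cnj w * ((G (w\<^sup>2) *\<^sub>v v) \<bullet>c u))" .
  have "- (t * sqnorm u + sqnorm (G (w\<^sup>2) *\<^sub>v v) / (4 * t)) \<le> Re (cnj w * ((G (w\<^sup>2) *\<^sub>v v) \<bullet>c u))"
    using mult_mat_vec_carrier[OF G_carrier uv(2)] uv(1) t(1) w(1)
    by (intro Re_weak_Cauchy_Schwarz) auto
  with form have "x * sqnorm u + y * sqnorm v \<le> t * sqnorm u + sqnorm (G (w\<^sup>2) *\<^sub>v v) / (4 * t)"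
    by linarith
  also have "\<dots> \<le> t * sqnorm u + \<sigma>\<^sup>2 / (4 * t) * sqnorm v"
    using gv t(1) by (simp add: field_simps)
  finally have le: "(x - t) * sqnorm u + (y - \<sigma>\<^sup>2 / (4 * t)) * sqnorm v \<le> 0"
    by (simp add: algebra_simps)
  have "0 \<le> (x - t) * sqnorm u" "0 \<le> (y - \<sigma>\<^sup>2 / (4 * t)) * sqnorm v"
    using t by (intro mult_nonneg_nonneg; simp)+
  with le have "(x - t) * sqnorm u = 0" "(y - \<sigma>\<^sup>2 / (4 * t)) * sqnorm v = 0" by linarith+
  hence "sqnorm u = 0" "sqnorm v = 0" using t by auto
  hence "sqnorm c = 0" using XY(4)[OF c(1)] by (simp add: u_def v_def)
  thus False using sqnorm_pos[OF c(1,2)] by simp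
qed

text \<open>More than \<open>q\<close> dimensions force a vector with \<open>v = 0\<close>, and on
  such vectors the form of \<open>A\<close> is \<open>\<alpha> |u|^2\<close>.\<close>

lemma range_large_alpha:
  assumes k: "q < k" and z: "z \<in> rank_numerical_range k A"
  shows "z = \<alpha>"
proof -
  obtain X Y where XY: "X \<in> carrier_mat r k" "Y \<in> carrier_mat q k"
    "\<And>c. c \<in> carrier_vec k \<Longrightarrow> (\<alpha> - z) * of_real (sqnorm (X *\<^sub>v c)) + (\<beta> - z) * of_real (sqnorm (Y *\<^sub>v c))
       + ((C *\<^sub>v (Y *\<^sub>v c)) \<bullet>c (X *\<^sub>v c) + (D *\<^sub>v (X *\<^sub>v c)) \<bullet>c (Y *\<^sub>v c)) = 0"
    "\<And>c. c \<in> carrier_vec k \<Longrightarrow> sqnorm (X *\<^sub>v c) + sqnorm (Y *\<^sub>v c) = sqnorm c"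
    using range_decompose[OF z] by blast
  obtain c where c: "c \<in> carrier_vec k" "c \<noteq> 0\<^sub>v k" "Y *\<^sub>v c = 0\<^sub>v q"
    using wide_mat_kernel[OF XY(2) k] by blast
  have "C *\<^sub>v 0\<^sub>v q = 0\<^sub>v r" using C by (intro eq_vecI) auto
  moreover have "sqnorm (0\<^sub>v q) = 0" by (simp add: sqnorm_def)
  ultimately have "(\<alpha> - z) * of_real (sqnorm (X *\<^sub>v c)) = 0" "sqnorm (X *\<^sub>v c) = sqnorm c"
    using XY(3)[OF c(1)] XY(4)[OF c(1)] XY(1) D c by simp_all
  thus ?thesis using sqnorm_pos[OF c(1,2)] by simp
qed

lemma range_large_beta:
  assumes k: "r < k" and z: "z \<in> rank_numerical_range k A"
  shows "z = \<beta>"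
proof -
  obtain X Y where XY: "X \<in> carrier_mat r k" "Y \<in> carrier_mat q k"
    "\<And>c. c \<in> carrier_vec k \<Longrightarrow> (\<alpha> - z) * of_real (sqnorm (X *\<^sub>v c)) + (\<beta> - z) * of_real (sqnorm (Y *\<^sub>v c))
       + ((C *\<^sub>v (Y *\<^sub>v c)) \<bullet>c (X *\<^sub>v c) + (D *\<^sub>v (X *\<^sub>v c)) \<bullet>c (Y *\<^sub>v c)) = 0"
    "\<And>c. c \<in> carrier_vec k \<Longrightarrow> sqnorm (X *\<^sub>v c) + sqnorm (Y *\<^sub>v c) = sqnorm c"
    using range_decompose[OF z] by blast
  obtain c where c: "c \<in> carrier_vec k" "c \<noteq> 0\<^sub>v k" "X *\<^sub>v c = 0\<^sub>v r"
    using wide_mat_kernel[OF XY(1) k] by blast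
  have "D *\<^sub>v 0\<^sub>v r = 0\<^sub>v q" using D by (intro eq_vecI) auto
  moreover have "sqnorm (0\<^sub>v r) = 0" by (simp add: sqnorm_def)
  ultimately have "(\<beta> - z) * of_real (sqnorm (Y *\<^sub>v c)) = 0" "sqnorm (Y *\<^sub>v c) = sqnorm c"
    using XY(3)[OF c(1)] XY(4)[OF c(1)] XY(2) C c by simp_all
  thus ?thesis using sqnorm_pos[OF c(1,2)] by simp
qed

text \<open>A rank bound: \<open>G 1\<close> is injective on the span of the first \<open>p\<close>
  right singular vectors and has values in dimension \<open>r\<close>. The locale itself bounds
  \<open>p\<close> only by \<open>q\<close>.\<close>

lemma length_s_le_r: "p \<le> r"
proof (rule ccontr)
  assume "\<not> p \<le> r"
  hence rp: "r < p" by simp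
  obtain U where U: "U \<in> carrier_mat q q" "mat_adjoint U * U = 1\<^sub>m q"
    "\<And>c. c \<in> carrier_vec q \<Longrightarrow> sqnorm (G 1 *\<^sub>v (U *\<^sub>v c)) = (\<Sum>i<q. (sv i)\<^sup>2 * (cmod (c $ i))\<^sup>2)"
    using svd[of 1] by auto
  define V where "V = G 1 * U"
  have V: "V \<in> carrier_mat r q" unfolding V_def by (rule mult_carrier_mat[OF G_carrier U(1)])
  define R where "R = mat r p (\<lambda>(i, j). V $$ (i, j))"
  have "R \<in> carrier_mat r p" by (simp add: R_def)
  then obtain c where c: "c \<in> carrier_vec p" "c \<noteq> 0\<^sub>v p" "R *\<^sub>v c = 0\<^sub>v r"
    using wide_mat_kernel rp by blast
  define d where "d = vec q (\<lambda>i. if i < p then c $ i else 0)"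
  have d: "d \<in> carrier_vec q" by (simp add: d_def)
  have "V *\<^sub>v d = R *\<^sub>v c"
  proof (rule eq_vecI)
    fix i assume "i < dim_vec (R *\<^sub>v c)"
    hence i: "i < r" by (simp add: R_def)
    have "(V *\<^sub>v d) $ i = (\<Sum>j\<in>{0..<q}. V $$ (i, j) * d $ j)"
      using i V d by (simp add: scalar_prod_def)
    also have "\<dots> = (\<Sum>j\<in>{0..<p}. V $$ (i, j) * d $ j)"
      using length_s by (intro sum.mono_neutral_right) (auto simp: d_def)
    also have "\<dots> = (\<Sum>j\<in>{0..<p}. V $$ (i, j) * c $ j)"
      using length_s by (intro sum.cong) (auto simp: d_def)
    also have "\<dots> = (R *\<^sub>v c) $ i"
      using i c(1) by (simp add: scalar_prod_def R_def)
    finally show "(V *\<^sub>v d) $ i = (R *\<^sub>v c) $ i" .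
  qed (use V in \<open>auto simp: R_def\<close>)
  hence "G 1 *\<^sub>v (U *\<^sub>v d) = 0\<^sub>v r" using c(3) assoc_mult_mat_vec[OF G_carrier U(1) d] by (simp add: V_def)
  hence "(\<Sum>i<q. (sv i)\<^sup>2 * (cmod (d $ i))\<^sup>2) = 0" using U(3)[OF d] by (simp add: sqnorm_def)
  hence z: "(sv i)\<^sup>2 * (cmod (d $ i))\<^sup>2 = 0" if "i < q" for i
    using that by (subst (asm) sum_nonneg_eq_0_iff) auto
  have "c = 0\<^sub>v p"
  proof (rule eq_vecI)
    fix i assume "i < dim_vec (0\<^sub>v p :: complex vec)"
    hence i: "i < p" by simp
    thus "c $ i = 0\<^sub>v p $ i" using z[of i] length_s s_pos[of "s ! i"] by (auto simp: sv_def d_def)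
  qed (use c in auto)
  thus False using c(2) by simp
qed

text \<open>For \<open>\<alpha> = \<beta>\<close> the two forced values of \<open>z\<close> agree,
  so the off-diagonal part has to decide. On the vectors with \<open>u = G(1) v\<close> and
  \<open>v\<close> in the span of the first \<open>p\<close> right singular vectors, the real part
  of the form of \<open>A - z\<close> is \<open>|u|^2\<close>, positive unless \<open>v = 0\<close>.
  An isotropic space meets this \<open>p\<close>-dimensional space only in 0.\<close>

lemma range_empty:
  assumes eq: "\<alpha> = \<beta>" and k: "n - p < k"
  shows "rank_numerical_range k A = {}"
proof (rule ccontr)
  assume "rank_numerical_range k A \<noteq> {}"
  then obtain z where z: "z \<in> rank_numerical_range k A" by blast
  have "q < k" using k length_s_le_r by linarith
  hence za: "z = \<alpha>" "z = \<beta>" using range_large_alpha[OF _ z] eq by auto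
  obtain X Y where XY: "X \<in> carrier_mat r k" "Y \<in> carrier_mat q k"
    "\<And>c. c \<in> carrier_vec k \<Longrightarrow> (\<alpha> - z) * of_real (sqnorm (X *\<^sub>v c)) + (\<beta> - z) * of_real (sqnorm (Y *\<^sub>v c))
       + ((C *\<^sub>v (Y *\<^sub>v c)) \<bullet>c (X *\<^sub>v c) + (D *\<^sub>v (X *\<^sub>v c)) \<bullet>c (Y *\<^sub>v c)) = 0"
    "\<And>c. c \<in> carrier_vec k \<Longrightarrow> sqnorm (X *\<^sub>v c) + sqnorm (Y *\<^sub>v c) = sqnorm c"
    using range_decompose[OF z] by blast
  obtain U where U: "U \<in> carrier_mat q q" "mat_adjoint U * U = 1\<^sub>m q"
    "\<And>c. c \<in> carrier_vec q \<Longrightarrow> sqnorm (G 1 *\<^sub>v (U *\<^sub>v c)) = (\<Sum>i<q. (sv i)\<^sup>2 * (cmod (c $ i))\<^sup>2)"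
    using svd[of 1] by auto
  define V where "V = mat_adjoint U * Y"
  have UY: "V \<in> carrier_mat q k" using U(1) XY(2) by (auto simp: V_def)
  have GY: "G 1 * Y \<in> carrier_mat r k" by (rule mult_carrier_mat[OF G_carrier XY(2)])
  define R where "R = mat (q - p) k (\<lambda>(i, j). V $$ (p + i, j))"
  have R: "R \<in> carrier_mat (q - p) k" by (simp add: R_def)
  have XG: "X - G 1 * Y \<in> carrier_mat r k" using GY by (rule minus_carrier_mat)
  \<comment> \<open>\<open>r\<close> equations for \<open>u = G(1) v\<close> and
    \<open>q - p\<close> for the coordinates of \<open>v\<close> from index \<open>p\<close> on:
    fewer than \<open>k\<close> in total.\<close>
  have "(X - G 1 * Y) @\<^sub>r R \<in> carrier_mat (r + (q - p)) k"
    using XG R by (rule carrier_append_rows)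
  moreover have "r + (q - p) < k" using k length_s by linarith
  ultimately obtain c where c: "c \<in> carrier_vec k" "c \<noteq> 0\<^sub>v k" "((X - G 1 * Y) @\<^sub>r R) *\<^sub>v c = 0\<^sub>v (r + (q - p))"
    using wide_mat_kernel by blast
  have "((X - G 1 * Y) *\<^sub>v c) @\<^sub>v (R *\<^sub>v c) = 0\<^sub>v r @\<^sub>v 0\<^sub>v (q - p)"
    using c(3) mat_mult_append[OF XG R c(1)] by (auto intro!: eq_vecI)
  hence k1: "(X - G 1 * Y) *\<^sub>v c = 0\<^sub>v r" and k2: "R *\<^sub>v c = 0\<^sub>v (q - p)"
    using append_vec_eq[OF mult_mat_vec_carrier[OF XG c(1)], of "0\<^sub>v r"] by auto
  define u where "u = X *\<^sub>v c"
  define v where "v = Y *\<^sub>v c"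
  define d where "d = mat_adjoint U *\<^sub>v v"
  have uv: "u \<in> carrier_vec r" "v \<in> carrier_vec q" "d \<in> carrier_vec q"
    using XY c U(1) by (auto simp: u_def v_def d_def)
  have "u - G 1 *\<^sub>v v = 0\<^sub>v r"
    using k1 minus_mult_distrib_mat_vec[OF XY(1) GY c(1)] assoc_mult_mat_vec[OF G_carrier XY(2) c(1)]
    by (simp add: u_def v_def)
  hence u: "u = G 1 *\<^sub>v v" using uv mult_mat_vec_carrier[OF G_carrier uv(2)]
    by (metis carrier_vecD eq_vecI index_minus_vec(1) index_zero_vec(1) right_minus_eq)
  have d0: "d $ (p + i) = 0" if "i < q - p" for i
  proof -
    have "d = V *\<^sub>v c"
      unfolding d_def v_def V_def using U(1) XY(2) c(1) by (simp add: assoc_mult_mat_vec[of _ q q])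
    moreover have "row V (p + i) = row R i"
      using that UY by (intro eq_vecI) (auto simp: R_def)
    moreover have "(R *\<^sub>v c) $ i = 0" using k2 that by simp
    ultimately show ?thesis using that UY R by simp
  qed
  have vd: "v = U *\<^sub>v d"
    unfolding d_def using unitary_right_inverse[OF U(1,2)] uv(2) U(1)
    by (simp add: assoc_mult_mat_vec[symmetric, of U q q _ q])
  have "(C *\<^sub>v v) \<bullet>c u + (D *\<^sub>v u) \<bullet>c v = 0"
    using XY(3)[OF c(1)] za by (simp add: u_def v_def)
  \<comment> \<open>At \<open>w = 1\<close> the cross terms have real part
    \<open>Re <G(1) v, u>\<close>, which is \<open>|u|^2\<close> by the choice of
    \<open>c\<close>.\<close>
  hence "Re (u \<bullet>c u) = 0" using G_form[OF uv(1,2), of 1] u by simp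
  hence u0: "sqnorm u = 0" by (simp add: sqnorm_cscalar)
  hence "(\<Sum>i<q. (sv i)\<^sup>2 * (cmod (d $ i))\<^sup>2) = 0" using U(3)[OF uv(3)] u vd by simp
  hence z: "(sv i)\<^sup>2 * (cmod (d $ i))\<^sup>2 = 0" if "i < q" for i
    using that by (subst (asm) sum_nonneg_eq_0_iff) auto
  have "d = 0\<^sub>v q"
  proof (rule eq_vecI)
    fix i assume "i < dim_vec (0\<^sub>v q :: complex vec)"
    hence i: "i < q" by simp
    show "d $ i = 0\<^sub>v q $ i"
    proof (cases "i < p")
      case True thus ?thesis using z[OF i] i s_pos[of "s ! i"] by (auto simp: sv_def)
    next
      case False thus ?thesis using d0[of "i - p"] i by simp
    qed
  qed (use uv in auto)
  hence "v = 0\<^sub>v q" using vd mult_mat_zero_vec[OF U(1)] by simp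
  hence "sqnorm v = 0" by (simp add: sqnorm_def)
  hence "sqnorm c = 0" using u0 XY(4)[OF c(1)] by (simp add: u_def v_def)
  thus False using sqnorm_pos[OF c(1,2)] by simp
qed

text \<open>A scalar diagonal block makes coordinate subspaces isotropic; the offset
  \<open>off\<close> selects the block.\<close>

lemma alpha_in_range: "k \<le> r \<Longrightarrow> \<alpha> \<in> rank_numerical_range k A"
  and beta_in_range: "k \<le> q \<Longrightarrow> \<beta> \<in> rank_numerical_range k A"
proof -
  have main: "z \<in> rank_numerical_range k A"
    if off: "off + k \<le> n" and B: "\<And>i j. i < k \<Longrightarrow> j < k \<Longrightarrow> (A - z \<cdot>\<^sub>m 1\<^sub>m n) $$ (off + i, off + j) = 0" for off z
  proof (rule rank_numerical_rangeI[OF A_carrier])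
    define X where "X = mat n k (\<lambda>(i, j). if i = off + j then 1 else 0 :: complex)"
    show X: "X \<in> carrier_mat n k" by (simp add: X_def)
    have col: "col X j = unit_vec n (off + j)" if "j < k" for j
      using that off by (intro eq_vecI) (auto simp: X_def)
    have BB: "A - z \<cdot>\<^sub>m 1\<^sub>m n \<in> carrier_mat n n" by auto
    have cu: "conjugate (unit_vec n i) = (unit_vec n i :: complex vec)" for i
      by (intro eq_vecI) (auto simp: unit_vec_def)
    show "mat_adjoint X * (A - z \<cdot>\<^sub>m 1\<^sub>m n) * X = 0\<^sub>m k k"
    proof (rule eq_matI)
      fix i j assume "i < dim_row (0\<^sub>m k k :: complex mat)" "j < dim_col (0\<^sub>m k k :: complex mat)"
      hence ij: "i < k" "j < k" by auto
      have "(mat_adjoint X * (A - z \<cdot>\<^sub>m 1\<^sub>m n) * X) $$ (i, j)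
        = ((A - z \<cdot>\<^sub>m 1\<^sub>m n) *\<^sub>v unit_vec n (off + j)) \<bullet> unit_vec n (off + i)"
        using adjoint_sandwich_index[OF BB X X ij] by (simp add: col ij cu)
      also have "\<dots> = (A - z \<cdot>\<^sub>m 1\<^sub>m n) $$ (off + i, off + j)"
      proof -
        have "off + i < n" "off + j < n" using ij off by auto
        thus ?thesis using BB by (simp add: scalar_prod_right_unit)
      qed
      finally show "(mat_adjoint X * (A - z \<cdot>\<^sub>m 1\<^sub>m n) * X) $$ (i, j) = 0\<^sub>m k k $$ (i, j)" using B[OF ij] ij by simp
    qed (use X in auto)
    fix c assume c: "c \<in> carrier_vec k" "X *\<^sub>v c = 0\<^sub>v n"
    show "c = 0\<^sub>v k"
    proof (rule eq_vecI)
      fix i assume "i < dim_vec (0\<^sub>v k :: complex vec)"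
      hence i: "i < k" by simp
      have row: "row X (off + i) = unit_vec k i" using i off by (intro eq_vecI) (auto simp: X_def)
      have "(X *\<^sub>v c) $ (off + i) = row X (off + i) \<bullet> c" using i off X by simp
      also have "\<dots> = c $ i" unfolding row using i c(1) by (simp add: scalar_prod_left_unit)
      finally show "c $ i = 0\<^sub>v k $ i" using c(2) i off by simp
    qed (use c in auto)
  qed
  show "k \<le> r \<Longrightarrow> \<alpha> \<in> rank_numerical_range k A"
    by (rule main[of 0]) (use C D in \<open>auto simp: A_def\<close>)
  show "k \<le> q \<Longrightarrow> \<beta> \<in> rank_numerical_range k A"
    by (rule main[of r]) (use C D in \<open>auto simp: A_def\<close>)
qed

end

subsection \<open>Closedness\<close>

lemma bounded_family_subsequence:
  fixes f :: "nat \<Rightarrow> 'i \<Rightarrow> complex"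
  assumes "finite I" and "\<And>m i. i \<in> I \<Longrightarrow> cmod (f m i) \<le> B"
  shows "\<exists>\<rho> L. strict_mono (\<rho> :: nat \<Rightarrow> nat) \<and> (\<forall>i\<in>I. (\<lambda>m. f (\<rho> m) i) \<longlonglongrightarrow> L i)"
  using assms
proof (induction I rule: finite_induct)
  case empty
  have "strict_mono (id :: nat \<Rightarrow> nat)" by (simp add: strict_mono_def)
  thus ?case by blast
next
  case (insert x I)
  have "\<exists>\<rho> L. strict_mono (\<rho> :: nat \<Rightarrow> nat) \<and> (\<forall>i\<in>I. (\<lambda>m. f (\<rho> m) i) \<longlonglongrightarrow> L i)"
    using insert.prems by (intro insert.IH) auto
  then obtain \<rho> L where \<rho>: "strict_mono \<rho>" "\<And>i. i \<in> I \<Longrightarrow> (\<lambda>m. f (\<rho> m) i) \<longlonglongrightarrow> L i" by blast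
  have "\<forall>m. f (\<rho> m) x \<in> cball 0 B" using insert.prems[of x] by auto
  then obtain l \<sigma> where \<sigma>: "strict_mono \<sigma>" "((\<lambda>m. f (\<rho> m) x) \<circ> \<sigma>) \<longlonglongrightarrow> l"
    using compact_cball[of "0::complex" B, unfolded compact_def, THEN spec, of "\<lambda>m. f (\<rho> m) x"] by blast
  have "(\<lambda>m. f ((\<rho> \<circ> \<sigma>) m) i) \<longlonglongrightarrow> (L(x := l)) i" if "i \<in> insert x I" for i
  proof (cases "i = x")
    case True thus ?thesis using \<sigma>(2) by (simp add: o_def)
  next
    case False
    hence "((\<lambda>m. f (\<rho> m) i) \<circ> \<sigma>) \<longlonglongrightarrow> L i"
      using \<rho>(2)[of i] that by (intro LIMSEQ_subseq_LIMSEQ[OF _ \<sigma>(1)]) auto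
    thus ?thesis using False by (simp add: o_def)
  qed
  moreover have "strict_mono (\<rho> \<circ> \<sigma>)" using \<rho>(1) \<sigma>(1) by (rule strict_mono_o)
  ultimately show ?case by blast
qed

text \<open>Compactness of the isometries: their entries are bounded by 1, and the defining
  equations are polynomial in the entries and their conjugates, so they pass to a subsequential
  limit.\<close>

lemma rank_numerical_range_limit:
  assumes A: "A \<in> carrier_mat n n" and z: "\<And>m. z m \<in> rank_numerical_range k A" and l: "z \<longlonglongrightarrow> l"
  shows "l \<in> rank_numerical_range k A"
proof -
  have "\<exists>X. X \<in> carrier_mat n k \<and> mat_adjoint X * X = 1\<^sub>m k \<and> mat_adjoint X * A * X = z m \<cdot>\<^sub>m 1\<^sub>m k" for m
    using z[of m] A unfolding rank_numerical_range_def by auto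
  then obtain X where X: "\<And>m. X m \<in> carrier_mat n k" "\<And>m. mat_adjoint (X m) * X m = 1\<^sub>m k"
    "\<And>m. mat_adjoint (X m) * A * X m = z m \<cdot>\<^sub>m 1\<^sub>m k" by metis
  have gram: "(mat_adjoint Y * Y) $$ (i, j) = (\<Sum>a<n. Y $$ (a, j) * cnj (Y $$ (a, i)))"
    if "Y \<in> carrier_mat n k" "i < k" "j < k" for Y i j
    using adjoint_mult_index[OF that(1,1,2,3)] that by (simp add: scalar_prod_def lessThan_atLeast0)
  have sandwich: "(mat_adjoint Y * A * Y) $$ (i, j) = (\<Sum>a<n. (\<Sum>b<n. A $$ (a, b) * Y $$ (b, j)) * cnj (Y $$ (a, i)))"
    if "Y \<in> carrier_mat n k" "i < k" "j < k" for Y i j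
    using adjoint_sandwich_index[OF A that(1,1,2,3)] that A by (simp add: scalar_prod_def lessThan_atLeast0)
  have bound: "cmod (X m $$ ij) \<le> 1" if "ij \<in> {..<n} \<times> {..<k}" for m ij
  proof -
    obtain i j where ij: "ij = (i, j)" "i < n" "j < k" using \<open>ij \<in> _\<close> by auto
    have "sqnorm (col (X m) j) = 1"
    proof -
      have "col (X m) j \<bullet>c col (X m) j = 1"
        using adjoint_mult_index[OF X(1)[of m] X(1)[of m], of j j] X(2)[of m] ij by simp
      thus ?thesis by (simp only: sqnorm_cscalar of_real_eq_1_iff)
    qed
    moreover have "(cmod (col (X m) j $ i))\<^sup>2 \<le> sqnorm (col (X m) j)"
      unfolding sqnorm_def using ij X(1)[of m] by (intro member_le_sum) auto
    ultimately have "(cmod (X m $$ (i, j)))\<^sup>2 \<le> 1\<^sup>2" using ij X(1)[of m] by simp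
    thus ?thesis unfolding ij by (rule power2_le_imp_le) simp
  qed
  have "finite ({..<n} \<times> {..<k})" by simp
  from bounded_family_subsequence[OF this, of "\<lambda>m ij. X m $$ ij" 1] bound
  obtain \<rho> L where \<rho>: "strict_mono \<rho>" "\<And>ij. ij \<in> {..<n} \<times> {..<k} \<Longrightarrow> (\<lambda>m. X (\<rho> m) $$ ij) \<longlonglongrightarrow> L ij"
    by blast
  define Y where "Y = mat n k L"
  have Y: "Y \<in> carrier_mat n k" by (simp add: Y_def)
  have lim: "(\<lambda>m. X (\<rho> m) $$ (i, j)) \<longlonglongrightarrow> Y $$ (i, j)" if "i < n" "j < k" for i j
    using \<rho>(2)[of "(i, j)"] that by (simp add: Y_def)
  have zl: "(\<lambda>m. z (\<rho> m)) \<longlonglongrightarrow> l" using LIMSEQ_subseq_LIMSEQ[OF l \<rho>(1)] by (simp add: o_def)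
  have "mat_adjoint Y * Y = 1\<^sub>m k"
  proof (rule eq_matI)
    fix i j assume "i < dim_row (1\<^sub>m k :: complex mat)" "j < dim_col (1\<^sub>m k :: complex mat)"
    hence ij: "i < k" "j < k" by auto
    have "(\<lambda>m. (mat_adjoint (X (\<rho> m)) * X (\<rho> m)) $$ (i, j)) \<longlonglongrightarrow> (mat_adjoint Y * Y) $$ (i, j)"
      unfolding gram[OF X(1) ij] gram[OF Y ij] using ij by (intro tendsto_intros lim) auto
    moreover have "(\<lambda>m. (mat_adjoint (X (\<rho> m)) * X (\<rho> m)) $$ (i, j)) \<longlonglongrightarrow> 1\<^sub>m k $$ (i, j)"
      unfolding X(2) by simp
    ultimately show "(mat_adjoint Y * Y) $$ (i, j) = 1\<^sub>m k $$ (i, j)" by (rule LIMSEQ_unique)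
  qed (use Y in auto)
  moreover have "mat_adjoint Y * A * Y = l \<cdot>\<^sub>m 1\<^sub>m k"
  proof (rule eq_matI)
    fix i j assume "i < dim_row (l \<cdot>\<^sub>m 1\<^sub>m k :: complex mat)" "j < dim_col (l \<cdot>\<^sub>m 1\<^sub>m k :: complex mat)"
    hence ij: "i < k" "j < k" by auto
    have "(\<lambda>m. (mat_adjoint (X (\<rho> m)) * A * X (\<rho> m)) $$ (i, j)) \<longlonglongrightarrow> (mat_adjoint Y * A * Y) $$ (i, j)"
      unfolding sandwich[OF X(1) ij] sandwich[OF Y ij] using ij by (intro tendsto_intros lim) auto
    moreover have "(\<lambda>m. (mat_adjoint (X (\<rho> m)) * A * X (\<rho> m)) $$ (i, j)) \<longlonglongrightarrow> (l \<cdot>\<^sub>m 1\<^sub>m k) $$ (i, j)"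
      unfolding X(3) using zl ij by (auto intro!: tendsto_intros)
    ultimately show "(mat_adjoint Y * A * Y) $$ (i, j) = (l \<cdot>\<^sub>m 1\<^sub>m k) $$ (i, j)" by (rule LIMSEQ_unique)
  qed (use Y A in auto)
  ultimately show ?thesis using Y A unfolding rank_numerical_range_def by auto
qed

subsection \<open>Elliptical discs\<close>

lemma ellipse_form_nonneg: "0 \<le> ellipse_form \<alpha> \<beta> z"
proof -
  have "\<bar>Re ((\<alpha> - z) * cnj (\<beta> - z))\<bar> \<le> cmod ((\<alpha> - z) * (\<beta> - z))"
    using abs_Re_le_cmod[of "(\<alpha> - z) * cnj (\<beta> - z)"] by (simp add: norm_mult del: complex_cnj_diff)
  thus ?thesis unfolding ellipse_form_def by linarith
qed

text \<open>By the law of cosines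
  \<open>|\<alpha> - \<beta>|^2 = |a|^2 + |b|^2 - 2 Re (a conj b)\<close>, while the squared sum of
  the focal distances is \<open>|a|^2 + |b|^2 + 2 |a b|\<close>; the difference is the form.\<close>

lemma ellipse_form_le_iff:
  "ellipse_form \<alpha> \<beta> z \<le> s\<^sup>2 \<longleftrightarrow> (dist z \<alpha> + dist z \<beta>)\<^sup>2 \<le> (dist \<alpha> \<beta>)\<^sup>2 + s\<^sup>2"
proof -
  have "(dist \<alpha> \<beta>)\<^sup>2 = (cmod (\<alpha> - z))\<^sup>2 + (cmod (\<beta> - z))\<^sup>2 - 2 * Re ((\<alpha> - z) * cnj (\<beta> - z))"
    unfolding dist_norm cmod_power2 by (simp add: power2_eq_square algebra_simps)
  moreover have "dist z \<alpha> = cmod (\<alpha> - z)" "dist z \<beta> = cmod (\<beta> - z)"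
    by (simp_all add: dist_norm norm_minus_commute)
  moreover from this have "(dist z \<alpha> + dist z \<beta>)\<^sup>2
    = (cmod (\<alpha> - z))\<^sup>2 + (cmod (\<beta> - z))\<^sup>2 + 2 * (cmod (\<alpha> - z) * cmod (\<beta> - z))"
    by (simp add: power2_sum)
  ultimately show ?thesis unfolding ellipse_form_def norm_mult by linarith
qed

lemma elliptical_disc_eq:
  assumes "0 \<le> s"
  shows "elliptical_disc \<alpha> \<beta> s = {z. ellipse_form \<alpha> \<beta> z \<le> s\<^sup>2}"
proof (cases "\<alpha> = \<beta>")
  case True
  have "dist \<beta> z \<le> s / 2 \<longleftrightarrow> ellipse_form \<beta> \<beta> z \<le> s\<^sup>2" for z
  proof -
    have "dist \<beta> z \<le> s / 2 \<longleftrightarrow> 2 * dist z \<beta> \<le> s" by (auto simp: dist_commute)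
    also have "\<dots> \<longleftrightarrow> (2 * dist z \<beta>)\<^sup>2 \<le> s\<^sup>2" 
      using assms by (subst power_mono_iff) auto
    finally show ?thesis unfolding ellipse_form_le_iff by simp
  qed
  thus ?thesis unfolding elliptical_disc_def True by (simp add: cball_def)
next
  case False
  have "dist z \<alpha> + dist z \<beta> \<le> sqrt ((dist \<alpha> \<beta>)\<^sup>2 + s\<^sup>2) \<longleftrightarrow> ellipse_form \<alpha> \<beta> z \<le> s\<^sup>2" for z
  proof -
    have "dist z \<alpha> + dist z \<beta> \<le> sqrt ((dist \<alpha> \<beta>)\<^sup>2 + s\<^sup>2)
      \<longleftrightarrow> (dist z \<alpha> + dist z \<beta>)\<^sup>2 \<le> (sqrt ((dist \<alpha> \<beta>)\<^sup>2 + s\<^sup>2))\<^sup>2"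
      by (subst power_mono_iff) auto
    thus ?thesis unfolding ellipse_form_le_iff by simp
  qed
  thus ?thesis using False by (auto simp: elliptical_disc_def)
qed

lemma closed_segment_ellipse: "closed_segment \<alpha> \<beta> = {z. ellipse_form \<alpha> \<beta> z \<le> 0}"
proof -
  have "z \<in> closed_segment \<alpha> \<beta> \<longleftrightarrow> ellipse_form \<alpha> \<beta> z \<le> 0" for z
  proof -
    have "z \<in> closed_segment \<alpha> \<beta> \<longleftrightarrow> dist \<alpha> \<beta> = dist \<alpha> z + dist z \<beta>"
      by (simp add: between_mem_segment[symmetric] between)
    also have "\<dots> \<longleftrightarrow> dist z \<alpha> + dist z \<beta> \<le> dist \<alpha> \<beta>"
      using dist_triangle[of \<alpha> \<beta> z] by (auto simp: dist_commute)
    also have "\<dots> \<longleftrightarrow> (dist z \<alpha> + dist z \<beta>)\<^sup>2 \<le> (dist \<alpha> \<beta>)\<^sup>2"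
      by (subst power_mono_iff) auto
    finally show ?thesis using ellipse_form_le_iff[of \<alpha> \<beta> z 0] by simp
  qed
  thus ?thesis by auto
qed

text \<open>In coordinates centred at \<open>c\<close>, with \<open>d\<close> half the focal
  difference, the form is \<open>2 |d^2 - x^2| + 2 |x|^2 - 2 |d|^2\<close>, and
  \<open>d^2 - t^2 y^2\<close> is a convex combination of \<open>d^2 - y^2\<close> and
  \<open>d^2\<close>. For \<open>t < 1\<close> this moves boundary points of a disc with
  \<open>s > 0\<close> strictly inside.\<close>

lemma ellipse_form_contract:
  fixes \<alpha> \<beta> z :: complex and t :: real
  assumes t: "0 \<le> t" "t \<le> 1"
  defines "c \<equiv> (\<alpha> + \<beta>) / 2"
  shows "ellipse_form \<alpha> \<beta> (c + of_real t * (z - c)) \<le> t\<^sup>2 * ellipse_form \<alpha> \<beta> z"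
proof -
  define d where "d = (\<alpha> - \<beta>) / 2"
  define y where "y = z - c"
  have form: "ellipse_form \<alpha> \<beta> (c + x) = 2 * cmod (d\<^sup>2 - x\<^sup>2) + 2 * (cmod x)\<^sup>2 - 2 * (cmod d)\<^sup>2" for x
  proof -
    have "(\<alpha> - (c + x)) = d - x" "\<beta> - (c + x) = - (d + x)"
      by (simp_all add: c_def d_def field_simps)
    moreover have "(d - x) * - (d + x) = - (d\<^sup>2 - x\<^sup>2)" by (simp add: power2_eq_square algebra_simps)
    moreover have "Re ((d - x) * cnj (- (d + x))) = (cmod x)\<^sup>2 - (cmod d)\<^sup>2"
      unfolding cmod_power2 by (simp add: power2_eq_square algebra_simps)
    ultimately show ?thesis unfolding ellipse_form_def by (simp only: norm_minus_cancel) simp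
  qed
  have "ellipse_form \<alpha> \<beta> (c + of_real t * y)
    = 2 * cmod (of_real (t\<^sup>2) * (d\<^sup>2 - y\<^sup>2) + of_real (1 - t\<^sup>2) * d\<^sup>2) + 2 * t\<^sup>2 * (cmod y)\<^sup>2 - 2 * (cmod d)\<^sup>2"
  proof -
    have "d\<^sup>2 - (of_real t * y)\<^sup>2 = of_real (t\<^sup>2) * (d\<^sup>2 - y\<^sup>2) + of_real (1 - t\<^sup>2) * d\<^sup>2"
      by (simp add: power_mult_distrib algebra_simps)
    moreover have "(cmod (of_real t * y))\<^sup>2 = t\<^sup>2 * (cmod y)\<^sup>2" by (simp add: norm_mult power_mult_distrib)
    ultimately show ?thesis unfolding form by simp
  qed
  also have "\<dots> \<le> 2 * (t\<^sup>2 * cmod (d\<^sup>2 - y\<^sup>2) + (1 - t\<^sup>2) * (cmod d)\<^sup>2) + 2 * t\<^sup>2 * (cmod y)\<^sup>2 - 2 * (cmod d)\<^sup>2"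
  proof -
    have t1: "0 \<le> 1 - t\<^sup>2" using t by (simp add: power_le_one)
    have "cmod (of_real (t\<^sup>2) * (d\<^sup>2 - y\<^sup>2) + of_real (1 - t\<^sup>2) * d\<^sup>2)
      \<le> cmod (of_real (t\<^sup>2) * (d\<^sup>2 - y\<^sup>2)) + cmod (of_real (1 - t\<^sup>2) * d\<^sup>2)" by (rule norm_triangle_ineq)
    also have "\<dots> = t\<^sup>2 * cmod (d\<^sup>2 - y\<^sup>2) + (1 - t\<^sup>2) * (cmod d)\<^sup>2"
      unfolding norm_mult norm_of_real norm_power using t1 by simp
    finally show ?thesis by (intro diff_right_mono add_right_mono mult_left_mono) simp_all
  qed
  also have "\<dots> = t\<^sup>2 * ellipse_form \<alpha> \<beta> (c + y)" unfolding form by (simp add: algebra_simps)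
  finally show ?thesis by (simp add: y_def)
qed

section \<open>The operator norm as the largest singular value\<close>

context scalar_block_matrix
begin

lemma spectral_norm_G:
  assumes q: "0 < q"
  shows "spectral_norm (G 1) = sv 0"
proof -
  obtain U where U: "U \<in> carrier_mat q q" "mat_adjoint U * U = 1\<^sub>m q"
    "\<And>c. c \<in> carrier_vec q \<Longrightarrow> sqnorm (G 1 *\<^sub>v (U *\<^sub>v c)) = (\<Sum>i<q. (sv i)\<^sup>2 * (cmod (c $ i))\<^sup>2)"
    using svd[of 1] by auto
  have dim: "dim_col (G 1) = q" using carrier_matD(2)[OF G_carrier] .
  have "l2_norm_vec (G 1 *\<^sub>v v) \<le> sv 0" if v: "v \<in> carrier_vec q" "l2_norm_vec v = 1" for v
  proof -
    define c where "c = mat_adjoint U *\<^sub>v v"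
    have c: "c \<in> carrier_vec q" using U(1) by (simp add: c_def)
    have vc: "v = U *\<^sub>v c"
      unfolding c_def using unitary_right_inverse[OF U(1,2)] v(1) U(1)
      by (simp add: assoc_mult_mat_vec[symmetric, of U q q _ q])
    have "sqnorm c = 1" using sqnorm_isometry[OF U(1,2) c] v(2) vc
      by (simp add: l2_norm_vec_sqnorm)
    have "sqnorm (G 1 *\<^sub>v v) = (\<Sum>i<q. (sv i)\<^sup>2 * (cmod (c $ i))\<^sup>2)" unfolding vc by (rule U(3)[OF c])
    also have "\<dots> \<le> (\<Sum>i<q. (sv 0)\<^sup>2 * (cmod (c $ i))\<^sup>2)"
      using sv_mono[of 0] sv_nonneg by (intro sum_mono mult_right_mono power_mono) auto
    also have "\<dots> = (sv 0)\<^sup>2" using \<open>sqnorm c = 1\<close> c by (simp add: sqnorm_def sum_distrib_left[symmetric])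
    finally show ?thesis unfolding l2_norm_vec_sqnorm using sv_nonneg by (intro real_le_lsqrt) auto
  qed
  moreover have "\<exists>v \<in> carrier_vec q. l2_norm_vec v = 1 \<and> l2_norm_vec (G 1 *\<^sub>v v) = sv 0"
  proof -
    \<comment> \<open>The first right singular vector attains the supremum.\<close>
    define c :: "complex vec" where "c = unit_vec q 0"
    have c: "c \<in> carrier_vec q" by (simp add: c_def)
    have c2: "(cmod (c $ i))\<^sup>2 = (if i = 0 then 1 else 0)" if "i < q" for i using q that by (simp add: c_def unit_vec_def)
    have "sqnorm c = 1" using q c c2 by (simp add: sqnorm_def)
    hence "l2_norm_vec (U *\<^sub>v c) = 1" using sqnorm_isometry[OF U(1,2) c] by (simp add: l2_norm_vec_sqnorm)
    moreover have "sqnorm (G 1 *\<^sub>v (U *\<^sub>v c)) = (sv 0)\<^sup>2"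
    proof -
      have "(\<Sum>i<q. (sv i)\<^sup>2 * (cmod (c $ i))\<^sup>2) = (\<Sum>i<q. if i = 0 then (sv 0)\<^sup>2 else 0)"
        using c2 by (intro sum.cong) (simp_all del: power_eq_0_iff zero_less_power2)
      thus ?thesis unfolding U(3)[OF c] using q by simp
    qed
    ultimately show ?thesis using U(1) c sv_nonneg[of 0] by (intro bexI[of _ "U *\<^sub>v c"]) (auto simp: l2_norm_vec_sqnorm)
  qed
  then obtain v where "v \<in> carrier_vec q" "l2_norm_vec v = 1" "l2_norm_vec (G 1 *\<^sub>v v) = sv 0" by blast
  hence "sv 0 \<in> (\<lambda>v. l2_norm_vec (G 1 *\<^sub>v v)) ` {v \<in> carrier_vec q. l2_norm_vec v = 1}"
    by (intro image_eqI[of _ _ v]) auto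
  ultimately show ?thesis unfolding spectral_norm_def dim by (intro cSup_eq_maximum) auto
qed

end

subsection \<open>Isotropic subspaces of a matrix pencil\<close>

text \<open>By triangularity, entry \<open>(i, j)\<close> of the equation involves only entries
  \<open>(a, b)\<close> with \<open>a \<le> i\<close> and \<open>b \<le> j\<close>. By induction on
  \<open>i + j\<close> all but the last vanish, leaving a multiple of that entry by
  \<open>1 - cnj u_ii * v_jj\<close>. The rectangular form also serves mixed blocks.\<close>

lemma triangular_Stein_zero:
  fixes \<Phi> U V :: "complex mat"
  assumes P: "\<Phi> \<in> carrier_mat k l" and U: "U \<in> carrier_mat k k" "upper_triangular U"
    and V: "V \<in> carrier_mat l l" "upper_triangular V"
    and eq: "mat_adjoint U * \<Phi> * V = \<Phi>"
    and ne: "\<And>i j. i < k \<Longrightarrow> j < l \<Longrightarrow> cnj (U $$ (i, i)) * V $$ (j, j) \<noteq> 1"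
  shows "\<Phi> = 0\<^sub>m k l"
proof -
  have expand: "\<Phi> $$ (i, j) = (\<Sum>(a, b)\<in>{..<k} \<times> {..<l}. cnj (U $$ (a, i)) * \<Phi> $$ (a, b) * V $$ (b, j))"
    if "i < k" "j < l" for i j
  proof -
    have "\<Phi> $$ (i, j) = (\<Phi> *\<^sub>v col V j) \<bullet>c col U i"
      using adjoint_sandwich_index[OF P U(1) V(1) that] eq by simp
    also have "\<dots> = (\<Sum>a<k. (\<Sum>b<l. \<Phi> $$ (a, b) * V $$ (b, j)) * cnj (U $$ (a, i)))"
      using that P U V by (simp add: scalar_prod_def lessThan_atLeast0)
    also have "\<dots> = (\<Sum>a<k. \<Sum>b<l. cnj (U $$ (a, i)) * \<Phi> $$ (a, b) * V $$ (b, j))"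
      by (simp add: sum_distrib_right sum_distrib_left mult_ac)
    finally show ?thesis by (simp add: sum.cartesian_product)
  qed
  have "\<Phi> $$ (i, j) = 0" if "i < k" "j < l" for i j
    using that
  proof (induction "i + j" arbitrary: i j rule: less_induct)
    case less
    have "(\<Sum>(a, b)\<in>{..<k} \<times> {..<l}. cnj (U $$ (a, i)) * \<Phi> $$ (a, b) * V $$ (b, j))
      = (\<Sum>(a, b)\<in>{(i, j)}. cnj (U $$ (a, i)) * \<Phi> $$ (a, b) * V $$ (b, j))"
    proof (intro sum.mono_neutral_right ballI)
      fix x assume x: "x \<in> {..<k} \<times> {..<l} - {(i, j)}"
      obtain a b where ab: "x = (a, b)" "a < k" "b < l" "(a, b) \<noteq> (i, j)" using x by auto
      have "cnj (U $$ (a, i)) * \<Phi> $$ (a, b) * V $$ (b, j) = 0"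
      proof (cases "i < a \<or> j < b")
        case True
        thus ?thesis using U V ab unfolding upper_triangular_def by auto
      next
        case False
        hence "a + b < i + j" using ab(4) by auto
        thus ?thesis using less.hyps ab by simp
      qed
      thus "(case x of (a, b) \<Rightarrow> cnj (U $$ (a, i)) * \<Phi> $$ (a, b) * V $$ (b, j)) = 0" using ab by simp
    qed (use less.prems in auto)
    hence "\<Phi> $$ (i, j) = (cnj (U $$ (i, i)) * V $$ (j, j)) * \<Phi> $$ (i, j)"
      using expand[OF less.prems] by (simp add: mult_ac)
    hence "(1 - cnj (U $$ (i, i)) * V $$ (j, j)) * \<Phi> $$ (i, j) = 0" by (simp add: algebra_simps)
    thus ?case using ne[OF less.prems] by simp
  qed
  thus ?thesis using P by (intro eq_matI) auto
qed

text \<open>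
  On a deflating subspace \<open>B X U = - B\<^sup>* X\<close> of the pencil \<open>\<omega> B + B\<^sup>*\<close> the form of \<open>B\<close> is preserved by \<open>U\<close>.
\<close>

lemma deflating_form_invariant:
  fixes B X Y U V :: "complex mat"
  assumes B: "B \<in> carrier_mat n n" and X: "X \<in> carrier_mat n k" and Y: "Y \<in> carrier_mat n l"
    and U: "U \<in> carrier_mat k k" and V: "V \<in> carrier_mat l l"
    and XU: "B * (X * U) = - (mat_adjoint B * X)" and YV: "B * (Y * V) = - (mat_adjoint B * Y)"
  shows "mat_adjoint U * (mat_adjoint X * B * Y) * V = mat_adjoint X * B * Y"
proof -
  note Ba = mat_adjoint_carrier[OF B] and Xa = mat_adjoint_carrier[OF X] and Ua = mat_adjoint_carrier[OF U]
  note BY = mult_carrier_mat[OF B Y] and XUc = mult_carrier_mat[OF X U] and BYa = mult_carrier_mat[OF Ba Y]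
  note XUa = mat_adjoint_carrier[OF XUc]
  have XBY: "mat_adjoint X * B * Y = mat_adjoint X * (B * Y)" by (rule assoc_mult_mat[OF Xa B Y])
  have "mat_adjoint U * (mat_adjoint X * B * Y) * V = mat_adjoint U * ((mat_adjoint X * (B * Y)) * V)"
    unfolding XBY by (rule assoc_mult_mat[OF Ua mult_carrier_mat[OF Xa BY] V])
  also have "(mat_adjoint X * (B * Y)) * V = mat_adjoint X * ((B * Y) * V)"
    by (rule assoc_mult_mat[OF Xa BY V])
  also have "(B * Y) * V = - (mat_adjoint B * Y)"
    using YV assoc_mult_mat[OF B Y V] by simp
  also have "mat_adjoint U * (mat_adjoint X * (- (mat_adjoint B * Y))) = (mat_adjoint U * mat_adjoint X) * (- (mat_adjoint B * Y))"
    by (rule assoc_mult_mat[OF Ua Xa uminus_carrier_mat[OF BYa], symmetric])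
  also have "mat_adjoint U * mat_adjoint X = mat_adjoint (X * U)"
    by (rule mat_adjoint_mult[OF X U, symmetric])
  also have "mat_adjoint (X * U) * (- (mat_adjoint B * Y)) = - (mat_adjoint (X * U) * (mat_adjoint B * Y))"
    using X BYa B by (intro uminus_mult_right_mat) auto
  also have "mat_adjoint (X * U) * (mat_adjoint B * Y) = (mat_adjoint (X * U) * mat_adjoint B) * Y"
    by (rule assoc_mult_mat[OF XUa Ba Y, symmetric])
  also have "mat_adjoint (X * U) * mat_adjoint B = mat_adjoint (B * (X * U))"
    by (rule mat_adjoint_mult[OF B XUc, symmetric])
  also have "\<dots> = - (mat_adjoint X * B)"
    unfolding XU mat_adjoint_uminus using mat_adjoint_mult[OF Ba X] by simp
  also have "- (- (mat_adjoint X * B) * Y) = mat_adjoint X * B * Y"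
    using B Y by (subst uminus_mult_left_mat) auto
  finally show ?thesis .
qed

lemma unit_circle_infinite: "infinite {\<omega> :: complex. cmod \<omega> = 1}"
proof
  assume fin: "finite {\<omega> :: complex. cmod \<omega> = 1}"
  define N where "N = Suc (card {\<omega> :: complex. cmod \<omega> = 1})"
  have "{\<omega> :: complex. \<omega> ^ N = 1} \<subseteq> {\<omega>. cmod \<omega> = 1}"
  proof
    fix \<omega> :: complex assume "\<omega> \<in> {\<omega>. \<omega> ^ N = 1}"
    hence "cmod \<omega> ^ N = 1 ^ N" by (simp add: norm_power[symmetric])
    hence "cmod \<omega> = 1" by (rule power_eq_imp_eq_base) (auto simp: N_def)
    thus "\<omega> \<in> {\<omega>. cmod \<omega> = 1}" by simp
  qed
  from card_mono[OF fin this] show False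
    using card_roots_unity_eq[of N] by (simp add: N_def)
qed

text \<open>The determinant of the pencil is computed only for unimodular \<open>\<omega>\<close>;
  an infinite set of points carries the formula to all \<open>\<omega>\<close>.\<close>

lemma poly_eq_on_unit_circle:
  fixes P Q :: "complex poly"
  assumes "\<And>\<omega>. cmod \<omega> = 1 \<Longrightarrow> poly P \<omega> = poly Q \<omega>"
  shows "P = Q"
proof (rule ccontr)
  assume "P \<noteq> Q"
  hence "finite {\<omega>. poly (P - Q) \<omega> = 0}" by (intro poly_roots_finite) simp
  moreover have "{\<omega>. cmod \<omega> = 1} \<subseteq> {\<omega>. poly (P - Q) \<omega> = 0}" using assms by auto
  ultimately show False using unit_circle_infinite finite_subset by blast
qed

lemma det_mat_adjoint:
  fixes B :: "complex mat"
  assumes "B \<in> carrier_mat n n"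
  shows "det (mat_adjoint B) = cnj (det B)"
proof -
  interpret cnj_hom: comm_ring_hom cnj by unfold_locales auto
  have "mat_adjoint B = map_mat cnj (transpose_mat B)" using assms by (intro eq_matI) auto
  hence "det (mat_adjoint B) = cnj (det (transpose_mat B))" by (simp add: cnj_hom.hom_det)
  thus ?thesis using det_transpose[OF assms] by simp
qed

text \<open>Constant and leading coefficients are conjugate, so \<open>|\<mu> \<nu>| = 1\<close>,
  and the bound on \<open>e\<close> excludes unimodular roots; the root inside is then named
  \<open>\<mu>\<close>. The bound is the premise of an implication, so that roots can be chosen for
  every \<open>e\<close>, including those for which \<open>z\<close> is not interior.\<close>

lemma reciprocal_quadratic_roots:
  fixes a b :: complex and e :: real
  assumes ab: "a \<noteq> 0" "b \<noteq> 0"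
  shows "\<exists>\<mu> \<nu>. [:cnj a, a:] * [:cnj b, b:] - [:0, of_real e:] = Polynomial.smult (a * b) ([:- \<mu>, 1:] * [:- \<nu>, 1:])
    \<and> (2 * cmod (a * b) + 2 * Re (a * cnj b) < e \<longrightarrow> cmod \<mu> < 1)"
proof -
  define Q where "Q = [:cnj a, a:] * [:cnj b, b:] - [:0, of_real e:]"
  have Q: "Q = [:cnj (a * b), 2 * of_real (Re (a * cnj b)) - of_real e, a * b:]"
    unfolding Q_def by (simp add: algebra_simps complex_eq_iff)
  have degQ: "degree Q = 2" and lead: "lead_coeff Q = a * b" unfolding Q using ab by auto
  obtain as where as: "Polynomial.smult (lead_coeff Q) (\<Prod>x\<leftarrow>as. [:- x, 1:]) = Q"
    using fundamental_theorem_algebra_factorized[of Q] by blast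
  have "length as = 2"
  proof -
    have "degree Q = degree (\<Prod>x\<leftarrow>as. [:- x, 1:])"
      unfolding as[symmetric, unfolded lead] using ab by simp
    thus ?thesis using degQ degree_linear_factors[of uminus as] by simp
  qed
  then obtain \<mu> \<nu> where "as = [\<mu>, \<nu>]" by (metis (no_types) Suc_1 length_0_conv length_Suc_conv One_nat_def)
  hence fac: "Q = Polynomial.smult (a * b) ([:- \<mu>, 1:] * [:- \<nu>, 1:])" using as lead by simp
  have "cnj (a * b) = a * b * (\<mu> * \<nu>)"
    using arg_cong[OF fac, of "\<lambda>P. coeff P 0"] unfolding Q by simp
  hence "cmod (cnj (a * b)) = cmod (a * b) * (cmod \<mu> * cmod \<nu>)" by (simp only: norm_mult)
  hence prod1: "cmod \<mu> * cmod \<nu> = 1" using ab by (simp add: norm_mult)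
  show ?thesis
  proof (cases "2 * cmod (a * b) + 2 * Re (a * cnj b) < e")
    case False
    thus ?thesis using fac unfolding Q_def by blast
  next
    case True
    have "cmod \<mu> \<noteq> 1"
    proof
      assume m1: "cmod \<mu> = 1"
      hence mm: "\<mu> * cnj \<mu> = 1" using complex_norm_square[of \<mu>] by simp
      have "poly [:- \<mu>, 1:] \<mu> = 0" by simp
      hence "poly Q \<mu> = 0" unfolding fac poly_smult poly_mult by simp
      \<comment> \<open>The factor \<open>cnj \<mu>\<close>, the inverse of \<open>\<mu>\<close>,
        turns the equation into the real one
        \<open>2 Re (\<mu> a b) + 2 Re (a conj b) - e = 0\<close>.\<close>
      hence "0 = cnj \<mu> * (cnj (a * b) + \<mu> * (2 * of_real (Re (a * cnj b)) - of_real e + \<mu> * (a * b)))"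
        unfolding Q by simp
      also have "\<dots> = cnj (\<mu> * (a * b)) + (\<mu> * cnj \<mu>) * (2 * of_real (Re (a * cnj b)) - of_real e) + (\<mu> * cnj \<mu>) * (\<mu> * (a * b))"
        by (simp add: algebra_simps)
      also have "\<dots> = cnj (\<mu> * (a * b)) + \<mu> * (a * b) + of_real (2 * Re (a * cnj b) - e)"
        unfolding mm by simp
      finally have "Re (cnj (\<mu> * (a * b)) + \<mu> * (a * b) + of_real (2 * Re (a * cnj b) - e)) = 0" by (metis zero_complex.sel(1))
      hence "2 * Re (\<mu> * (a * b)) + 2 * Re (a * cnj b) - e = 0"
        by (simp only: plus_complex.sel complex_cnj Re_complex_of_real complex.sel cnj.sel)
      moreover have "Re (\<mu> * (a * b)) \<le> cmod (a * b)"
        using complex_Re_le_cmod[of "\<mu> * (a * b)"] m1 by (simp only: norm_mult)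
      ultimately show False using True by linarith
    qed
    then consider "cmod \<mu> < 1" | "cmod \<nu> < 1"
    proof (cases "cmod \<mu> < 1")
      case False
      hence "1 < cmod \<mu>" using \<open>cmod \<mu> \<noteq> 1\<close> by simp
      moreover have "0 < cmod \<nu>" using prod1 by (metis mult_zero_right norm_eq_zero zero_less_norm_iff zero_neq_one)
      ultimately have "1 * cmod \<nu> < cmod \<mu> * cmod \<nu>" by (rule mult_strict_right_mono)
      thus ?thesis using that prod1 by simp
    qed auto
    thus ?thesis
    proof cases
      case 1 thus ?thesis using fac unfolding Q_def by blast
    next
      case 2
      have "Q = Polynomial.smult (a * b) ([:- \<nu>, 1:] * [:- \<mu>, 1:])" using fac by (simp only: mult.commute)
      thus ?thesis using 2 unfolding Q_def by blast
    qed
  qed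
qed

text \<open>In an eigenbasis of the Gram matrix of \<open>K\<close> the eigenvalues are squared
  norms \<open>f i\<close>, so \<open>f i + \<tau>\<close> has a real root. The use is to solve a
  quadratic matrix equation by completing the square, with unknown \<open>L - K\<close>.\<close>

lemma gram_shift_root:
  fixes K :: "complex mat"
  assumes K: "K \<in> carrier_mat m h" and \<tau>: "0 \<le> \<tau>"
  shows "\<exists>L \<in> carrier_mat h h. \<forall>c \<in> carrier_vec h. \<forall>d \<in> carrier_vec h.
    (L *\<^sub>v d) \<bullet>c (L *\<^sub>v c) = (K *\<^sub>v d) \<bullet>c (K *\<^sub>v c) + of_real \<tau> * (d \<bullet>c c)"
proof -
  define H where "H = mat_adjoint K * K"
  have H: "H \<in> carrier_mat h h" unfolding H_def using K by auto
  have "mat_adjoint H = H" unfolding H_def using mat_adjoint_mult[OF mat_adjoint_carrier[OF K] K] by simp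
  moreover obtain es where "char_poly H = (\<Prod>e\<leftarrow>es. [:- e, 1:])" using char_poly_factorized[OF H] by blast
  ultimately obtain U where U: "U \<in> carrier_mat h h" "mat_adjoint U * U = 1\<^sub>m h"
    "mat_adjoint U * H * U = mat_diag h (\<lambda>i. es ! i)"
    using hermitian_diagonalization[OF H] by blast
  define f where "f i = sqnorm (K *\<^sub>v col U i)" for i
  have KK: "(K *\<^sub>v x) \<bullet>c (K *\<^sub>v y) = (H *\<^sub>v x) \<bullet>c y" if "x \<in> carrier_vec h" "y \<in> carrier_vec h" for x y
    using cscalar_sandwich[OF one_carrier_mat K that] K that
    by (simp add: H_def right_mult_one_mat[of _ h m])
  have f: "es ! i = of_real (f i)" if "i < h" for i
  proof -
    have "col U i \<in> carrier_vec h" using U(1) that by auto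
    hence "complex_of_real (f i) = (H *\<^sub>v col U i) \<bullet>c col U i"
      unfolding f_def sqnorm_cscalar[symmetric] by (intro KK)
    also have "\<dots> = (mat_adjoint U * H * U) $$ (i, i)"
      using adjoint_sandwich_index[OF H U(1) U(1) that that] by simp
    finally show ?thesis unfolding U(3) using that by simp
  qed
  define L where "L = mat_diag h (\<lambda>i. complex_of_real (sqrt (f i + \<tau>))) * mat_adjoint U"
  have L: "L \<in> carrier_mat h h" unfolding L_def using U(1) by (auto intro!: mult_carrier_mat)
  have diag: "mat_diag h g *\<^sub>v x = vec h (\<lambda>i. g i * x $ i)" if "x \<in> carrier_vec h" for g :: "nat \<Rightarrow> complex" and x
  proof (rule eq_vecI)
    fix i assume "i < dim_vec (vec h (\<lambda>i. g i * x $ i))"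
    hence i: "i < h" by simp
    have "(mat_diag h g *\<^sub>v x) $ i = (\<Sum>j\<in>{0..<h}. (if i = j then g j else 0) * x $ j)"
      using i that by (simp add: scalar_prod_def)
    also have "\<dots> = (\<Sum>j\<in>{0..<h}. if j = i then g i * x $ i else 0)"
      by (rule sum.cong) auto
    finally show "(mat_diag h g *\<^sub>v x) $ i = vec h (\<lambda>i. g i * x $ i) $ i" using i by simp
  qed simp
  have "(L *\<^sub>v d) \<bullet>c (L *\<^sub>v c) = (K *\<^sub>v d) \<bullet>c (K *\<^sub>v c) + of_real \<tau> * (d \<bullet>c c)"
    if c: "c \<in> carrier_vec h" and d: "d \<in> carrier_vec h" for c d
  proof -
    define c' where "c' = mat_adjoint U *\<^sub>v c"
    define d' where "d' = mat_adjoint U *\<^sub>v d"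
    have cd': "c' \<in> carrier_vec h" "d' \<in> carrier_vec h" using U(1) by (auto simp: c'_def d'_def)
    have UU: "U *\<^sub>v (mat_adjoint U *\<^sub>v x) = x" if "x \<in> carrier_vec h" for x
      using unitary_right_inverse[OF U(1,2)] that U(1)
      by (simp add: assoc_mult_mat_vec[symmetric, of U h h _ h])
    have Lx: "L *\<^sub>v x = vec h (\<lambda>i. of_real (sqrt (f i + \<tau>)) * (mat_adjoint U *\<^sub>v x) $ i)" if "x \<in> carrier_vec h" for x
      unfolding L_def using U(1) that
      by (subst assoc_mult_mat_vec[of _ h h _ h]) (auto simp: diag)
    have sq: "complex_of_real (sqrt (f i + \<tau>)) * complex_of_real (sqrt (f i + \<tau>)) = of_real (f i) + of_real \<tau>" for i
    proof -
      have "sqrt (f i + \<tau>) * sqrt (f i + \<tau>) = f i + \<tau>" using \<tau> by (simp add: f_def)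
      thus ?thesis by (metis of_real_add of_real_mult)
    qed
    have "(L *\<^sub>v d) \<bullet>c (L *\<^sub>v c) = (\<Sum>i<h. (of_real (sqrt (f i + \<tau>)) * of_real (sqrt (f i + \<tau>))) * (d' $ i * cnj (c' $ i)))"
      unfolding Lx[OF c] Lx[OF d] c'_def[symmetric] d'_def[symmetric]
      by (simp add: scalar_prod_def lessThan_atLeast0 mult_ac)
    also have "\<dots> = (\<Sum>i<h. of_real (f i) * d' $ i * cnj (c' $ i)) + of_real \<tau> * (\<Sum>i<h. d' $ i * cnj (c' $ i))"
      unfolding sq by (simp add: algebra_simps sum.distrib sum_distrib_left)
    also have "(\<Sum>i<h. d' $ i * cnj (c' $ i)) = d' \<bullet>c c'"
      using cd' by (simp add: scalar_prod_def lessThan_atLeast0)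
    also have "d' \<bullet>c c' = d \<bullet>c c"
      using cscalar_mult_mat_vec[of "mat_adjoint U" h h d c'] U(1) d cd' UU[OF c] by (simp add: d'_def c'_def)
    also have "(\<Sum>i<h. of_real (f i) * d' $ i * cnj (c' $ i)) = (mat_diag h (\<lambda>i. es ! i) *\<^sub>v d') \<bullet>c c'"
      unfolding diag[OF cd'(2)] using cd' f by (simp add: scalar_prod_def lessThan_atLeast0)
    also have "\<dots> = (H *\<^sub>v (U *\<^sub>v d')) \<bullet>c (U *\<^sub>v c')"
      using cscalar_sandwich[OF H U(1) cd'(2) cd'(1)] U(3) by simp
    also have "\<dots> = (K *\<^sub>v d) \<bullet>c (K *\<^sub>v c)"
      using KK[OF d c] UU[OF d] UU[OF c] by (simp add: d'_def c'_def)
    finally show ?thesis .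
  qed
  thus ?thesis using L by blast
qed

lemma prod_list_smult_product:
  fixes g h :: "'b \<Rightarrow> complex poly"
  shows "(\<Prod>x\<leftarrow>xs. Polynomial.smult c (g x * h x))
    = Polynomial.smult (c ^ length xs) ((\<Prod>x\<leftarrow>xs. g x) * (\<Prod>x\<leftarrow>xs. h x))"
  by (induction xs) (simp_all add: mult_ac)

text \<open>Schur triangularization respects the order of \<open>L\<close>, and the first
  \<open>k\<close> columns of \<open>P\<close> span a subspace on which \<open>T\<close> acts by the
  leading block of \<open>S\<close>. Listing eigenvalues first in \<open>L\<close> therefore selects
  the subspace.\<close>

lemma leading_columns_deflating:
  fixes T :: "complex mat"
  assumes T: "T \<in> carrier_mat n n" and cp: "char_poly T = (\<Prod>e\<leftarrow>L. [:- e, 1:])" and k: "k \<le> n"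
  shows "\<exists>X \<in> carrier_mat n k. \<exists>U \<in> carrier_mat k k. upper_triangular U \<and> (\<forall>i<k. U $$ (i, i) = L ! i)
    \<and> T * X = X * U \<and> (\<forall>c \<in> carrier_vec k. X *\<^sub>v c = 0\<^sub>v n \<longrightarrow> c = 0\<^sub>v k)"
proof -
  obtain S P Q where schur: "schur_decomposition T L = (S, P, Q)" by (cases "schur_decomposition T L") auto
  have sim: "similar_mat_wit T S P Q" and ut: "upper_triangular S" and diag: "diag_mat S = L"
    using schur_decomposition[OF T cp schur] by auto
  have PQ: "P * Q = 1\<^sub>m n" "Q * P = 1\<^sub>m n" "T = P * S * Q"
    and S: "S \<in> carrier_mat n n" and P: "P \<in> carrier_mat n n" and Q: "Q \<in> carrier_mat n n"
    using similar_mat_witD2[OF T sim] by auto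
  have TP: "T * P = P * S"
  proof -
    have "T * P = (P * S) * (Q * P)" unfolding PQ(3) using P S Q by (intro assoc_mult_mat) auto
    thus ?thesis using PQ(2) P S by simp
  qed
  define X where "X = mat n k (\<lambda>(i, j). P $$ (i, j))"
  define U where "U = mat k k (\<lambda>(i, j). S $$ (i, j))"
  have X: "X \<in> carrier_mat n k" and U: "U \<in> carrier_mat k k" by (auto simp: X_def U_def)
  have "upper_triangular U" using ut S k by (auto simp: U_def upper_triangular_def)
  moreover have "U $$ (i, i) = L ! i" if "i < k" for i
    using that k S by (auto simp: U_def diag[symmetric] diag_mat_def)
  moreover have "T * X = X * U"
  proof (rule eq_matI)
    fix i j assume "i < dim_row (X * U)" "j < dim_col (X * U)"
    hence ij: "i < n" "j < k" using X U by auto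
    have "(T * X) $$ (i, j) = (T * P) $$ (i, j)"
    proof -
      have "col X j = col P j" using ij k P by (intro eq_vecI) (auto simp: X_def)
      thus ?thesis using ij k T X P by simp
    qed
    also have "\<dots> = (\<Sum>l\<in>{0..<n}. P $$ (i, l) * S $$ (l, j))"
      unfolding TP using ij k P S by (simp add: scalar_prod_def)
    also have "\<dots> = (\<Sum>l\<in>{0..<k}. P $$ (i, l) * S $$ (l, j))"
      using ij k ut S by (intro sum.mono_neutral_right) (auto simp: upper_triangular_def)
    also have "\<dots> = (X * U) $$ (i, j)"
      using ij k by (simp add: scalar_prod_def X_def U_def)
    finally show "(T * X) $$ (i, j) = (X * U) $$ (i, j)" .
  qed (use T X U in auto)
  moreover have "c = 0\<^sub>v k" if c: "c \<in> carrier_vec k" "X *\<^sub>v c = 0\<^sub>v n" for c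
  proof -
    define d where "d = vec n (\<lambda>i. if i < k then c $ i else 0)"
    have d: "d \<in> carrier_vec n" by (simp add: d_def)
    have "P *\<^sub>v d = X *\<^sub>v c"
    proof (rule eq_vecI)
      fix i assume "i < dim_vec (X *\<^sub>v c)"
      hence i: "i < n" using X by simp
      have "(P *\<^sub>v d) $ i = (\<Sum>l\<in>{0..<n}. P $$ (i, l) * d $ l)"
        using i P d by (simp add: scalar_prod_def)
      also have "\<dots> = (\<Sum>l\<in>{0..<k}. P $$ (i, l) * d $ l)"
        using k by (intro sum.mono_neutral_right) (auto simp: d_def)
      also have "\<dots> = (\<Sum>l\<in>{0..<k}. P $$ (i, l) * c $ l)"
        using k by (intro sum.cong) (auto simp: d_def)
      also have "\<dots> = (X *\<^sub>v c) $ i" using i k c(1) by (simp add: scalar_prod_def X_def)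
      finally show "(P *\<^sub>v d) $ i = (X *\<^sub>v c) $ i" .
    qed (use P X in auto)
    hence Pd: "P *\<^sub>v d = 0\<^sub>v n" using c(2) by simp
    have "Q *\<^sub>v (P *\<^sub>v d) = d"
      using PQ(2) P Q d by (simp add: assoc_mult_mat_vec[symmetric, of Q n n P n])
    hence d0: "d = 0\<^sub>v n" unfolding Pd using mult_mat_zero_vec[OF Q] by simp
    show "c = 0\<^sub>v k"
    proof (rule eq_vecI)
      fix i assume "i < dim_vec (0\<^sub>v k :: complex vec)"
      hence i: "i < k" by simp
      have "d $ i = c $ i" using i k by (simp add: d_def)
      thus "c $ i = 0\<^sub>v k $ i" using d0 i k by simp
    qed (use c in auto)
  qed
  ultimately show ?thesis using X U by blast
qed

section \<open>The pencil of a block matrix and points inside the ellipses\<close>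

context scalar_block_matrix
begin

lemma shifted_block:
  "A - z \<cdot>\<^sub>m 1\<^sub>m n = four_block_mat ((\<alpha> - z) \<cdot>\<^sub>m 1\<^sub>m r) C D ((\<beta> - z) \<cdot>\<^sub>m 1\<^sub>m q)"
  unfolding A_def using C D by (intro eq_matI) auto

text \<open>Unimodularity makes the lower left block \<open>\<omega> D + C^*\<close> equal to
  \<open>\<omega>\<close> times the adjoint of \<open>G(\<omega>)\<close>.\<close>

lemma pencil_block:
  fixes z \<omega> :: complex
  assumes \<omega>: "cmod \<omega> = 1"
  defines "B \<equiv> A - z \<cdot>\<^sub>m 1\<^sub>m n"
  shows "\<omega> \<cdot>\<^sub>m B + mat_adjoint B = four_block_mat ((\<omega> * (\<alpha> - z) + cnj (\<alpha> - z)) \<cdot>\<^sub>m 1\<^sub>m r) (G \<omega>)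
    (\<omega> \<cdot>\<^sub>m mat_adjoint (G \<omega>)) ((\<omega> * (\<beta> - z) + cnj (\<beta> - z)) \<cdot>\<^sub>m 1\<^sub>m q)"
proof -
  have ww: "\<omega> * (cnj \<omega> * x) = x" for x
    using \<omega> complex_norm_square[of \<omega>] by (simp add: mult.assoc[symmetric])
  show ?thesis unfolding B_def shifted_block rotated_off_diagonal_def
    using C D by (intro eq_matI) (auto simp: algebra_simps ww)
qed

text \<open>Right multiplication by \<open>E\<close> is a Schur complement step without division: it
  clears the upper right block and leaves \<open>x y - \<omega> K\<close> below, at the price of
  \<open>det E = x^q\<close>. That factor stays on the left because \<open>x\<close> can vanish on
  the unit circle.\<close>

lemma det_pencil:
  fixes z \<omega> :: complex
  assumes \<omega>: "cmod \<omega> = 1"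
  defines "B \<equiv> A - z \<cdot>\<^sub>m 1\<^sub>m n"
    and "x \<equiv> \<omega> * (\<alpha> - z) + cnj (\<alpha> - z)" and "y \<equiv> \<omega> * (\<beta> - z) + cnj (\<beta> - z)"
  shows "x ^ q * det (\<omega> \<cdot>\<^sub>m B + mat_adjoint B)
    = x ^ r * ((\<Prod>e\<leftarrow>s. x * y - \<omega> * of_real (e\<^sup>2)) * (x * y) ^ (q - p))"
proof -
  define K where "K = mat_adjoint (G \<omega>) * G \<omega>"
  note Ga = mat_adjoint_carrier[OF G_carrier[of \<omega>]]
  have K: "K \<in> carrier_mat q q" unfolding K_def by (rule mult_carrier_mat[OF Ga G_carrier])
  have w0: "\<omega> \<noteq> 0" using \<omega> by auto
  define N where "N = \<omega> \<cdot>\<^sub>m B + mat_adjoint B"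
  define E where "E = four_block_mat (1\<^sub>m r) (- G \<omega>) (0\<^sub>m q r) (x \<cdot>\<^sub>m 1\<^sub>m q)"
  have Nb: "N = four_block_mat (x \<cdot>\<^sub>m 1\<^sub>m r) (G \<omega>) (\<omega> \<cdot>\<^sub>m mat_adjoint (G \<omega>)) (y \<cdot>\<^sub>m 1\<^sub>m q)"
    unfolding N_def B_def x_def y_def by (rule pencil_block[OF \<omega>])
  have Nc: "N \<in> carrier_mat n n" unfolding Nb by auto
  have Ec: "E \<in> carrier_mat n n" unfolding E_def by auto
  have detE: "det E = x ^ q"
    unfolding E_def by (subst det_four_block_mat_lower_left_zero[of _ r _ q]) auto
  have "N * E = four_block_mat (x \<cdot>\<^sub>m 1\<^sub>m r) (0\<^sub>m r q) (\<omega> \<cdot>\<^sub>m mat_adjoint (G \<omega>)) ((x * y) \<cdot>\<^sub>m 1\<^sub>m q - \<omega> \<cdot>\<^sub>m K)"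
  proof -
    have G: "G \<omega> \<in> carrier_mat r q" by simp
    have dG: "dim_row (G \<omega>) = r" "dim_col (G \<omega>) = q" using carrier_matD[OF G] by auto
    have 1: "(x \<cdot>\<^sub>m 1\<^sub>m r) * 1\<^sub>m r + G \<omega> * 0\<^sub>m q r = x \<cdot>\<^sub>m 1\<^sub>m r"
      using right_mult_zero_mat[OF G, of r] right_mult_one_mat[of "x \<cdot>\<^sub>m 1\<^sub>m r" r r] by (intro eq_matI) auto
    have 2: "(x \<cdot>\<^sub>m 1\<^sub>m r) * (- G \<omega>) + G \<omega> * (x \<cdot>\<^sub>m 1\<^sub>m q) = 0\<^sub>m r q"
      using G mult_smult_assoc_mat[of "1\<^sub>m r" r r "- G \<omega>" q x] mult_smult_distrib[of "G \<omega>" r q "1\<^sub>m q" q x]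
      by (intro eq_matI) (auto simp: dG left_mult_one_mat[of _ r q] right_mult_one_mat[of _ r q])
    have 3: "(\<omega> \<cdot>\<^sub>m mat_adjoint (G \<omega>)) * 1\<^sub>m r + (y \<cdot>\<^sub>m 1\<^sub>m q) * 0\<^sub>m q r = \<omega> \<cdot>\<^sub>m mat_adjoint (G \<omega>)"
      using right_mult_zero_mat[of "y \<cdot>\<^sub>m 1\<^sub>m q" q q r] right_mult_one_mat[of "\<omega> \<cdot>\<^sub>m mat_adjoint (G \<omega>)" q r] Ga
      by (intro eq_matI) (auto simp: dG)
    have 4: "(\<omega> \<cdot>\<^sub>m mat_adjoint (G \<omega>)) * (- G \<omega>) + (y \<cdot>\<^sub>m 1\<^sub>m q) * (x \<cdot>\<^sub>m 1\<^sub>m q) = (x * y) \<cdot>\<^sub>m 1\<^sub>m q - \<omega> \<cdot>\<^sub>m K"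
    proof -
      have "(\<omega> \<cdot>\<^sub>m mat_adjoint (G \<omega>)) * (- G \<omega>) = - (\<omega> \<cdot>\<^sub>m K)"
        unfolding K_def using G Ga mult_smult_assoc_mat[OF Ga G, of \<omega>] by simp
      moreover have "(y \<cdot>\<^sub>m 1\<^sub>m q) * (x \<cdot>\<^sub>m 1\<^sub>m q) = (x * y) \<cdot>\<^sub>m (1\<^sub>m q :: complex mat)"
        using mult_smult_assoc_mat[of "1\<^sub>m q" q q "x \<cdot>\<^sub>m 1\<^sub>m q" q y] 
        by (simp add: left_mult_one_mat[of _ q q]) (intro eq_matI; auto)
      ultimately show ?thesis using K by (intro eq_matI) auto
    qed
    have c: "x \<cdot>\<^sub>m 1\<^sub>m r \<in> carrier_mat r r" "\<omega> \<cdot>\<^sub>m mat_adjoint (G \<omega>) \<in> carrier_mat q r" "y \<cdot>\<^sub>m 1\<^sub>m q \<in> carrier_mat q q"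
      "- G \<omega> \<in> carrier_mat r q" "x \<cdot>\<^sub>m 1\<^sub>m q \<in> carrier_mat q q" using G Ga by auto
    show ?thesis unfolding Nb E_def
      mult_four_block_mat[OF c(1) G c(2) c(3) one_carrier_mat c(4) zero_carrier_mat c(5)] 1 2 3 4 ..
  qed
  hence "det (N * E) = det (x \<cdot>\<^sub>m 1\<^sub>m r) * det ((x * y) \<cdot>\<^sub>m 1\<^sub>m q - \<omega> \<cdot>\<^sub>m K)"
    using K by (subst det_four_block_mat_upper_right_zero[symmetric, of _ r _ q]) (auto intro!: minus_carrier_mat)
  also have "det (x \<cdot>\<^sub>m 1\<^sub>m r) = x ^ r" by simp
  \<comment> \<open>Taking \<open>\<omega>\<close> out of each row leaves the characteristic
    polynomial of \<open>K\<close> at \<open>x y / \<omega>\<close>; the powers of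
    \<open>\<omega>\<close> are then given back to the individual factors.\<close>
  also have "det ((x * y) \<cdot>\<^sub>m 1\<^sub>m q - \<omega> \<cdot>\<^sub>m K) = \<omega> ^ q * poly (char_poly K) (x * y / \<omega>)"
  proof -
    have "(x * y) \<cdot>\<^sub>m 1\<^sub>m q - \<omega> \<cdot>\<^sub>m K = \<omega> \<cdot>\<^sub>m ((x * y / \<omega>) \<cdot>\<^sub>m 1\<^sub>m q - K)"
      using K w0 by (intro eq_matI) (auto simp: field_simps)
    thus ?thesis using K poly_char_poly[OF K] by simp
  qed
  also have "\<omega> ^ q * poly (char_poly K) (x * y / \<omega>)
    = (\<Prod>e\<leftarrow>s. x * y - \<omega> * of_real (e\<^sup>2)) * (x * y) ^ (q - p)"
  proof -
    have "poly (char_poly K) (x * y / \<omega>) = (\<Prod>e\<leftarrow>s. x * y / \<omega> - of_real (e\<^sup>2)) * (x * y / \<omega>) ^ (q - p)"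
      unfolding K_def char_poly_gram[OF \<omega>] by (simp add: poly_prod_list o_def prod_list_replicate map_replicate_const)
    moreover have "\<omega> ^ length l * (\<Prod>e\<leftarrow>l. x * y / \<omega> - of_real (e\<^sup>2)) = (\<Prod>e\<leftarrow>l. x * y - \<omega> * of_real (e\<^sup>2))" for l :: "real list"
    proof (induction l)
      case (Cons e l)
      have "\<omega> * (x * y / \<omega> - of_real (e\<^sup>2)) = x * y - \<omega> * of_real (e\<^sup>2)" using w0 by (simp add: algebra_simps)
      moreover have "\<omega> ^ length (e # l) * (\<Prod>e\<leftarrow>e # l. x * y / \<omega> - of_real (e\<^sup>2))
        = (\<omega> * (x * y / \<omega> - of_real (e\<^sup>2))) * (\<omega> ^ length l * (\<Prod>e\<leftarrow>l. x * y / \<omega> - of_real (e\<^sup>2)))"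
        by (simp only: list.size list.map prod_list.Cons add_Suc_right add_0_right power_Suc mult_ac)
      ultimately show ?case unfolding Cons.IH by simp
    qed simp
    moreover have "\<omega> ^ q = \<omega> ^ p * \<omega> ^ (q - p)" using length_s by (simp add: power_add[symmetric])
    moreover have "\<omega> ^ (q - p) * (x * y / \<omega>) ^ (q - p) = (x * y) ^ (q - p)"
      using w0 by (simp add: power_mult_distrib[symmetric])
    moreover have "\<omega> ^ p * \<omega> ^ (q - p) * (S * t ^ (q - p)) = (\<omega> ^ p * S) * (\<omega> ^ (q - p) * t ^ (q - p))" for S t
      by (simp only: mult_ac)
    ultimately show ?thesis by (simp only:)
  qed
  finally have "det (N * E) = x ^ r * ((\<Prod>e\<leftarrow>s. x * y - \<omega> * of_real (e\<^sup>2)) * (x * y) ^ (q - p))" .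
  thus ?thesis using det_mult[OF Nc Ec] detE by (simp add: N_def mult.commute)
qed

text \<open>The deflating equation is \<open>T X = X U\<close> multiplied by \<open>B\<close>, for
  \<open>T = - B\<inverse> B^*\<close>, whose characteristic polynomial is the determinant of the
  pencil divided by \<open>det B\<close>. Invertibility of \<open>B\<close> is exported too, as the
  segment case cancels \<open>B\<close>.\<close>

lemma deflating_subspace:
  fixes z :: complex
  assumes z: "z \<noteq> \<alpha>" "z \<noteq> \<beta>" and k: "k \<le> p"
    and form: "\<And>i. i < k \<Longrightarrow> ellipse_form \<alpha> \<beta> z < (sv i)\<^sup>2"
  defines "B \<equiv> A - z \<cdot>\<^sub>m 1\<^sub>m n"
  obtains X U where "X \<in> carrier_mat n k" "U \<in> carrier_mat k k" "upper_triangular U"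
    "\<And>i. i < k \<Longrightarrow> cmod (U $$ (i, i)) < 1" "B * (X * U) = - (mat_adjoint B * X)"
    "\<And>c. c \<in> carrier_vec k \<Longrightarrow> X *\<^sub>v c = 0\<^sub>v n \<Longrightarrow> c = 0\<^sub>v k"
    "det B \<noteq> 0"
proof -
  define a where "a = \<alpha> - z"
  define b where "b = \<beta> - z"
  have ab: "a \<noteq> 0" "b \<noteq> 0" using z by (auto simp: a_def b_def)
  have B: "B \<in> carrier_mat n n" unfolding B_def shifted_block by auto
  note Ba = mat_adjoint_carrier[OF B]
  \<comment> \<open>The pencil as a matrix over polynomials in \<open>\<omega>\<close>, so that its
    determinant is a polynomial.\<close>
  define R where "R = mat n n (\<lambda>(i, j). [:cnj (B $$ (j, i)), B $$ (i, j):])"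
  define P where "P = det R"
  have P: "poly P \<omega> = det (\<omega> \<cdot>\<^sub>m B + mat_adjoint B)" for \<omega>
    unfolding P_def by (rule poly_det_cong[of _ n]) (use B in \<open>auto simp: R_def\<close>)
  define Lx where "Lx = [:cnj a, a:]"
  define Ly where "Ly = [:cnj b, b:]"
  define S where "S = (\<Prod>e\<leftarrow>s. Lx * Ly - [:0, complex_of_real (e\<^sup>2):])"
  have L0: "Lx \<noteq> 0" "Ly \<noteq> 0" using ab by (auto simp: Lx_def Ly_def)
  \<comment> \<open>As an identity of polynomials this permits cancelling \<open>Lx ^ q\<close>,
    even though its value vanishes at some unimodular \<open>\<omega>\<close>.\<close>
  have "Lx ^ q * P = Lx ^ r * (S * (Lx * Ly) ^ (q - p))"
  proof (rule poly_eq_on_unit_circle)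
    fix \<omega> :: complex assume \<omega>: "cmod \<omega> = 1"
    have "poly Lx \<omega> = \<omega> * a + cnj a" "poly Ly \<omega> = \<omega> * b + cnj b" by (simp_all add: Lx_def Ly_def)
    thus "poly (Lx ^ q * P) \<omega> = poly (Lx ^ r * (S * (Lx * Ly) ^ (q - p))) \<omega>"
      using det_pencil[OF \<omega>, of z] unfolding P B_def poly_mult poly_power S_def
      by (simp add: poly_prod_list o_def a_def b_def)
  qed
  also have "\<dots> = Lx ^ q * (Lx ^ (r - p) * Ly ^ (q - p) * S)"
  proof -
    have "Lx ^ r * Lx ^ (q - p) = Lx ^ q * Lx ^ (r - p)"
      using length_s length_s_le_r by (simp add: power_add[symmetric] add.commute)
    thus ?thesis by (simp add: power_mult_distrib mult_ac)
  qed
  finally have P_eq: "P = Lx ^ (r - p) * Ly ^ (q - p) * S" using L0 by simp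
  have "\<forall>e :: real. \<exists>\<mu> \<nu>. Lx * Ly - [:0, of_real e:] = Polynomial.smult (a * b) ([:- \<mu>, 1:] * [:- \<nu>, 1:])
    \<and> (2 * cmod (a * b) + 2 * Re (a * cnj b) < e \<longrightarrow> cmod \<mu> < 1)"
    unfolding Lx_def Ly_def using reciprocal_quadratic_roots[OF ab] by blast
  then obtain \<mu> \<nu> :: "real \<Rightarrow> complex" where \<mu>\<nu>:
    "\<And>e. Lx * Ly - [:0, of_real e:] = Polynomial.smult (a * b) ([:- \<mu> e, 1:] * [:- \<nu> e, 1:])"
    "\<And>e. 2 * cmod (a * b) + 2 * Re (a * cnj b) < e \<Longrightarrow> cmod (\<mu> e) < 1" by metis
  \<comment> \<open>The roots \<open>\<mu>\<close> come first and in the order of \<open>s\<close>,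
    so by \<open>form\<close> the first \<open>k\<close> entries are stable. The total count is
    \<open>2 p + (r - p) + (q - p) = n\<close>.\<close>
  define es where "es = map (\<lambda>x. \<mu> (x\<^sup>2)) s @ map (\<lambda>x. \<nu> (x\<^sup>2)) s @ replicate (r - p) (- (cnj a / a)) @ replicate (q - p) (- (cnj b / b))"
  define c where "c = (a * b) ^ p * a ^ (r - p) * b ^ (q - p)"
  have c0: "c \<noteq> 0" using ab by (simp add: c_def)
  have P_fac: "P = Polynomial.smult c (\<Prod>e\<leftarrow>es. [:- e, 1:])"
  proof -
    have "Lx = Polynomial.smult a [:- (- (cnj a / a)), 1:]" "Ly = Polynomial.smult b [:- (- (cnj b / b)), 1:]"
      using ab by (simp_all add: Lx_def Ly_def)
    hence "Lx ^ (r - p) = Polynomial.smult (a ^ (r - p)) ([:- (- (cnj a / a)), 1:] ^ (r - p))"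
      "Ly ^ (q - p) = Polynomial.smult (b ^ (q - p)) ([:- (- (cnj b / b)), 1:] ^ (q - p))"
      by (simp_all only: smult_power)
    moreover have "S = Polynomial.smult ((a * b) ^ p) ((\<Prod>x\<leftarrow>s. [:- \<mu> (x\<^sup>2), 1:]) * (\<Prod>x\<leftarrow>s. [:- \<nu> (x\<^sup>2), 1:]))"
      unfolding S_def \<mu>\<nu>(1) by (rule prod_list_smult_product)
    moreover have "(\<Prod>e\<leftarrow>es. [:- e, 1:]) = (\<Prod>x\<leftarrow>s. [:- \<mu> (x\<^sup>2), 1:]) * (\<Prod>x\<leftarrow>s. [:- \<nu> (x\<^sup>2), 1:])
      * [:- (- (cnj a / a)), 1:] ^ (r - p) * [:- (- (cnj b / b)), 1:] ^ (q - p)"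
      unfolding es_def by (simp add: o_def prod_list_replicate map_replicate_const mult.assoc)
    ultimately show ?thesis unfolding P_eq c_def by (simp only: mult_smult_left mult_smult_right smult_smult mult_ac)
  qed
  have detB: "det B \<noteq> 0"
  proof -
    \<comment> \<open>At 0 the terms with \<open>e^2\<close> drop out and only powers of
      \<open>cnj a\<close> and \<open>cnj b\<close> remain, while the pencil reduces to the adjoint
      of \<open>B\<close>.\<close>
    have "poly P 0 \<noteq> 0"
      unfolding P_eq S_def using ab by (auto simp: Lx_def Ly_def poly_prod_list prod_list_zero_iff)
    moreover have "0 \<cdot>\<^sub>m B + mat_adjoint B = mat_adjoint B" using B by (intro eq_matI) auto
    ultimately have "det (mat_adjoint B) \<noteq> 0" unfolding P by simp
    thus ?thesis unfolding det_mat_adjoint[OF B] by simp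
  qed
  define Bi where "Bi = (1 / det B) \<cdot>\<^sub>m adj_mat B"
  have adj: "adj_mat B \<in> carrier_mat n n" "B * adj_mat B = det B \<cdot>\<^sub>m 1\<^sub>m n" using adj_mat[OF B] by auto
  have Bi: "Bi \<in> carrier_mat n n" using adj by (simp add: Bi_def)
  have BBi: "B * Bi = 1\<^sub>m n"
    unfolding Bi_def mult_smult_distrib[OF B adj(1)] adj(2) using detB by (intro eq_matI) auto
  define T where "T = - (Bi * mat_adjoint B)"
  have T: "T \<in> carrier_mat n n" unfolding T_def using mult_carrier_mat[OF Bi Ba] by simp
  have BT: "B * T = - mat_adjoint B"
  proof -
    have "B * T = - (B * (Bi * mat_adjoint B))" unfolding T_def using B Bi Ba by (intro uminus_mult_right_mat) auto
    also have "B * (Bi * mat_adjoint B) = B * Bi * mat_adjoint B" by (rule assoc_mult_mat[OF B Bi Ba, symmetric])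
    finally show ?thesis unfolding BBi left_mult_one_mat[OF Ba] .
  qed
  have "Polynomial.smult (det B) (char_poly T) = P"
  proof (rule poly_eq_poly_eq_iff[THEN iffD1], rule ext)
    fix \<omega>
    have "B * (\<omega> \<cdot>\<^sub>m 1\<^sub>m n - T) = \<omega> \<cdot>\<^sub>m B + mat_adjoint B"
    proof -
      have "B * (\<omega> \<cdot>\<^sub>m 1\<^sub>m n - T) = B * (\<omega> \<cdot>\<^sub>m 1\<^sub>m n) - B * T"
        using B T by (intro mult_minus_distrib_mat) auto
      also have "B * (\<omega> \<cdot>\<^sub>m 1\<^sub>m n) = \<omega> \<cdot>\<^sub>m B"
        using mult_smult_distrib[OF B one_carrier_mat, of \<omega>] B by simp
      finally show ?thesis unfolding BT using B by (intro eq_matI) auto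
    qed
    moreover have "det (B * (\<omega> \<cdot>\<^sub>m 1\<^sub>m n - T)) = det B * det (\<omega> \<cdot>\<^sub>m 1\<^sub>m n - T)"
      by (rule det_mult[OF B]) (rule minus_carrier_mat[OF T])
    ultimately show "poly (Polynomial.smult (det B) (char_poly T)) \<omega> = poly P \<omega>"
      unfolding P using poly_char_poly[OF T, of \<omega>] by simp
  qed
  hence eq: "Polynomial.smult (det B) (char_poly T) = Polynomial.smult c (\<Prod>e\<leftarrow>es. [:- e, 1:])"
    unfolding P_fac .
  have "monic (char_poly T)" using degree_monic_char_poly[OF T] by auto
  moreover have "monic (\<Prod>e\<leftarrow>es. [:- e, 1:])" by (rule monic_prod_list) auto
  ultimately have "det B = c" using arg_cong[OF eq, of lead_coeff] unfolding lead_coeff_smult by simp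
  hence "Polynomial.smult (inverse c) (Polynomial.smult c (char_poly T))
    = Polynomial.smult (inverse c) (Polynomial.smult c (\<Prod>e\<leftarrow>es. [:- e, 1:]))" using eq by simp
  hence cp: "char_poly T = (\<Prod>e\<leftarrow>es. [:- e, 1:])" using c0 by simp
  have "k \<le> n" using k length_s by linarith
  from leading_columns_deflating[OF T cp this] obtain X U where
    X: "X \<in> carrier_mat n k" and U: "U \<in> carrier_mat k k" "upper_triangular U" "\<And>i. i < k \<Longrightarrow> U $$ (i, i) = es ! i"
    and TX: "T * X = X * U" and inj: "\<And>c. c \<in> carrier_vec k \<Longrightarrow> X *\<^sub>v c = 0\<^sub>v n \<Longrightarrow> c = 0\<^sub>v k" by blast
  have "B * (X * U) = - (mat_adjoint B * X)"
  proof -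
    have "B * (X * U) = (B * T) * X" unfolding TX[symmetric] by (rule assoc_mult_mat[OF B T X, symmetric])
    also have "\<dots> = - (mat_adjoint B * X)" unfolding BT using Ba X by (intro uminus_mult_left_mat) auto
    finally show ?thesis .
  qed
  moreover have "cmod (U $$ (i, i)) < 1" if i: "i < k" for i
  proof -
    have "es ! i = \<mu> ((sv i)\<^sup>2)" using i k by (simp add: es_def nth_append sv_def)
    thus ?thesis unfolding U(3)[OF i] using form[OF i] \<mu>\<nu>(2) by (simp add: ellipse_form_def a_def b_def)
  qed
  ultimately show ?thesis using that X U(1,2) inj detB by blast
qed

text \<open>Stable diagonal entries never have \<open>cnj u_ii * u_jj = 1\<close>, so the Stein
  equation forces isotropy. The foci are set apart because the factorization divides by
  \<open>a\<close> and \<open>b\<close>; the diagonal blocks supply them.\<close>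

lemma ellipse_interior_in_range:
  assumes z: "z \<noteq> \<alpha>" "z \<noteq> \<beta>" and k: "k \<le> p"
    and form: "\<And>i. i < k \<Longrightarrow> ellipse_form \<alpha> \<beta> z < (sv i)\<^sup>2"
  shows "z \<in> rank_numerical_range k A"
proof -
  define B where "B = A - z \<cdot>\<^sub>m 1\<^sub>m n"
  have B: "B \<in> carrier_mat n n" unfolding B_def shifted_block by auto
  obtain X U where X: "X \<in> carrier_mat n k" and U: "U \<in> carrier_mat k k" "upper_triangular U"
    "\<And>i. i < k \<Longrightarrow> cmod (U $$ (i, i)) < 1" and eq: "B * (X * U) = - (mat_adjoint B * X)"
    and inj: "\<And>c. c \<in> carrier_vec k \<Longrightarrow> X *\<^sub>v c = 0\<^sub>v n \<Longrightarrow> c = 0\<^sub>v k"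
    using deflating_subspace[OF z k form, folded B_def] by metis
  have "mat_adjoint X * B * X = 0\<^sub>m k k"
  proof (rule triangular_Stein_zero[OF _ U(1,2) U(1,2)])
    show "mat_adjoint U * (mat_adjoint X * B * X) * U = mat_adjoint X * B * X"
      by (rule deflating_form_invariant[OF B X X U(1) U(1) eq eq])
    fix i j assume ij: "i < k" "j < k"
    have "cmod (cnj (U $$ (i, i)) * U $$ (j, j)) < 1 * 1"
      unfolding norm_mult complex_mod_cnj using U(3)[OF ij(1)] U(3)[OF ij(2)] by (intro mult_strict_mono') auto
    thus "cnj (U $$ (i, i)) * U $$ (j, j) \<noteq> 1" by auto
  qed (use X B in auto)
  thus ?thesis using rank_numerical_rangeI[OF A_carrier X inj] unfolding B_def by blast
qed

end

section \<open>Points strictly between the foci\<close>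

lemma isometry_cscalar:
  fixes X :: "complex mat"
  assumes "X \<in> carrier_mat n k" "mat_adjoint X * X = 1\<^sub>m k" "c \<in> carrier_vec k" "d \<in> carrier_vec k"
  shows "(X *\<^sub>v c) \<bullet>c (X *\<^sub>v d) = c \<bullet>c d"
  using cscalar_sandwich[OF one_carrier_mat assms(1,3,4)] assms
  by (simp add: right_mult_one_mat[of _ k n])

lemma adjoint_cscalar:
  fixes E :: "complex mat"
  assumes "E \<in> carrier_mat n k" "x \<in> carrier_vec n" "y \<in> carrier_vec k"
  shows "x \<bullet>c (E *\<^sub>v y) = (mat_adjoint E *\<^sub>v x) \<bullet>c y"
  using cscalar_mult_mat_vec[OF mat_adjoint_carrier[OF assms(1)] assms(2,3)] by simp

lemma mult_mat_uminus_vec: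
  fixes A :: "complex mat"
  assumes "A \<in> carrier_mat n m" "v \<in> carrier_vec m"
  shows "A *\<^sub>v (- v) = - (A *\<^sub>v v)"
  using assms by (intro eq_vecI) auto

context scalar_block_matrix
begin

text \<open>If \<open>R f = 0\<close>, the first \<open>p\<close> right singular coordinates of
  \<open>f\<close> vanish and \<open>G f = 0\<close>. For the adjoint, left singular vectors are
  avoided: if \<open>R\<close> annihilates \<open>y = G^* x\<close>, then \<open>G y = 0\<close> and
  \<open>|y|^2 = <x, G y> = 0\<close>. So \<open>p\<close> linear conditions suffice on either
  side.\<close>

lemma kernel_bases:
  assumes \<omega>: "cmod \<omega> = 1" and h: "p + h \<le> r" "p + h \<le> q"
  obtains E F where "E \<in> carrier_mat r h" "mat_adjoint E * E = 1\<^sub>m h"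
    "F \<in> carrier_mat q h" "mat_adjoint F * F = 1\<^sub>m h"
    "\<And>c. c \<in> carrier_vec h \<Longrightarrow> mat_adjoint (G \<omega>) *\<^sub>v (E *\<^sub>v c) = 0\<^sub>v q"
    "\<And>c. c \<in> carrier_vec h \<Longrightarrow> G \<omega> *\<^sub>v (F *\<^sub>v c) = 0\<^sub>v r"
proof -
  obtain U where U: "U \<in> carrier_mat q q" "mat_adjoint U * U = 1\<^sub>m q"
    "\<And>c. c \<in> carrier_vec q \<Longrightarrow> sqnorm (G \<omega> *\<^sub>v (U *\<^sub>v c)) = (\<Sum>i<q. (sv i)\<^sup>2 * (cmod (c $ i))\<^sup>2)"
    using svd[OF \<omega>] by blast
  note Ga = mat_adjoint_carrier[OF G_carrier[of \<omega>]]
  define R where "R = mat p q (\<lambda>(i, j). mat_adjoint U $$ (i, j))"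
  have R: "R \<in> carrier_mat p q" by (simp add: R_def)
  have ker: "G \<omega> *\<^sub>v f = 0\<^sub>v r" if f: "f \<in> carrier_vec q" and Rf: "R *\<^sub>v f = 0\<^sub>v p" for f
  proof -
    define c where "c = mat_adjoint U *\<^sub>v f"
    have c: "c \<in> carrier_vec q" using U(1) by (simp add: c_def)
    have fc: "f = U *\<^sub>v c"
      unfolding c_def using unitary_right_inverse[OF U(1,2)] f U(1)
      by (simp add: assoc_mult_mat_vec[symmetric, of U q q _ q])
    have "c $ i = 0" if "i < p" for i
    proof -
      have "row (mat_adjoint U) i = row R i"
        using that length_s U(1) by (intro eq_vecI) (auto simp: R_def)
      moreover have "(R *\<^sub>v f) $ i = 0" using Rf that by simp
      ultimately show ?thesis using that length_s U(1) R by (simp add: c_def)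
    qed
    hence "sqnorm (G \<omega> *\<^sub>v f) = 0"
      unfolding fc U(3)[OF c] by (intro sum.neutral) (auto simp: sv_def)
    thus ?thesis using sqnorm_eq_0[OF mult_mat_vec_carrier[OF G_carrier f]] by simp
  qed
  obtain F where F: "F \<in> carrier_mat q h" "mat_adjoint F * F = 1\<^sub>m h" "R * F = 0\<^sub>m p h"
    using orthonormal_kernel[OF R h(2)] by blast
  have RG: "R * mat_adjoint (G \<omega>) \<in> carrier_mat p r" by (rule mult_carrier_mat[OF R Ga])
  obtain E where E: "E \<in> carrier_mat r h" "mat_adjoint E * E = 1\<^sub>m h" "R * mat_adjoint (G \<omega>) * E = 0\<^sub>m p h"
    using orthonormal_kernel[OF RG h(1)] by blast
  have zero: "0\<^sub>m p h *\<^sub>v c = 0\<^sub>v p" if "c \<in> carrier_vec h" for c :: "complex vec"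
    using that by (intro eq_vecI) auto
  have "G \<omega> *\<^sub>v (F *\<^sub>v c) = 0\<^sub>v r" if c: "c \<in> carrier_vec h" for c
    using ker[OF mult_mat_vec_carrier[OF F(1) c]] assoc_mult_mat_vec[OF R F(1) c] zero[OF c] F(3) by simp
  moreover have "mat_adjoint (G \<omega>) *\<^sub>v (E *\<^sub>v c) = 0\<^sub>v q" if c: "c \<in> carrier_vec h" for c
  proof -
    define y where "y = mat_adjoint (G \<omega>) *\<^sub>v (E *\<^sub>v c)"
    have Ec: "E *\<^sub>v c \<in> carrier_vec r" using E(1) c by simp
    have y: "y \<in> carrier_vec q" unfolding y_def using mult_mat_vec_carrier[OF Ga Ec] .
    have "R *\<^sub>v y = 0\<^sub>v p"
      unfolding y_def using assoc_mult_mat_vec[OF R Ga Ec] assoc_mult_mat_vec[OF RG E(1) c] zero[OF c] E(3) by simp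
    hence "G \<omega> *\<^sub>v y = 0\<^sub>v r" by (rule ker[OF y])
    hence "y \<bullet>c y = 0"
      using cscalar_mult_mat_vec[OF Ga Ec y] Ec by (simp add: y_def)
    thus ?thesis using sqnorm_eq_0[OF y] unfolding sqnorm_cscalar y_def by simp
  qed
  ultimately show ?thesis using that E(1,2) F(1,2) by blast
qed

lemma block_sesquilinear:
  assumes "u \<in> carrier_vec r" "v \<in> carrier_vec q" "u' \<in> carrier_vec r" "v' \<in> carrier_vec q"
  shows "((A - z \<cdot>\<^sub>m 1\<^sub>m n) *\<^sub>v (u' @\<^sub>v v')) \<bullet>c (u @\<^sub>v v)
    = (\<alpha> - z) * (u' \<bullet>c u) + (C *\<^sub>v v') \<bullet>c u + ((D *\<^sub>v u') \<bullet>c v + (\<beta> - z) * (v' \<bullet>c v))"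
proof -
  have conj: "conjugate (u @\<^sub>v v) = conjugate u @\<^sub>v conjugate v"
    using assms by (intro eq_vecI) auto
  have "(A - z \<cdot>\<^sub>m 1\<^sub>m n) *\<^sub>v (u' @\<^sub>v v') = (((\<alpha> - z) \<cdot>\<^sub>m 1\<^sub>m r) *\<^sub>v u' + C *\<^sub>v v') @\<^sub>v (D *\<^sub>v u' + ((\<beta> - z) \<cdot>\<^sub>m 1\<^sub>m q) *\<^sub>v v')"
    unfolding shifted_block using C D assms by (intro four_block_mat_mult_vec) auto
  also have "\<dots> = ((\<alpha> - z) \<cdot>\<^sub>v u' + C *\<^sub>v v') @\<^sub>v (D *\<^sub>v u' + (\<beta> - z) \<cdot>\<^sub>v v')"
    using assms by (simp add: smult_mat_vec[of _ r r] smult_mat_vec[of _ q q])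
  also have "\<dots> \<bullet>c (u @\<^sub>v v) = ((\<alpha> - z) \<cdot>\<^sub>v u' + C *\<^sub>v v') \<bullet>c u + (D *\<^sub>v u' + (\<beta> - z) \<cdot>\<^sub>v v') \<bullet>c v"
    unfolding conj using assms C D by (subst scalar_prod_append[of _ r _ q]) auto
  also have "\<dots> = ((\<alpha> - z) \<cdot>\<^sub>v u') \<bullet>c u + (C *\<^sub>v v') \<bullet>c u + ((D *\<^sub>v u') \<bullet>c v + ((\<beta> - z) \<cdot>\<^sub>v v') \<bullet>c v)"
    using assms C D add_scalar_prod_distrib[of "(\<alpha> - z) \<cdot>\<^sub>v u'" r "C *\<^sub>v v'" "conjugate u"]
      add_scalar_prod_distrib[of "D *\<^sub>v u'" q "(\<beta> - z) \<cdot>\<^sub>v v'" "conjugate v"] by simp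
  finally show ?thesis using assms by simp
qed

text \<open>
  For \<open>z\<close> strictly between \<open>\<alpha>\<close> and \<open>\<beta>\<close> the pencil is singular at \<open>\<omega> = - conj a / a\<close>; on its kernel there
  the form of \<open>A - z\<close> is \<open>a\<close> times a Hermitian form, and the graph of \<open>Z = L - K\<close> with
  \<open>L\<^sup>* L = K\<^sup>* K + \<tau>\<close> is isotropic for it.
\<close>

lemma isotropic_kernel:
  fixes z \<omega> :: complex and \<tau> :: real
  assumes \<tau>: "0 \<le> \<tau>" "\<beta> - z = - (of_real \<tau> * (\<alpha> - z))" and z: "z \<noteq> \<alpha>" and h: "p + h \<le> r" "p + h \<le> q"
    and \<omega>: "\<omega> = - (cnj (\<alpha> - z) / (\<alpha> - z))"
  defines "B \<equiv> A - z \<cdot>\<^sub>m 1\<^sub>m n"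
  obtains N where "N \<in> carrier_mat n h" "B * (N * (\<omega> \<cdot>\<^sub>m 1\<^sub>m h)) = - (mat_adjoint B * N)"
    "mat_adjoint N * B * N = 0\<^sub>m h h"
    "\<And>c. c \<in> carrier_vec h \<Longrightarrow> N *\<^sub>v c = 0\<^sub>v n \<Longrightarrow> c = 0\<^sub>v h"
proof -
  define a where "a = \<alpha> - z"
  have a0: "a \<noteq> 0" using z by (simp add: a_def)
  have \<omega>1: "cmod \<omega> = 1" unfolding \<omega> a_def[symmetric] using a0 by (simp add: norm_divide)
  have B: "B \<in> carrier_mat n n" unfolding B_def shifted_block by auto
  note Ga = mat_adjoint_carrier[OF G_carrier[of \<omega>]]
  obtain E F where E: "E \<in> carrier_mat r h" "mat_adjoint E * E = 1\<^sub>m h"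
    and F: "F \<in> carrier_mat q h" "mat_adjoint F * F = 1\<^sub>m h"
    and kE: "\<And>c. c \<in> carrier_vec h \<Longrightarrow> mat_adjoint (G \<omega>) *\<^sub>v (E *\<^sub>v c) = 0\<^sub>v q"
    and kF: "\<And>c. c \<in> carrier_vec h \<Longrightarrow> G \<omega> *\<^sub>v (F *\<^sub>v c) = 0\<^sub>v r"
    using kernel_bases[OF \<omega>1 h] by metis
  \<comment> \<open>The compression of \<open>C\<close> to the two kernels, divided by
    \<open>a\<close> so that the whole form acquires the common factor \<open>a\<close>.\<close>
  define K where "K = (1 / a) \<cdot>\<^sub>m (mat_adjoint E * (C * F))"
  note CF = mult_carrier_mat[OF C F(1)]
  have ECF: "mat_adjoint E * (C * F) \<in> carrier_mat h h" by (rule mult_carrier_mat[OF mat_adjoint_carrier[OF E(1)] CF])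
  have K: "K \<in> carrier_mat h h" unfolding K_def using ECF by simp
  obtain L where L: "L \<in> carrier_mat h h" "\<And>c d. c \<in> carrier_vec h \<Longrightarrow> d \<in> carrier_vec h \<Longrightarrow>
    (L *\<^sub>v d) \<bullet>c (L *\<^sub>v c) = (K *\<^sub>v d) \<bullet>c (K *\<^sub>v c) + of_real \<tau> * (d \<bullet>c c)"
    using gram_shift_root[OF K \<tau>(1)] by blast
  define Z where "Z = L - K"
  have Z: "Z \<in> carrier_mat h h" unfolding Z_def using K by (rule minus_carrier_mat)
  define N where "N = (E * Z) @\<^sub>r F"
  note EZ = mult_carrier_mat[OF E(1) Z]
  have N: "N \<in> carrier_mat n h" unfolding N_def by (rule carrier_append_rows[OF EZ F(1)])
  have Nc: "N *\<^sub>v c = (E *\<^sub>v (Z *\<^sub>v c)) @\<^sub>v (F *\<^sub>v c)" if "c \<in> carrier_vec h" for c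
    unfolding N_def mat_mult_append[OF EZ F(1) that] assoc_mult_mat_vec[OF E(1) Z that] ..
  have CFc: "mat_adjoint E *\<^sub>v (C *\<^sub>v (F *\<^sub>v c)) = a \<cdot>\<^sub>v (K *\<^sub>v c)" if c: "c \<in> carrier_vec h" for c
  proof -
    have "mat_adjoint E *\<^sub>v (C *\<^sub>v (F *\<^sub>v c)) = (mat_adjoint E * (C * F)) *\<^sub>v c"
      using assoc_mult_mat_vec[OF mat_adjoint_carrier[OF E(1)] CF c] assoc_mult_mat_vec[OF C F(1) c] by simp
    moreover have "K *\<^sub>v c = (1 / a) \<cdot>\<^sub>v ((mat_adjoint E * (C * F)) *\<^sub>v c)"
      unfolding K_def by (rule smult_mat_vec[OF ECF c])
    ultimately show ?thesis using a0 by (simp add: smult_smult_assoc)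
  qed
  have DFc: "mat_adjoint D *\<^sub>v (F *\<^sub>v c) = - \<omega> \<cdot>\<^sub>v (C *\<^sub>v (F *\<^sub>v c))" if c: "c \<in> carrier_vec h" for c
  proof -
    have Fc: "F *\<^sub>v c \<in> carrier_vec q" using F(1) c by simp
    have "G \<omega> *\<^sub>v (F *\<^sub>v c) = \<omega> \<cdot>\<^sub>v (C *\<^sub>v (F *\<^sub>v c)) + mat_adjoint D *\<^sub>v (F *\<^sub>v c)"
      unfolding rotated_off_diagonal_def using C D Fc
      by (subst add_mult_distrib_mat_vec[of _ r q]) (auto simp: smult_mat_vec[of _ r q])
    hence e: "\<omega> \<cdot>\<^sub>v (C *\<^sub>v (F *\<^sub>v c)) + mat_adjoint D *\<^sub>v (F *\<^sub>v c) = 0\<^sub>v r" using kF[OF c] by simp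
    show ?thesis
    proof (rule eq_vecI)
      fix i assume "i < dim_vec (- \<omega> \<cdot>\<^sub>v (C *\<^sub>v (F *\<^sub>v c)))"
      hence i: "i < r" using C by simp
      have "(\<omega> \<cdot>\<^sub>v (C *\<^sub>v (F *\<^sub>v c)) + mat_adjoint D *\<^sub>v (F *\<^sub>v c)) $ i = 0" unfolding e using i by simp
      hence "\<omega> * (C *\<^sub>v (F *\<^sub>v c)) $ i + (mat_adjoint D *\<^sub>v (F *\<^sub>v c)) $ i = 0"
        using i C D by (simp del: index_mult_mat_vec)
      thus "(mat_adjoint D *\<^sub>v (F *\<^sub>v c)) $ i = (- \<omega> \<cdot>\<^sub>v (C *\<^sub>v (F *\<^sub>v c))) $ i"
        using i C D by (simp add: eq_neg_iff_add_eq_0 add.commute del: index_mult_mat_vec)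
    qed (use C D in auto)
  qed
  have form: "(B *\<^sub>v (N *\<^sub>v d)) \<bullet>c (N *\<^sub>v c) = 0" if c: "c \<in> carrier_vec h" and d: "d \<in> carrier_vec h" for c d
  proof -
    define zc where "zc = Z *\<^sub>v c"
    define zd where "zd = Z *\<^sub>v d"
    define kc where "kc = K *\<^sub>v c"
    define kd where "kd = K *\<^sub>v d"
    have cv: "zc \<in> carrier_vec h" "zd \<in> carrier_vec h" "kc \<in> carrier_vec h" "kd \<in> carrier_vec h"
      using Z K c d by (auto simp: zc_def zd_def kc_def kd_def)
    have Ev: "E *\<^sub>v zc \<in> carrier_vec r" "E *\<^sub>v zd \<in> carrier_vec r" "F *\<^sub>v c \<in> carrier_vec q" "F *\<^sub>v d \<in> carrier_vec q"
      using E(1) F(1) cv c d by auto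
    have CFv: "C *\<^sub>v (F *\<^sub>v d) \<in> carrier_vec r" "C *\<^sub>v (F *\<^sub>v c) \<in> carrier_vec r" using C Ev by auto
    have t1: "(E *\<^sub>v zd) \<bullet>c (E *\<^sub>v zc) = zd \<bullet>c zc" by (rule isometry_cscalar[OF E cv(2,1)])
    have t4: "(F *\<^sub>v d) \<bullet>c (F *\<^sub>v c) = d \<bullet>c c" by (rule isometry_cscalar[OF F d c])
    have t2: "(C *\<^sub>v (F *\<^sub>v d)) \<bullet>c (E *\<^sub>v zc) = a * (kd \<bullet>c zc)"
      using adjoint_cscalar[OF E(1) CFv(1) cv(1)] CFc[OF d] cv by (simp add: kd_def)
    \<comment> \<open>On the kernel of \<open>G(\<omega>)\<close> the adjoint of \<open>D\<close>
      acts as \<open>- \<omega> C\<close>, and \<open>\<omega>\<close> satisfies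
      \<open>- conj \<omega> conj a = a\<close>; so this term gets the same factor \<open>a\<close>
      as the \<open>C\<close> term.\<close>
    have t3: "(D *\<^sub>v (E *\<^sub>v zd)) \<bullet>c (F *\<^sub>v c) = a * (zd \<bullet>c kc)"
    proof -
      have "(D *\<^sub>v (E *\<^sub>v zd)) \<bullet>c (F *\<^sub>v c) = (E *\<^sub>v zd) \<bullet>c (- \<omega> \<cdot>\<^sub>v (C *\<^sub>v (F *\<^sub>v c)))"
        using cscalar_mult_mat_vec[OF D Ev(2,3)] DFc[OF c] by simp
      also have "\<dots> = - cnj \<omega> * ((E *\<^sub>v zd) \<bullet>c (C *\<^sub>v (F *\<^sub>v c)))"
        using Ev CFv by (simp add: conjugate_smult_vec)
      also have "(E *\<^sub>v zd) \<bullet>c (C *\<^sub>v (F *\<^sub>v c)) = zd \<bullet>c (a \<cdot>\<^sub>v kc)"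
        using cscalar_mult_mat_vec[OF E(1) cv(2) CFv(2)] CFc[OF c] by (simp add: kc_def)
      also have "\<dots> = cnj a * (zd \<bullet>c kc)" using cv by (simp add: conjugate_smult_vec)
      also have "- cnj \<omega> * (cnj a * (zd \<bullet>c kc)) = a * (zd \<bullet>c kc)"
        unfolding \<omega> a_def[symmetric] using a0 by simp
      finally show ?thesis .
    qed
    have "L *\<^sub>v x = Z *\<^sub>v x + K *\<^sub>v x" if "x \<in> carrier_vec h" for x
    proof -
      have "L = Z + K" unfolding Z_def using L(1) K by (intro eq_matI) auto
      thus ?thesis using add_mult_distrib_mat_vec[OF Z K that] by simp
    qed
    hence "(zd + kd) \<bullet>c (zc + kc) = kd \<bullet>c kc + of_real \<tau> * (d \<bullet>c c)"
      using L(2)[OF c d] c d by (simp add: zc_def zd_def kc_def kd_def)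
    moreover have "(zd + kd) \<bullet>c (zc + kc) = zd \<bullet>c zc + zd \<bullet>c kc + (kd \<bullet>c zc + kd \<bullet>c kc)"
      using cv by (simp add: conjugate_add_vec[of _ h] add_scalar_prod_distrib[of _ h] scalar_prod_add_distrib[of _ h])
    \<comment> \<open>Expanding the defining identity of \<open>L = Z + K\<close>, the
      \<open>K\<close> terms cancel; what remains is exactly isotropy of the graph of
      \<open>Z\<close>.\<close>
    ultimately have rel: "zd \<bullet>c zc + zd \<bullet>c kc + kd \<bullet>c zc - of_real \<tau> * (d \<bullet>c c) = 0" by (simp add: algebra_simps)
    have "(B *\<^sub>v (N *\<^sub>v d)) \<bullet>c (N *\<^sub>v c) = a * (zd \<bullet>c zc) + a * (kd \<bullet>c zc) + (a * (zd \<bullet>c kc) + (- (of_real \<tau> * a)) * (d \<bullet>c c))"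
      unfolding Nc[OF c] Nc[OF d] B_def zc_def[symmetric] zd_def[symmetric]
      block_sesquilinear[OF Ev(1,3,2,4)] t1 t2 t3 t4 \<tau>(2) a_def[symmetric] ..
    also have "\<dots> = a * (zd \<bullet>c zc + zd \<bullet>c kc + kd \<bullet>c zc - of_real \<tau> * (d \<bullet>c c))" by (simp add: algebra_simps)
    finally show ?thesis unfolding rel by simp
  qed
  have colN: "col N j = N *\<^sub>v unit_vec h j" if "j < h" for j
    using N that by (intro eq_vecI) auto
  have "mat_adjoint N * B * N = 0\<^sub>m h h"
  proof (rule eq_matI)
    fix i j assume "i < dim_row (0\<^sub>m h h :: complex mat)" "j < dim_col (0\<^sub>m h h :: complex mat)"
    hence ij: "i < h" "j < h" by auto
    show "(mat_adjoint N * B * N) $$ (i, j) = 0\<^sub>m h h $$ (i, j)"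
      unfolding adjoint_sandwich_index[OF B N N ij] colN[OF ij(1)] colN[OF ij(2)] using form ij by simp
  qed (use N in auto)
  moreover have "B * (N * (\<omega> \<cdot>\<^sub>m 1\<^sub>m h)) = - (mat_adjoint B * N)"
  proof -
    \<comment> \<open>At this \<open>\<omega>\<close> both diagonal blocks of the pencil vanish,
      \<open>\<beta> - z\<close> being a real multiple of \<open>\<alpha> - z\<close>. Vectors with
      \<open>u\<close> in the kernel of the adjoint of \<open>G(\<omega>)\<close> and
      \<open>v\<close> in that of \<open>G(\<omega>)\<close> are then annihilated.\<close>
    have x0: "\<omega> * (\<alpha> - z) + cnj (\<alpha> - z) = 0" unfolding \<omega> using z by simp
    have "\<omega> * (\<beta> - z) + cnj (\<beta> - z) = - of_real \<tau> * (\<omega> * (\<alpha> - z) + cnj (\<alpha> - z))"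
      unfolding \<tau>(2) by (simp add: algebra_simps)
    hence y0: "\<omega> * (\<beta> - z) + cnj (\<beta> - z) = 0" unfolding x0 by simp
    have blk: "\<omega> \<cdot>\<^sub>m B + mat_adjoint B = four_block_mat (0 \<cdot>\<^sub>m 1\<^sub>m r) (G \<omega>) (\<omega> \<cdot>\<^sub>m mat_adjoint (G \<omega>)) (0 \<cdot>\<^sub>m 1\<^sub>m q)"
      unfolding B_def pencil_block[OF \<omega>1] x0 y0 ..
    have W: "\<omega> \<cdot>\<^sub>m B + mat_adjoint B \<in> carrier_mat n n" using B by auto
    have zero: "(\<omega> \<cdot>\<^sub>m B + mat_adjoint B) *\<^sub>v (N *\<^sub>v c) = 0\<^sub>v n" if c: "c \<in> carrier_vec h" for c
    proof -
      define u where "u = E *\<^sub>v (Z *\<^sub>v c)"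
      define v where "v = F *\<^sub>v c"
      have uv: "u \<in> carrier_vec r" "v \<in> carrier_vec q" using E(1) Z F(1) c by (auto simp: u_def v_def)
      have Zc: "Z *\<^sub>v c \<in> carrier_vec h" using Z c by simp
      have "(\<omega> \<cdot>\<^sub>m B + mat_adjoint B) *\<^sub>v (u @\<^sub>v v)
        = ((0 \<cdot>\<^sub>m 1\<^sub>m r) *\<^sub>v u + G \<omega> *\<^sub>v v) @\<^sub>v ((\<omega> \<cdot>\<^sub>m mat_adjoint (G \<omega>)) *\<^sub>v u + (0 \<cdot>\<^sub>m 1\<^sub>m q) *\<^sub>v v)"
        unfolding blk using uv Ga by (intro four_block_mat_mult_vec) auto
      also have "G \<omega> *\<^sub>v v = 0\<^sub>v r" unfolding v_def by (rule kF[OF c])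
      also have "(\<omega> \<cdot>\<^sub>m mat_adjoint (G \<omega>)) *\<^sub>v u = 0\<^sub>v q"
        unfolding smult_mat_vec[OF Ga uv(1)] unfolding u_def kE[OF Zc] by (intro eq_vecI) auto
      also have "((0 \<cdot>\<^sub>m 1\<^sub>m r) *\<^sub>v u + 0\<^sub>v r) @\<^sub>v (0\<^sub>v q + (0 \<cdot>\<^sub>m 1\<^sub>m q) *\<^sub>v v) = 0\<^sub>v n"
        using uv by (intro eq_vecI) (auto simp: smult_mat_vec[of _ r r] smult_mat_vec[of _ q q])
      finally show ?thesis unfolding Nc[OF c] u_def v_def .
    qed
    have "(\<omega> \<cdot>\<^sub>m B + mat_adjoint B) * N = 0\<^sub>m n h"
    proof (rule mat_col_eqI)
      fix j assume "j < dim_col (0\<^sub>m n h :: complex mat)"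
      hence j: "j < h" by simp
      show "col ((\<omega> \<cdot>\<^sub>m B + mat_adjoint B) * N) j = col (0\<^sub>m n h) j"
        unfolding col_mult2[OF W N j] colN[OF j] using zero[of "unit_vec h j"] j by simp
    qed (use W N in auto)
    moreover have "(\<omega> \<cdot>\<^sub>m B + mat_adjoint B) * N = \<omega> \<cdot>\<^sub>m (B * N) + mat_adjoint B * N"
      using B N by (subst add_mult_distrib_mat[of _ n n]) (auto simp: mult_smult_assoc_mat[of _ n n])
    moreover have "B * (N * (\<omega> \<cdot>\<^sub>m 1\<^sub>m h)) = \<omega> \<cdot>\<^sub>m (B * N)"
      using mult_smult_distrib[OF N one_carrier_mat, of \<omega>] N mult_smult_distrib[OF B N, of \<omega>] by simp
    ultimately have sum0: "B * (N * (\<omega> \<cdot>\<^sub>m 1\<^sub>m h)) + mat_adjoint B * N = 0\<^sub>m n h" by simp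
    note c1 = mult_carrier_mat[OF B mult_carrier_mat[OF N, of "\<omega> \<cdot>\<^sub>m 1\<^sub>m h" h]]
    note c2 = mult_carrier_mat[OF mat_adjoint_carrier[OF B] N]
    have "X = - Y" if "X + Y = 0\<^sub>m n h" "X \<in> carrier_mat n h" "Y \<in> carrier_mat n h" for X Y :: "complex mat"
    proof (rule eq_matI)
      fix i j assume "i < dim_row (- Y)" "j < dim_col (- Y)"
      hence ij: "i < n" "j < h" using that by auto
      have "(X + Y) $$ (i, j) = X $$ (i, j) + Y $$ (i, j)"
        using ij that(2,3) by (intro index_add_mat(1)) auto
      moreover have "(X + Y) $$ (i, j) = 0" unfolding that(1) using ij by simp
      ultimately have "X $$ (i, j) + Y $$ (i, j) = 0" by simp
      thus "X $$ (i, j) = (- Y) $$ (i, j)" using ij that by (simp add: eq_neg_iff_add_eq_0)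
    qed (use that in auto)
    from this[OF sum0 c1 c2] show ?thesis by simp
  qed
  moreover have "c = 0\<^sub>v h" if c: "c \<in> carrier_vec h" and N0: "N *\<^sub>v c = 0\<^sub>v n" for c
  proof -
    have "(E *\<^sub>v (Z *\<^sub>v c)) @\<^sub>v (F *\<^sub>v c) = 0\<^sub>v r @\<^sub>v 0\<^sub>v q"
      using N0 unfolding Nc[OF c] by (auto intro!: eq_vecI)
    moreover have "E *\<^sub>v (Z *\<^sub>v c) \<in> carrier_vec r"
      by (rule mult_mat_vec_carrier[OF E(1) mult_mat_vec_carrier[OF Z c]])
    ultimately have "F *\<^sub>v c = 0\<^sub>v q" using append_vec_eq[of _ r "0\<^sub>v r"] by simp
    hence "sqnorm c = 0" using sqnorm_isometry[OF F c] by (simp add: sqnorm_def)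
    thus ?thesis using sqnorm_eq_0[OF c] by simp
  qed
  ultimately show ?thesis using that N by blast
qed

text \<open>The \<open>p\<close> stable directions \<open>X\<close> are supplemented by
  \<open>h = k - p\<close> isotropic directions \<open>N\<close> for the eigenvalue
  \<open>\<omega>\<close>. Mixed forms vanish since \<open>|u_ii| |\<omega>| < 1\<close>, and the
  directions are independent because \<open>\<omega>\<close> is no eigenvalue of
  \<open>U\<close>.\<close>

lemma segment_in_range:
  assumes z: "z \<noteq> \<alpha>" "z \<noteq> \<beta>" and form: "ellipse_form \<alpha> \<beta> z \<le> 0" and k: "p \<le> k" "k \<le> r" "k \<le> q"
  shows "z \<in> rank_numerical_range k A"
proof -
  define a where "a = \<alpha> - z"
  define b where "b = \<beta> - z"
  define B where "B = A - z \<cdot>\<^sub>m 1\<^sub>m n"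
  define h where "h = k - p"
  define \<tau> where "\<tau> = cmod b / cmod a"
  define \<omega> where "\<omega> = - (cnj a / a)"
  have kph: "k = p + h" using k by (simp add: h_def)
  have ab: "a \<noteq> 0" "b \<noteq> 0" using z by (auto simp: a_def b_def)
  have \<omega>1: "cmod \<omega> = 1" using ab by (simp add: \<omega>_def norm_divide)
  have B: "B \<in> carrier_mat n n" unfolding B_def shifted_block by auto
  \<comment> \<open>The form is never negative, so it is zero here:
    \<open>Re (a conj b) = - |a b|\<close>, which makes \<open>a conj b\<close> real and
    non-positive.\<close>
  have b_eq: "b = - (of_real \<tau> * a)"
  proof -
    define x where "x = a * cnj b"
    have cx: "cmod x = cmod (a * b)" by (simp add: x_def norm_mult)
    have Re: "Re x = - cmod x"
      using form ellipse_form_nonneg[of \<alpha> \<beta> z] unfolding cx unfolding ellipse_form_def a_def[symmetric] b_def[symmetric] x_def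
      by linarith
    hence "(Im x)\<^sup>2 = 0" using cmod_power2[of x] by simp
    hence xr: "x = of_real (- cmod x)" using Re by (simp add: complex_eq_iff)
    define m where "m = complex_of_real (cmod a * cmod a)"
    have m0: "m \<noteq> 0" using ab by (simp add: m_def)
    have "a * cnj a = m" by (simp add: m_def complex_norm_square[symmetric] power2_eq_square[symmetric])
    hence "b * m = a * cnj x" by (simp add: x_def mult_ac)
    also have "cnj x = of_real (- (cmod a * cmod b))"
      by (subst xr) (simp add: cx norm_mult)
    also have "cmod a * cmod b = \<tau> * (cmod a * cmod a)" using ab by (simp add: \<tau>_def)
    also have "a * of_real (- (\<tau> * (cmod a * cmod a))) = (- (of_real \<tau> * a)) * m"
      by (simp add: m_def)
    finally show ?thesis by (rule mult_right_cancel[OF m0, THEN iffD1])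
  qed
  have \<tau>0: "0 \<le> \<tau>" by (simp add: \<tau>_def)
  obtain N where N: "N \<in> carrier_mat n h" and Neq: "B * (N * (\<omega> \<cdot>\<^sub>m 1\<^sub>m h)) = - (mat_adjoint B * N)"
    and NBN: "mat_adjoint N * B * N = 0\<^sub>m h h"
    and injN: "\<And>c. c \<in> carrier_vec h \<Longrightarrow> N *\<^sub>v c = 0\<^sub>v n \<Longrightarrow> c = 0\<^sub>v h"
    using isotropic_kernel[OF \<tau>0 b_eq[unfolded a_def b_def] z(1) k(2,3)[unfolded kph] \<omega>_def[unfolded a_def], folded B_def] by metis
  have "ellipse_form \<alpha> \<beta> z < (sv i)\<^sup>2" if "i < p" for i
    using form s_pos[of "s ! i"] that by (simp add: sv_def) (smt (verit) nth_mem zero_less_power)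
  then obtain X U where X: "X \<in> carrier_mat n p" and U: "U \<in> carrier_mat p p" "upper_triangular U"
    "\<And>i. i < p \<Longrightarrow> cmod (U $$ (i, i)) < 1" and Xeq: "B * (X * U) = - (mat_adjoint B * X)"
    and injX: "\<And>c. c \<in> carrier_vec p \<Longrightarrow> X *\<^sub>v c = 0\<^sub>v n \<Longrightarrow> c = 0\<^sub>v p" and detB: "det B \<noteq> 0"
    using deflating_subspace[OF z le_refl, folded B_def] by metis
  \<comment> \<open>A scalar matrix is triangular, so the Stein lemma also covers the blocks mixing
    \<open>X\<close> and \<open>N\<close>.\<close>
  have V: "\<omega> \<cdot>\<^sub>m 1\<^sub>m h \<in> carrier_mat h h" "upper_triangular (\<omega> \<cdot>\<^sub>m 1\<^sub>m h)"
    by (auto simp: upper_triangular_def)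
  have small: "cnj x * y \<noteq> 1" if "cmod x * cmod y < 1" for x y
  proof
    assume "cnj x * y = 1"
    hence "cmod (cnj x * y) = 1" by simp
    thus False using that by (simp add: norm_mult)
  qed
  have XBX: "mat_adjoint X * B * X = 0\<^sub>m p p"
  proof (rule triangular_Stein_zero[OF _ U(1,2) U(1,2)])
    show "mat_adjoint U * (mat_adjoint X * B * X) * U = mat_adjoint X * B * X"
      by (rule deflating_form_invariant[OF B X X U(1) U(1) Xeq Xeq])
    fix i j assume ij: "i < p" "j < p"
    have "cmod (U $$ (i, i)) * cmod (U $$ (j, j)) < 1 * 1" using U(3) ij by (intro mult_strict_mono') auto
    thus "cnj (U $$ (i, i)) * U $$ (j, j) \<noteq> 1" using small by simp
  qed (use X B in auto)
  have XBN: "mat_adjoint X * B * N = 0\<^sub>m p h"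
  proof (rule triangular_Stein_zero[OF _ U(1,2) V])
    show "mat_adjoint U * (mat_adjoint X * B * N) * (\<omega> \<cdot>\<^sub>m 1\<^sub>m h) = mat_adjoint X * B * N"
      by (rule deflating_form_invariant[OF B X N U(1) V(1) Xeq Neq])
    fix i j assume "i < p" "j < h"
    thus "cnj (U $$ (i, i)) * (\<omega> \<cdot>\<^sub>m 1\<^sub>m h) $$ (j, j) \<noteq> 1" using U(3) \<omega>1 by (intro small) simp
  qed (use X N B in auto)
  have NBX: "mat_adjoint N * B * X = 0\<^sub>m h p"
  proof (rule triangular_Stein_zero[OF _ V U(1,2)])
    show "mat_adjoint (\<omega> \<cdot>\<^sub>m 1\<^sub>m h) * (mat_adjoint N * B * X) * U = mat_adjoint N * B * X"
      by (rule deflating_form_invariant[OF B N X V(1) U(1) Neq Xeq])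
    fix i j assume "i < h" "j < p"
    thus "cnj ((\<omega> \<cdot>\<^sub>m 1\<^sub>m h) $$ (i, i)) * U $$ (j, j) \<noteq> 1" using U(3) \<omega>1 by (intro small) simp
  qed (use X N B in auto)
  define Y where "Y = mat n k (\<lambda>(i, j). if j < p then X $$ (i, j) else N $$ (i, j - p))"
  have Y: "Y \<in> carrier_mat n k" by (simp add: Y_def)
  have colY: "col Y j = (if j < p then col X j else col N (j - p))" if "j < k" for j
    using that X N kph by (auto simp: Y_def intro!: eq_vecI)
  have iso: "mat_adjoint Y * B * Y = 0\<^sub>m k k"
  proof (rule eq_matI)
    fix i j assume "i < dim_row (0\<^sub>m k k :: complex mat)" "j < dim_col (0\<^sub>m k k :: complex mat)"
    hence ij: "i < k" "j < k" by auto
    have h: "i - p < h" if "\<not> i < p" "i < k" for i using that kph by auto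
    show "(mat_adjoint Y * B * Y) $$ (i, j) = 0\<^sub>m k k $$ (i, j)"
      unfolding adjoint_sandwich_index[OF B Y Y ij] colY[OF ij(1)] colY[OF ij(2)]
      using ij h adjoint_sandwich_index[OF B X X, of i j] adjoint_sandwich_index[OF B X N, of i "j - p"]
        adjoint_sandwich_index[OF B N X, of "i - p" j] adjoint_sandwich_index[OF B N N, of "i - p" "j - p"]
      unfolding XBX XBN NBX NBN by auto
  qed (use Y in auto)
  have "c = 0\<^sub>v k" if c: "c \<in> carrier_vec k" and Y0: "Y *\<^sub>v c = 0\<^sub>v n" for c
  proof -
    define c1 where "c1 = vec_first c p"
    define c2 where "c2 = vec_last c h"
    have cc: "c1 \<in> carrier_vec p" "c2 \<in> carrier_vec h" by (auto simp: c1_def c2_def)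
    have capp: "c = c1 @\<^sub>v c2" using c unfolding kph c1_def c2_def by simp
    note Xc = mult_mat_vec_carrier[OF X cc(1)] and Ncar = mult_mat_vec_carrier[OF N cc(2)]
    have sum0: "X *\<^sub>v c1 + N *\<^sub>v c2 = 0\<^sub>v n"
    proof (rule eq_vecI)
      fix i assume "i < dim_vec (0\<^sub>v n :: complex vec)"
      hence i: "i < n" by simp
      have "row Y i = row X i @\<^sub>v row N i"
        using i X N kph by (intro eq_vecI) (auto simp: Y_def)
      hence "row Y i \<bullet> c = row X i \<bullet> c1 + row N i \<bullet> c2"
        unfolding capp using cc i X N by (simp add: scalar_prod_append[of _ p _ h])
      moreover have "(Y *\<^sub>v c) $ i = 0" unfolding Y0 using i by simp
      ultimately show "(X *\<^sub>v c1 + N *\<^sub>v c2) $ i = 0\<^sub>v n $ i" using i X N Y by simp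
    qed (use X N in auto)
    have NX: "N *\<^sub>v c2 = - (X *\<^sub>v c1)"
    proof (rule eq_vecI)
      fix i assume "i < dim_vec (- (X *\<^sub>v c1))"
      hence i: "i < n" using X by simp
      have "(X *\<^sub>v c1 + N *\<^sub>v c2) $ i = 0" unfolding sum0 using i by simp
      moreover have "(X *\<^sub>v c1 + N *\<^sub>v c2) $ i = (X *\<^sub>v c1) $ i + (N *\<^sub>v c2) $ i"
        using i N by (intro index_add_vec(1)) auto
      ultimately have "(N *\<^sub>v c2) $ i + (X *\<^sub>v c1) $ i = 0" by (simp only: add.commute)
      thus "(N *\<^sub>v c2) $ i = (- (X *\<^sub>v c1)) $ i" using i X by (simp add: eq_neg_iff_add_eq_0 del: index_mult_mat_vec)
    qed (use X N in auto)
    \<comment> \<open>If \<open>X c1 = - N c2\<close>, the two deflating equations together give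
      \<open>B X (U - \<omega>) c1 = 0\<close>. As \<open>B\<close> is invertible and
      \<open>X\<close> injective, \<open>c1\<close> is zero or an eigenvector of \<open>U\<close>
      for \<open>\<omega>\<close>, which has modulus 1.\<close>
    define w where "w = U *\<^sub>v c1 - \<omega> \<cdot>\<^sub>v c1"
    have Uc: "U *\<^sub>v c1 \<in> carrier_vec p" using U(1) cc by simp
    have w: "w \<in> carrier_vec p" using Uc cc by (simp add: w_def)
    note Ba = mat_adjoint_carrier[OF B]
    have e1: "mat_adjoint B *\<^sub>v (X *\<^sub>v c1) = - (B *\<^sub>v (X *\<^sub>v (U *\<^sub>v c1)))"
    proof -
      have "(B * (X * U)) *\<^sub>v c1 = - (mat_adjoint B * X) *\<^sub>v c1" unfolding Xeq ..
      also have "\<dots> = - (mat_adjoint B *\<^sub>v (X *\<^sub>v c1))"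
        using assoc_mult_mat_vec[OF Ba X cc(1)] cc(1) X by (subst uminus_mult_mat_vec) auto
      finally show ?thesis
        using assoc_mult_mat_vec[OF B mult_carrier_mat[OF X U(1)] cc(1)] assoc_mult_mat_vec[OF X U(1) cc(1)] by simp
    qed
    have e2: "mat_adjoint B *\<^sub>v (N *\<^sub>v c2) = - (B *\<^sub>v (\<omega> \<cdot>\<^sub>v (N *\<^sub>v c2)))"
    proof -
      have "(B * (N * (\<omega> \<cdot>\<^sub>m 1\<^sub>m h))) *\<^sub>v c2 = - (mat_adjoint B * N) *\<^sub>v c2" unfolding Neq ..
      also have "\<dots> = - (mat_adjoint B *\<^sub>v (N *\<^sub>v c2))"
        using assoc_mult_mat_vec[OF Ba N cc(2)] cc(2) N by (subst uminus_mult_mat_vec) auto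
      finally have "mat_adjoint B *\<^sub>v (N *\<^sub>v c2) = - (B *\<^sub>v (N *\<^sub>v ((\<omega> \<cdot>\<^sub>m 1\<^sub>m h) *\<^sub>v c2)))"
        using assoc_mult_mat_vec[OF B mult_carrier_mat[OF N V(1)] cc(2)] assoc_mult_mat_vec[OF N V(1) cc(2)] by simp
      also have "(\<omega> \<cdot>\<^sub>m 1\<^sub>m h) *\<^sub>v c2 = \<omega> \<cdot>\<^sub>v c2" using cc(2) by (simp add: smult_mat_vec[of _ h h])
      also have "N *\<^sub>v (\<omega> \<cdot>\<^sub>v c2) = \<omega> \<cdot>\<^sub>v (N *\<^sub>v c2)" using mult_mat_vec[OF N cc(2)] .
      finally show ?thesis .
    qed
    have "B *\<^sub>v (X *\<^sub>v w) = 0\<^sub>v n"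
    proof -
      have Xw: "X *\<^sub>v w = X *\<^sub>v (U *\<^sub>v c1) - \<omega> \<cdot>\<^sub>v (X *\<^sub>v c1)"
        unfolding w_def using mult_minus_distrib_mat_vec[OF X Uc, of "\<omega> \<cdot>\<^sub>v c1"] mult_mat_vec[OF X cc(1)] cc(1) by simp
      have XU: "X *\<^sub>v (U *\<^sub>v c1) \<in> carrier_vec n" using mult_mat_vec_carrier[OF X Uc] .
      have "\<omega> \<cdot>\<^sub>v (N *\<^sub>v c2) = - (\<omega> \<cdot>\<^sub>v (X *\<^sub>v c1))" unfolding NX by (intro eq_vecI) auto
      hence "B *\<^sub>v (\<omega> \<cdot>\<^sub>v (N *\<^sub>v c2)) = - (B *\<^sub>v (\<omega> \<cdot>\<^sub>v (X *\<^sub>v c1)))"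
        using mult_mat_uminus_vec[OF B, of "\<omega> \<cdot>\<^sub>v (X *\<^sub>v c1)"] Xc by simp
      moreover have "mat_adjoint B *\<^sub>v (N *\<^sub>v c2) = - (mat_adjoint B *\<^sub>v (X *\<^sub>v c1))"
        unfolding NX by (rule mult_mat_uminus_vec[OF Ba Xc])
      ultimately have "B *\<^sub>v (X *\<^sub>v (U *\<^sub>v c1)) = B *\<^sub>v (\<omega> \<cdot>\<^sub>v (X *\<^sub>v c1))"
        using e1 e2 by (metis uminus_uminus_vec)
      thus ?thesis unfolding Xw
        using mult_minus_distrib_mat_vec[OF B XU, of "\<omega> \<cdot>\<^sub>v (X *\<^sub>v c1)"] Xc B by simp
    qed
    hence "X *\<^sub>v w = 0\<^sub>v n"
      using det_0_iff_vec_prod_zero_field[OF B] detB mult_mat_vec_carrier[OF X w] by blast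
    hence "w = 0\<^sub>v p" by (rule injX[OF w])
    have c10: "c1 = 0\<^sub>v p"
    proof (rule ccontr)
      assume ne: "c1 \<noteq> 0\<^sub>v p"
      have "U *\<^sub>v c1 = \<omega> \<cdot>\<^sub>v c1"
      proof (rule eq_vecI)
        fix i assume "i < dim_vec (\<omega> \<cdot>\<^sub>v c1)"
        hence i: "i < p" using cc by simp
        have "w $ i = 0" unfolding \<open>w = 0\<^sub>v p\<close> using i by simp
        thus "(U *\<^sub>v c1) $ i = (\<omega> \<cdot>\<^sub>v c1) $ i" unfolding w_def using i cc by (simp del: index_mult_mat_vec)
      qed (use U(1) cc in auto)
      hence "eigenvalue U \<omega>" unfolding eigenvalue_def eigenvector_def using ne cc U(1) by auto
      hence "poly (\<Prod>e\<leftarrow>diag_mat U. [:- e, 1:]) \<omega> = 0"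
        unfolding eigenvalue_root_char_poly[OF U(1)] char_poly_upper_triangular[OF U(1,2)] .
      hence "\<omega> \<in> set (diag_mat U)" by (auto simp: poly_prod_list prod_list_zero_iff)
      then obtain i where "i < p" "\<omega> = U $$ (i, i)" using U(1) by (auto simp: diag_mat_def)
      thus False using U(3)[of i] \<omega>1 by simp
    qed
    have "N *\<^sub>v c2 = 0\<^sub>v n" unfolding NX c10 mult_mat_zero_vec[OF X] by (intro eq_vecI) auto
    hence "c2 = 0\<^sub>v h" by (rule injN[OF cc(2)])
    thus "c = 0\<^sub>v k" unfolding capp kph c10 by (auto intro!: eq_vecI)
  qed
  from rank_numerical_rangeI[OF A_carrier Y this] iso show ?thesis unfolding B_def by blast
qed

end

section \<open>The exact ranges in each regime of \<open>k\<close>\<close>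

context scalar_block_matrix
begin

text \<open>A point of the closed disc is a limit of points pulled towards the centre. There the
  inequality is strict for \<open>s_k\<close>, hence for every earlier \<open>s_i\<close>, as the
  list is non-increasing.\<close>

lemma rank_range_ellipse:
  assumes k: "1 \<le> k" "k \<le> p"
  shows "rank_numerical_range k A = elliptical_disc \<alpha> \<beta> (s ! (k - 1))"
proof -
  have sk: "sv (k - 1) = s ! (k - 1)" and pos: "0 < sv (k - 1)"
    using k s_pos[of "s ! (k - 1)"] by (auto simp: sv_def)
  have disc: "elliptical_disc \<alpha> \<beta> (s ! (k - 1)) = {z. ellipse_form \<alpha> \<beta> z \<le> (sv (k - 1))\<^sup>2}"
    using elliptical_disc_eq[of "s ! (k - 1)"] pos sk by simp
  have "z \<in> rank_numerical_range k A" if z: "ellipse_form \<alpha> \<beta> z \<le> (sv (k - 1))\<^sup>2" for z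
  proof -
    define c where "c = (\<alpha> + \<beta>) / 2"
    define t where "t m = real m / real (Suc m)" for m
    define w where "w m = c + of_real (t m) * (z - c)" for m
    have "w m \<in> rank_numerical_range k A" for m
    proof -
      have t: "0 \<le> t m" "t m < 1" by (auto simp: t_def)
      have "ellipse_form \<alpha> \<beta> (w m) \<le> (t m)\<^sup>2 * ellipse_form \<alpha> \<beta> z"
        unfolding w_def c_def using t by (intro ellipse_form_contract) auto
      also have "\<dots> \<le> (t m)\<^sup>2 * (sv (k - 1))\<^sup>2" using z by (intro mult_left_mono) auto
      also have "\<dots> < 1 * (sv (k - 1))\<^sup>2"
      proof (rule mult_strict_right_mono)
        show "(t m)\<^sup>2 < 1" using t by (simp add: power_less_one_iff)
        show "0 < (sv (k - 1))\<^sup>2" using pos by simp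
      qed
      finally have "ellipse_form \<alpha> \<beta> (w m) < (sv (k - 1))\<^sup>2" by simp
      moreover have "(sv (k - 1))\<^sup>2 \<le> (sv i)\<^sup>2" if "i < k" for i
        using sv_mono[of i "k - 1"] sv_nonneg[of "k - 1"] that by (intro power_mono) auto
      ultimately have "ellipse_form \<alpha> \<beta> (w m) < (sv i)\<^sup>2" if "i < k" for i
        using that less_le_trans by blast
      \<comment> \<open>A contracted point may hit a focus; it is then covered by a diagonal block,
        since \<open>k \<le> p\<close> and \<open>p\<close> is at most \<open>r\<close> and
        \<open>q\<close>.\<close>
      thus ?thesis
        using ellipse_interior_in_range[of "w m" k] alpha_in_range[of k] beta_in_range[of k] k length_s length_s_le_r
        by (cases "w m = \<alpha>"; cases "w m = \<beta>") auto
    qed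
    moreover have "w \<longlonglongrightarrow> z"
    proof -
      have "(\<lambda>m. c + of_real (t m) * (z - c)) \<longlonglongrightarrow> c + of_real 1 * (z - c)"
        unfolding t_def by (intro tendsto_intros LIMSEQ_n_over_Suc_n)
      moreover have "w = (\<lambda>m. c + of_real (t m) * (z - c))" by (simp add: w_def fun_eq_iff)
      ultimately show ?thesis by simp
    qed
    ultimately show ?thesis by (rule rank_numerical_range_limit[OF A_carrier])
  qed
  moreover have "k \<le> q" using k length_s by linarith
  ultimately show ?thesis unfolding disc using range_ellipse[OF k(1)] by blast
qed

lemma rank_range_segment:
  assumes k: "p < k" "k \<le> r" "k \<le> q"
  shows "rank_numerical_range k A = closed_segment \<alpha> \<beta>"
proof -
  have "sv (k - 1) = 0" using k by (auto simp: sv_def)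
  hence "ellipse_form \<alpha> \<beta> z \<le> 0" if "z \<in> rank_numerical_range k A" for z
    using range_ellipse[of k z] that k by simp
  moreover have "z \<in> rank_numerical_range k A" if "ellipse_form \<alpha> \<beta> z \<le> 0" for z
    using segment_in_range[OF _ _ that, of k] alpha_in_range[of k] beta_in_range[of k] k
    by (cases "z = \<alpha>"; cases "z = \<beta>") auto
  ultimately show ?thesis unfolding closed_segment_ellipse by blast
qed

lemma rank_range_alpha: "q < k \<Longrightarrow> k \<le> r \<Longrightarrow> rank_numerical_range k A = {\<alpha>}"
  using range_large_alpha[of k] alpha_in_range[of k] by blast

lemma rank_range_beta: "r < k \<Longrightarrow> k \<le> q \<Longrightarrow> rank_numerical_range k A = {\<beta>}"
  using range_large_beta[of k] beta_in_range[of k] by blast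

text \<open>An element would have to equal both \<open>\<alpha>\<close> and \<open>\<beta>\<close>;
  when these coincide, the count \<open>n - p < k\<close> takes over.\<close>

lemma rank_range_empty:
  assumes "r < k" "q < k" "\<alpha> \<noteq> \<beta> \<or> n - p < k"
  shows "rank_numerical_range k A = {}"
  using range_large_alpha[OF assms(2)] range_large_beta[OF assms(1)] range_empty[of k] assms(3) by blast

text \<open>For \<open>p = 0\<close> there is no \<open>s ! 0\<close>; the norm is then the padded
  value 0 and the disc degenerates to the segment.\<close>

lemma numerical_range_ellipse:
  assumes "0 < r" "0 < q"
  shows "numerical_range A = elliptical_disc \<alpha> \<beta> (spectral_norm (G 1))"
proof (cases "p = 0")
  case False
  hence "1 \<le> p" "sv 0 = s ! 0" by (auto simp: sv_def Suc_le_eq)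
  thus ?thesis unfolding numerical_range_def spectral_norm_G[OF assms(2)]
    using rank_range_ellipse[OF le_refl] by simp
next
  case True
  hence "rank_numerical_range 1 A = closed_segment \<alpha> \<beta>"
    using assms by (intro rank_range_segment) auto
  moreover have sv0: "sv 0 = 0" unfolding sv_def using True by simp
  ultimately show ?thesis unfolding numerical_range_def spectral_norm_G[OF assms(2)]
    using elliptical_disc_eq[of 0 \<alpha> \<beta>] closed_segment_ellipse[of \<alpha> \<beta>] sv0 by simp
qed

end

section \<open>From the spectrum of \<open>M(\<theta>)\<close> to constant singular values\<close>

lemma M_matrix_eq:
  assumes C: "C \<in> carrier_mat r q" and D: "D \<in> carrier_mat q r"
  shows "M_matrix C D \<theta> = mat_adjoint (rotated_off_diagonal C D (cis (- 2 * \<theta>))) * rotated_off_diagonal C D (cis (- 2 * \<theta>))"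
proof -
  define \<omega> where "\<omega> = cis (- 2 * \<theta>)"
  have e: "exp (- 2 * \<i> * complex_of_real \<theta>) = \<omega>"
    by (simp add: \<omega>_def cis_conv_exp mult_ac)
  have ww: "\<omega> * (cnj \<omega> * x) = x" for x
    by (simp add: \<omega>_def mult.assoc[symmetric] cis_cnj cis_mult)
  have DC: "D * C \<in> carrier_mat q q" using D C by simp
  show ?thesis unfolding \<omega>_def[symmetric]
  proof (rule eq_matI)
    fix i j assume "i < dim_row (mat_adjoint (rotated_off_diagonal C D \<omega>) * rotated_off_diagonal C D \<omega>)"
      "j < dim_col (mat_adjoint (rotated_off_diagonal C D \<omega>) * rotated_off_diagonal C D \<omega>)"
    hence ij: "i < q" "j < q" using C D by (auto simp: rotated_off_diagonal_def)
    have "(mat_adjoint (rotated_off_diagonal C D \<omega>) * rotated_off_diagonal C D \<omega>) $$ (i, j)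
      = (\<Sum>l<r. cnj (\<omega> * C $$ (l, i) + cnj (D $$ (i, l))) * (\<omega> * C $$ (l, j) + cnj (D $$ (j, l))))"
      using ij C D by (simp add: scalar_prod_def rotated_off_diagonal_def lessThan_atLeast0)
    also have "\<dots> = (\<Sum>l<r. cnj (C $$ (l, i)) * C $$ (l, j)) + (\<Sum>l<r. D $$ (i, l) * cnj (D $$ (j, l)))
      + (\<omega> * (\<Sum>l<r. D $$ (i, l) * C $$ (l, j)) + cnj \<omega> * (\<Sum>l<r. cnj (D $$ (j, l)) * cnj (C $$ (l, i))))"
    proof -
      \<comment> \<open>Unimodularity removes \<open>\<omega> conj \<omega>\<close> from the first
        product; the cross terms are \<open>\<omega> D C\<close> and its adjoint, that is, twice a
        Hermitian part.\<close>
      have "cnj (\<omega> * x + cnj d) * (\<omega> * y + cnj d') = cnj x * y + d * cnj d' + (\<omega> * (d * y) + cnj \<omega> * (cnj d' * cnj x))" for x y d d'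
      proof -
        have "cnj (\<omega> * x + cnj d) * (\<omega> * y + cnj d') = \<omega> * (cnj \<omega> * (cnj x * y)) + d * cnj d' + (\<omega> * (d * y) + cnj \<omega> * (cnj d' * cnj x))"
          by (simp add: algebra_simps)
        thus ?thesis unfolding ww .
      qed
      thus ?thesis by (simp only: sum.distrib sum_distrib_left)
    qed
    also have "\<dots> = M_matrix C D \<theta> $$ (i, j)"
      unfolding M_matrix_def hermitian_part_def e using ij C D
      by (simp add: scalar_prod_def lessThan_atLeast0 distrib_left)
    finally show "M_matrix C D \<theta> $$ (i, j)
      = (mat_adjoint (rotated_off_diagonal C D \<omega>) * rotated_off_diagonal C D \<omega>) $$ (i, j)" ..
  qed (use C D in \<open>auto simp: M_matrix_def hermitian_part_def rotated_off_diagonal_def\<close>)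
qed

text \<open>Exchanging \<open>C\<close> and \<open>D\<close> turns \<open>G(\<omega>)\<close> into
  \<open>\<omega>\<close> times its adjoint. For \<open>n > 2 r\<close> the hypothesis thus speaks
  of \<open>G G^*\<close>.\<close>

lemma rotated_off_diagonal_swap:
  assumes C: "C \<in> carrier_mat r q" and D: "D \<in> carrier_mat q r" and \<omega>: "cmod \<omega> = 1"
  shows "mat_adjoint (rotated_off_diagonal D C \<omega>) * rotated_off_diagonal D C \<omega>
    = rotated_off_diagonal C D \<omega> * mat_adjoint (rotated_off_diagonal C D \<omega>)"
proof -
  define G where "G = rotated_off_diagonal C D \<omega>"
  have G: "G \<in> carrier_mat r q" using C D by (simp add: G_def rotated_off_diagonal_def)
  have ww: "\<omega> * (cnj \<omega> * x) = x" for x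
    using \<omega> complex_norm_square[of \<omega>] by (simp add: mult.assoc[symmetric])
  have swap: "rotated_off_diagonal D C \<omega> = \<omega> \<cdot>\<^sub>m mat_adjoint G"
    unfolding G_def rotated_off_diagonal_def using C D by (intro eq_matI) (auto simp: algebra_simps ww)
  have "mat_adjoint (\<omega> \<cdot>\<^sub>m mat_adjoint G) * (\<omega> \<cdot>\<^sub>m mat_adjoint G) = G * mat_adjoint G"
    unfolding mat_adjoint_smult mat_adjoint_adjoint
    using mult_smult_assoc_mat[of G r q "\<omega> \<cdot>\<^sub>m mat_adjoint G" r "conjugate \<omega>"]
      mult_smult_distrib[of G r q "mat_adjoint G" r \<omega>] G
    by (intro eq_matI) (auto simp: ww mult.left_commute[of "cnj \<omega>" \<omega>])
  thus ?thesis unfolding swap G_def[symmetric] .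
qed

text \<open>\<open>G\<close> maps eigenvectors of \<open>G^* G\<close> to eigenvectors of
  \<open>G G^*\<close>, except possibly at the eigenvalue 0. The continuity argument accepts any
  finite superset of the spectra, so inserting 0 is harmless.\<close>

lemma spectrum_gram_subset:
  fixes G :: "complex mat"
  assumes G: "G \<in> carrier_mat r q"
  shows "spectrum (mat_adjoint G * G) \<subseteq> insert 0 (spectrum (G * mat_adjoint G))"
proof
  fix e assume "e \<in> spectrum (mat_adjoint G * G)"
  note Ga = mat_adjoint_carrier[OF G]
  obtain v where v: "v \<in> carrier_vec q" "v \<noteq> 0\<^sub>v q" "(mat_adjoint G * G) *\<^sub>v v = e \<cdot>\<^sub>v v"
    using \<open>e \<in> _\<close> G unfolding spectrum_def eigenvalue_def eigenvector_def by auto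
  note Gv = mult_mat_vec_carrier[OF G v(1)]
  have ev: "mat_adjoint G *\<^sub>v (G *\<^sub>v v) = e \<cdot>\<^sub>v v" using v(3) assoc_mult_mat_vec[OF Ga G v(1)] by simp
  show "e \<in> insert 0 (spectrum (G * mat_adjoint G))"
  proof (cases "e = 0")
    case False
    have "G *\<^sub>v v \<noteq> 0\<^sub>v r"
    proof
      assume "G *\<^sub>v v = 0\<^sub>v r"
      hence "e \<cdot>\<^sub>v v = 0\<^sub>v q" using ev mult_mat_zero_vec[OF Ga] by simp
      hence "e * v $ i = 0" if "i < q" for i using that v(1) by (metis carrier_vecD index_smult_vec(1) index_zero_vec(1))
      hence "v = 0\<^sub>v q" using False v(1) by (intro eq_vecI) auto
      thus False using v(2) by simp
    qed
    moreover have "(G * mat_adjoint G) *\<^sub>v (G *\<^sub>v v) = e \<cdot>\<^sub>v (G *\<^sub>v v)"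
      using assoc_mult_mat_vec[OF G Ga Gv] ev mult_mat_vec[OF G v(1)] by simp
    ultimately have "eigenvalue (G * mat_adjoint G) e"
      unfolding eigenvalue_def eigenvector_def using Gv G by auto
    thus ?thesis by (simp add: spectrum_def)
  qed simp
qed

text \<open>Every unimodular \<open>\<omega>\<close> lies on the path \<open>cis t\<close>, which at
  \<open>t = 0\<close> passes through \<open>C + mat_adjoint D\<close>, the matrix that defines
  \<open>s\<close>.\<close>

lemma char_poly_gram_constant:
  assumes C: "C \<in> carrier_mat r q" and D: "D \<in> carrier_mat q r" and fin: "finite S"
    and sp: "\<And>\<omega>. cmod \<omega> = 1 \<Longrightarrow> spectrum (mat_adjoint (rotated_off_diagonal C D \<omega>) * rotated_off_diagonal C D \<omega>) \<subseteq> S"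
    and \<omega>: "cmod \<omega> = 1"
  shows "char_poly (mat_adjoint (rotated_off_diagonal C D \<omega>) * rotated_off_diagonal C D \<omega>)
    = char_poly (mat_adjoint (C + mat_adjoint D) * (C + mat_adjoint D))"
proof -
  define K where "K t = mat_adjoint (rotated_off_diagonal C D (cis t)) * rotated_off_diagonal C D (cis t)" for t
  have G: "rotated_off_diagonal C D w \<in> carrier_mat r q" for w using C D by (simp add: rotated_off_diagonal_def)
  have K: "K t \<in> carrier_mat q q" for t unfolding K_def by (rule mult_carrier_mat[OF mat_adjoint_carrier[OF G] G])
  have cont: "continuous_on UNIV (\<lambda>t. K t $$ (i, j))" if ij: "i < q" "j < q" for i j
  proof -
    have "K t $$ (i, j) = (\<Sum>l<r. cnj (cis t * C $$ (l, i) + cnj (D $$ (i, l))) * (cis t * C $$ (l, j) + cnj (D $$ (j, l))))" for t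
      unfolding K_def using ij C D by (simp add: scalar_prod_def rotated_off_diagonal_def lessThan_atLeast0)
    thus ?thesis by (simp only:) (intro continuous_intros)
  qed
  have const: "char_poly (K t) = char_poly (K 0)" for t
    by (rule char_poly_constant[OF K cont fin]) (auto simp: K_def intro!: sp[THEN subsetD])
  have "\<omega> = cis (Arg \<omega>)" using \<omega> rcis_cmod_Arg[of \<omega>] by (simp add: rcis_def)
  moreover have "rotated_off_diagonal C D 1 = C + mat_adjoint D"
    unfolding rotated_off_diagonal_def using C D by (intro eq_matI) auto
  ultimately show ?thesis using const[of "Arg \<omega>"] by (simp add: K_def)
qed

text \<open>The eigenvalues are the squared norms \<open>|G u_i|^2\<close> over an eigenbasis, hence
  real and non-negative. Squaring therefore inverts \<open>sqrt (Re x)\<close>, and the multiset of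
  singular values turns back into a factorization.\<close>

lemma gram_eigenvalues:
  fixes G :: "complex mat"
  assumes G: "G \<in> carrier_mat r q"
  defines "s \<equiv> nonzero_singular_values G"
  shows "length s \<le> q" "\<And>x. x \<in> set s \<Longrightarrow> 0 < x" "sorted_wrt (\<ge>) s"
    "char_poly (mat_adjoint G * G) = (\<Prod>e\<leftarrow>map (\<lambda>x. complex_of_real (x\<^sup>2)) s @ replicate (q - length s) 0. [:- e, 1:])"
proof -
  define H where "H = mat_adjoint G * G"
  have H: "H \<in> carrier_mat q q" unfolding H_def using G by auto
  have "mat_adjoint H = H" unfolding H_def using mat_adjoint_mult[OF mat_adjoint_carrier[OF G] G] by simp
  moreover obtain es where es: "char_poly H = (\<Prod>e\<leftarrow>es. [:- e, 1:])" "length es = q" using char_poly_factorized[OF H] by blast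
  ultimately obtain U where U: "U \<in> carrier_mat q q" "mat_adjoint U * U = 1\<^sub>m q"
    "mat_adjoint U * H * U = mat_diag q (\<lambda>i. es ! i)"
    using hermitian_diagonalization[OF H] by blast
  have "es ! i = complex_of_real (sqnorm (G *\<^sub>v col U i))" if "i < q" for i
  proof -
    have c: "col U i \<in> carrier_vec q" using U(1) that by auto
    have "complex_of_real (sqnorm (G *\<^sub>v col U i)) = (mat_adjoint U * H * U) $$ (i, i)"
      using sqnorm_adjoint[OF G c] adjoint_sandwich_index[OF H U(1) U(1) that that] by (simp add: H_def)
    thus ?thesis unfolding U(3) using that by simp
  qed
  hence real: "\<exists>x\<ge>0. e = complex_of_real x" if "e \<in> set es" for e
    using that es(2) by (metis in_set_conv_nth sqnorm_nonneg)
  define R where "R = filter_mset (\<lambda>x. x \<noteq> 0) (mset es)"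
  have "proots (char_poly H) = mset es"
  proof -
    have "proots (\<Prod>e\<leftarrow>xs. [:- e, 1:]) = mset xs" for xs :: "complex list"
    proof (induction xs)
      case (Cons x xs)
      have "(\<Prod>e\<leftarrow>xs. [:- e, 1:]) \<noteq> (0 :: complex poly)" by (auto simp: prod_list_zero_iff)
      hence "proots ([:- x, 1:] * (\<Prod>e\<leftarrow>xs. [:- e, 1:])) = proots [:- x, 1:] + proots (\<Prod>e\<leftarrow>xs. [:- e, 1:])"
        by (intro proots_mult) auto
      thus ?case using Cons by (simp del: mult_pCons_left)
    qed simp
    thus ?thesis unfolding es(1) .
  qed
  hence s: "s = rev (sorted_list_of_multiset (image_mset (\<lambda>x. sqrt (Re x)) R))"
    unfolding s_def nonzero_singular_values_def H_def[symmetric] R_def by simp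
  have ms: "mset s = image_mset (\<lambda>x. sqrt (Re x)) R" unfolding s by simp
  show "0 < x" if "x \<in> set s" for x
  proof -
    have "x \<in># mset s" using that by simp
    then obtain e where e: "e \<in> set es" "e \<noteq> 0" "x = sqrt (Re e)" unfolding ms R_def by auto
    thus ?thesis using real[OF e(1)] by auto
  qed
  show "sorted_wrt (\<ge>) s" unfolding s sorted_wrt_rev using sorted_sorted_list_of_multiset by simp
  have img: "mset (map (\<lambda>x. complex_of_real (x\<^sup>2)) s) = R"
  proof -
    have "mset (map (\<lambda>x. complex_of_real (x\<^sup>2)) s) = image_mset (\<lambda>x. complex_of_real ((sqrt (Re x))\<^sup>2)) R"
      by (simp add: ms image_mset.compositionality o_def)
    also have "\<dots> = image_mset (\<lambda>x. x) R"
    proof (rule image_mset_cong)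
      fix e assume "e \<in># R"
      then obtain x where "x \<ge> 0" "e = complex_of_real x" using real[of e] unfolding R_def by auto
      thus "complex_of_real ((sqrt (Re e))\<^sup>2) = e" by simp
    qed
    finally show ?thesis by simp
  qed
  have len: "length s = size R" using arg_cong[OF img, of size] by simp
  show le: "length s \<le> q"
    unfolding len R_def using size_filter_mset_lesseq[of "\<lambda>x. x \<noteq> 0" "mset es"] es(2) by simp
  \<comment> \<open>The zeros are counted by size: \<open>q\<close> roots in all, of which
    \<open>length s\<close> are non-zero.\<close>
  have "filter_mset (\<lambda>x. \<not> x \<noteq> 0) (mset es) = replicate_mset (q - length s) 0"
  proof -
    have "filter_mset (\<lambda>x. \<not> x \<noteq> 0) (mset es) = replicate_mset (count (mset es) 0) 0"
      by (simp add: filter_eq_replicate_mset)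
    moreover have "size (mset es) = size R + size (filter_mset (\<lambda>x. \<not> x \<noteq> 0) (mset es))"
      unfolding R_def size_union[symmetric] multiset_partition[symmetric] ..
    ultimately show ?thesis using es(2) len by simp
  qed
  hence "mset es = mset (map (\<lambda>x. complex_of_real (x\<^sup>2)) s @ replicate (q - length s) 0)"
    using multiset_partition[of "mset es" "\<lambda>x. x \<noteq> 0"] unfolding mset_append img R_def[symmetric] by simp
  hence "mset (map (\<lambda>e. [:- e, 1:]) es) = mset (map (\<lambda>e. [:- e, 1:]) (map (\<lambda>x. complex_of_real (x\<^sup>2)) s @ replicate (q - length s) 0))"
    unfolding mset_map by simp
  hence "prod_list (map (\<lambda>e. [:- e, 1:]) es) = prod_list (map (\<lambda>e. [:- e, 1:]) (map (\<lambda>x. complex_of_real (x\<^sup>2)) s @ replicate (q - length s) 0))"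
    by (metis prod_mset_prod_list)
  thus "char_poly (mat_adjoint G * G) = (\<Prod>e\<leftarrow>map (\<lambda>x. complex_of_real (x\<^sup>2)) s @ replicate (q - length s) 0. [:- e, 1:])"
    using es(1) unfolding H_def by simp
qed

text \<open>Emptiness for \<open>k > m'\<close> is delicate when \<open>\<alpha> = \<beta>\<close>:
  if \<open>C\<close> and \<open>D\<close> vanish, then \<open>A\<close> is the scalar matrix
  \<open>\<alpha>\<close> and \<open>\<Lambda>_k(A) = {\<alpha>}\<close> for every
  \<open>k \<le> n\<close>. In that case emptiness is therefore asserted for
  \<open>k > n - p\<close>; for \<open>\<alpha> \<noteq> \<beta>\<close> it holds in the whole
  range.\<close>

theorem theorem3p1:
  fixes r n m m' p :: nat
    and \<alpha> \<beta> :: complex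
    and A C D :: "complex mat"
    and M :: "real \<Rightarrow> complex mat"
    and s :: "real list"
  assumes "0 < r" and "r < n"
    and "C \<in> carrier_mat r (n - r)" and "D \<in> carrier_mat (n - r) r"
    and "A = four_block_mat (\<alpha> \<cdot>\<^sub>m 1\<^sub>m r) C D (\<beta> \<cdot>\<^sub>m 1\<^sub>m (n - r))"
    and "M = (\<lambda>\<theta>. if n \<le> 2 * r then M_matrix C D \<theta> else M_matrix D C \<theta>)"
    and "\<forall>\<theta> \<in> {0..<2 * pi}. \<forall>\<phi> \<in> {0..<2 * pi}. spectrum (M \<theta>) = spectrum (M \<phi>)"
    and "s = nonzero_singular_values (C + mat_adjoint D)" and "p = length s"
    and "m = min (n - r) r" and "m' = max (n - r) r"
  shows
    "(n < 2 * r \<longrightarrow> (\<forall>k.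
        (1 \<le> k \<and> k \<le> p \<longrightarrow> rank_numerical_range k A = elliptical_disc \<alpha> \<beta> (s ! (k - 1))) \<and>
        (p < k \<and> k \<le> m \<longrightarrow> rank_numerical_range k A = closed_segment \<alpha> \<beta>) \<and>
        (m < k \<and> k \<le> m' \<longrightarrow> rank_numerical_range k A = {\<alpha>}) \<and>
        (m' < k \<and> k \<le> n \<and> (\<alpha> \<noteq> \<beta> \<or> n - p < k) \<longrightarrow> rank_numerical_range k A = {}))) \<and>
     (2 * r < n \<longrightarrow> (\<forall>k.
        (1 \<le> k \<and> k \<le> p \<longrightarrow> rank_numerical_range k A = elliptical_disc \<alpha> \<beta> (s ! (k - 1))) \<and>
        (p < k \<and> k \<le> m \<longrightarrow> rank_numerical_range k A = closed_segment \<alpha> \<beta>) \<and>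
        (m < k \<and> k \<le> m' \<longrightarrow> rank_numerical_range k A = {\<beta>}) \<and>
        (m' < k \<and> k \<le> n \<and> (\<alpha> \<noteq> \<beta> \<or> n - p < k) \<longrightarrow> rank_numerical_range k A = {}))) \<and>
     (n = 2 * r \<longrightarrow> (\<forall>k.
        (1 \<le> k \<and> k \<le> p \<longrightarrow> rank_numerical_range k A = elliptical_disc \<alpha> \<beta> (s ! (k - 1))) \<and>
        (p < k \<and> k \<le> n div 2 \<longrightarrow> rank_numerical_range k A = closed_segment \<alpha> \<beta>) \<and>
        (n div 2 < k \<and> k \<le> n \<and> (\<alpha> \<noteq> \<beta> \<or> n - p < k) \<longrightarrow> rank_numerical_range k A = {}))) \<and>
     numerical_range A = elliptical_disc \<alpha> \<beta> (spectral_norm (C + mat_adjoint D))"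
proof -
  define q where "q = n - r"
  have q: "0 < q" "n = r + q" using assms(2) by (auto simp: q_def)
  have C: "C \<in> carrier_mat r q" and D: "D \<in> carrier_mat q r" using assms(3,4) by (auto simp: q_def)
  have CD: "C + mat_adjoint D \<in> carrier_mat r q" using C D by simp
  have M0: "M 0 \<in> carrier_mat (if n \<le> 2 * r then q else r) (if n \<le> 2 * r then q else r)"
    using C D by (auto simp: assms(6) M_matrix_def hermitian_part_def)
  \<comment> \<open>0 is added because for \<open>n > 2 r\<close> the matrix \<open>M 0\<close> has
    size \<open>r\<close> instead of \<open>q\<close> and is sure to share only the non-zero
    eigenvalues with the Gram matrix.\<close>
  have fin: "finite (insert 0 (spectrum (M 0)))" using card_finite_spectrum(1)[OF M0] by simp
  have sp: "spectrum (mat_adjoint (rotated_off_diagonal C D \<omega>) * rotated_off_diagonal C D \<omega>) \<subseteq> insert 0 (spectrum (M 0))"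
    if \<omega>: "cmod \<omega> = 1" for \<omega>
  proof -
    \<comment> \<open>The angle is taken from \<open>cnj \<omega>\<close>, since
      \<open>M(\<theta>)\<close> belongs to \<open>\<omega> = cis (- 2 * \<theta>)\<close>; then
      \<open>\<theta> = t / 2\<close> lies in the interval of the hypothesis.\<close>
    have "(Re (cnj \<omega>))\<^sup>2 + (Im (cnj \<omega>))\<^sup>2 = 1" using \<omega> cmod_power2[of \<omega>] by simp
    then obtain t where t: "0 \<le> t" "t < 2 * pi" "Re (cnj \<omega>) = cos t" "Im (cnj \<omega>) = sin t"
      using sincos_total_2pi by metis
    have \<omega>t: "\<omega> = cis (- 2 * (t / 2))" using t(3,4) by (simp add: complex_eq_iff)
    have "t / 2 \<in> {0..<2 * pi}" "0 \<in> {0..<2 * pi}" using t(1,2) by auto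
    hence M: "spectrum (M (t / 2)) = spectrum (M 0)" using assms(7) by blast
    show ?thesis
    proof (cases "n \<le> 2 * r")
      case True
      have "mat_adjoint (rotated_off_diagonal C D \<omega>) * rotated_off_diagonal C D \<omega> = M (t / 2)"
        using M_matrix_eq[OF C D, of "t / 2"] True by (simp add: assms(6) \<omega>t)
      thus ?thesis using M by auto
    next
      case False
      have "rotated_off_diagonal C D \<omega> * mat_adjoint (rotated_off_diagonal C D \<omega>) = M (t / 2)"
        using M_matrix_eq[OF D C, of "t / 2"] False rotated_off_diagonal_swap[OF C D \<omega>] by (simp add: assms(6) \<omega>t)
      moreover have "rotated_off_diagonal C D \<omega> \<in> carrier_mat r q" using C D by (simp add: rotated_off_diagonal_def)
      ultimately show ?thesis using spectrum_gram_subset M by metis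
    qed
  qed
  note ev = gram_eigenvalues[OF CD, folded assms(8)]
  interpret S: scalar_block_matrix r q \<alpha> \<beta> C D s
    using C D ev char_poly_gram_constant[OF C D fin sp] by unfold_locales auto
  have A: "A = S.A" unfolding assms(5) S.A_def by (simp only: q_def)
  have G1: "rotated_off_diagonal C D 1 = C + mat_adjoint D"
    unfolding rotated_off_diagonal_def using C D by (intro eq_matI) auto
  have num: "numerical_range A = elliptical_disc \<alpha> \<beta> (spectral_norm (C + mat_adjoint D))"
    using S.numerical_range_ellipse[OF assms(1) q(1)] unfolding A G1 .
  have r1: "rank_numerical_range k A = elliptical_disc \<alpha> \<beta> (s ! (k - 1))" if "1 \<le> k" "k \<le> p" for k
    using S.rank_range_ellipse that unfolding A assms(9) by blast
  have r2: "rank_numerical_range k A = closed_segment \<alpha> \<beta>" if "p < k" "k \<le> r" "k \<le> q" for k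
    using S.rank_range_segment that unfolding A assms(9) by blast
  have r3: "rank_numerical_range k A = {\<alpha>}" if "q < k" "k \<le> r" for k
    using S.rank_range_alpha that unfolding A by blast
  have r4: "rank_numerical_range k A = {\<beta>}" if "r < k" "k \<le> q" for k
    using S.rank_range_beta that unfolding A by blast
  have r5: "rank_numerical_range k A = {}" if "r < k" "q < k" "\<alpha> \<noteq> \<beta> \<or> n - p < k" for k
    using S.rank_range_empty that unfolding A q(2) assms(9) by blast
  have m: "m = min q r" "m' = max q r" using assms(10,11) by (auto simp: q_def)
  show ?thesis
    using num r1 r2 r3 r4 r5 q(2) unfolding m by auto
qed

end
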